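(* Let $k\ge 3$ be a fixed integer, let $R$ be a finite commutative principal ring, let $P$ and $Q$ be probability distributions on $R$, and let $\hat P=P^{\otimes k}$. Suppose that $(\hat P,Q)$ satisfies (A1) and (A2). Set $$\alpha_{P,Q}=\frac{\sum_{i=1}^{\ell(P,Q)}k(k-1)^{i-1}}{1+\sum_{i=1}^{\ell(P,Q)}k(k-1)^{i-1}},$$ with $\alpha_{P,Q}=1$ if $\ell(P,Q)=\infty$. Then, for $m=m(n)$, $$\lim_{n\to\infty}\mathbb P[\mathbf B x=\mathbf b\text{ is satisfiable}]=\begin{cases}1 & \text{if } m\ll n^{\alpha_{P,Q}},\\ 0&\text{if } m\gg n^{\alpha_{P,Q}}.\end{cases}$$ Moreover, if $\alpha_{P,Q}<1$ and $m=\lceil Cn^{\alpha_{P,Q}}\rceil$, then for every fixed $C>0$, $$0<\liminf_{n\to\infty}\mathbb P[\mathbf B x=\mathbf b\text{ is satisfiable}]\le\limsup_{n\to\infty}\mathbb P[\mathbf B x=\mathbf b\text{ is satisfiable}]<1.$$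
   Context: Rings are finite, commutative, with identity; a ring is principal if every ideal is principal; $(r)=rR$. Random system. For $n\ge k$ let $C_m=\{a_1,\dots,a_m\}$ and $V_n=\{v_1,\dots,v_n\}$ be disjoint index sets. Given a distribution $\hat P$ on $R^k$ and a distribution $Q$ on $R$, the random matrix $\mathbf B\in R^{C_m\times V_n}$ is defined as follows: independently for each $a\in C_m$, choose $j_1<\dots<j_k$ (a $k$-subset of $[n]$) uniformly at random, sample $(\sigma_1,\dots,\sigma_k)$ from $\hat P$, set $\mathbf B_{a,v_{j_i}}=\sigma_i$ for $1\le i\le k$, and set all other entries of row $a$ to $0$. The vector $\mathbf b\in R^{C_m}$ is independent of $\mathbf B$ and has i.i.d. entries with distribution $Q$. The system $\mathbf Bx=\mathbf b$ is satisfiable if some $x\in R^{V_n}$ satisfies it. $P^{\otimes k}$ is the $k$-fold product measure. (A1): there exist $(a_1,\dots,a_k)\in\operatorname{supp}(\hat P)$ and $b\in\operatorname{supp}(Q)$ such that $b$ lies in the ideal generated by $a_1,\dots,a_k$. (A2): there is no $\sigma\in R$ such that $\sum_{i=1}^k a_i\sigma=b$ for all $(a_1,\dots,a_k)\in\operatorname{supp}(\hat P)$ and all $b\in\operatorname{supp}(Q)$. Ideals. For an ideal $I$ and $s\in R$, $(I:s)=\{t\in R: st\in I\}$. Define $I_0(P)=\bigcap_{r\in\operatorname{supp}(P)}(r)$ and, for $\ell\ge1$, $$I_\ell(P)=\bigcap_{r\in\operatorname{supp}(P)}r\Big(\bigcap_{s\in\operatorname{supp}(P)}(I_{\ell-1}(P):s)\Big).$$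 Define $\ell(P,Q)=\inf\{\ell\ge0:\operatorname{supp}(Q)\not\subseteq I_\ell(P)\}$, with $\inf\emptyset=\infty$. $f(n)\ll g(n)$ means $f(n)/g(n)\to0$, and $f\gg g$ means $g\ll f$; $m=m(n)$ is a sequence of nonnegative integers. *)

theory Defs
  imports "HOL-Probability.Probability" "HOL-Library.Landau_Symbols" "HOL-Library.Extended_Nat"
begin

text \<open>
  Finite commutative rings with identity are types of class \<open>{comm_ring_1, finite}\<close>. This class
  has \<open>0 \<noteq> 1\<close>; the zero ring is not lost, because it never satisfies condition \<open>A2\<close>.
  Index sets are \<open>{..<k}\<close>, \<open>{..<m}\<close>, \<open>{..<n}\<close>, and a tuple in \<open>R\<^sup>k\<close> is a function on \<open>nat\<close>
  of which only the arguments below \<open>k\<close> matter.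
\<close>

subsection \<open>Ideals\<close>

text \<open>Ideals are the submodules of the ring as a module over itself.\<close>

lemma module_times: "module ((*) :: 'r::comm_ring_1 \<Rightarrow> 'r \<Rightarrow> 'r)"
  by unfold_locales (simp_all add: algebra_simps)

abbreviation is_ideal :: "'r::comm_ring_1 set \<Rightarrow> bool" where
  "is_ideal \<equiv> module.subspace (*)"

abbreviation ideal_gen :: "'r::comm_ring_1 set \<Rightarrow> 'r set" where
  "ideal_gen \<equiv> module.span (*)"

lemma is_ideal_iff:
  "is_ideal (I :: 'r::comm_ring_1 set) \<longleftrightarrow>
     0 \<in> I \<and> (\<forall>x\<in>I. \<forall>y\<in>I. x + y \<in> I) \<and> (\<forall>r. \<forall>x\<in>I. r * x \<in> I)"
  by (simp add: module.subspace_def[OF module_times])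

lemma ideal_gen_eq_Inter:
  "ideal_gen (S :: 'r::comm_ring_1 set) = \<Inter>{I. is_ideal I \<and> S \<subseteq> I}"
  by (simp add: module.span_def[OF module_times] hull_def)

definition principal :: "'r::comm_ring_1 \<Rightarrow> 'r set" where
  "principal r = range ((*) r)"

definition principal_ring :: "'r::comm_ring_1 itself \<Rightarrow> bool" where
  "principal_ring _ \<longleftrightarrow> (\<forall>I :: 'r set. is_ideal I \<longrightarrow> (\<exists>r. I = principal r))"

definition ideal_quotient :: "'r::comm_ring_1 set \<Rightarrow> 'r \<Rightarrow> 'r set" where
  "ideal_quotient I s = {t. s * t \<in> I}"

fun level_ideal :: "'r::comm_ring_1 pmf \<Rightarrow> nat \<Rightarrow> 'r set" where
  "level_ideal P 0 = (\<Inter>r\<in>set_pmf P. principal r)"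
| "level_ideal P (Suc l) =
     (\<Inter>r\<in>set_pmf P. (*) r ` (\<Inter>s\<in>set_pmf P. ideal_quotient (level_ideal P l) s))"

definition level :: "'r::comm_ring_1 pmf \<Rightarrow> 'r pmf \<Rightarrow> enat" where
  "level P Q = (INF l\<in>{l. \<not> set_pmf Q \<subseteq> level_ideal P l}. enat l)"

definition alpha :: "nat \<Rightarrow> 'r::comm_ring_1 pmf \<Rightarrow> 'r pmf \<Rightarrow> real" where
  "alpha k P Q = (case level P Q of
       enat l \<Rightarrow> (let S = (\<Sum>i=1..l. real k * (real k - 1) ^ (i - 1)) in S / (1 + S))
     | \<infinity> \<Rightarrow> 1)"

subsection \<open>The random system\<close>

definition power_pmf :: "nat \<Rightarrow> 'r::zero pmf \<Rightarrow> (nat \<Rightarrow> 'r) pmf" where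
  "power_pmf k P = Pi_pmf {..<k} 0 (\<lambda>_. P)"

text \<open>
  For \<open>v \<in> J\<close>, the number of elements of \<open>J\<close> below \<open>v\<close> is the (zero-based) position of \<open>v\<close> in the
  increasing enumeration of \<open>J\<close>. The definition is meaningful only for \<open>k \<le> n\<close>.
\<close>

definition row_pmf :: "nat \<Rightarrow> nat \<Rightarrow> (nat \<Rightarrow> 'r::zero) pmf \<Rightarrow> (nat \<Rightarrow> 'r) pmf" where
  "row_pmf k n Phat =
     bind_pmf (pmf_of_set {J. J \<subseteq> {..<n} \<and> card J = k}) (\<lambda>J.
       map_pmf (\<lambda>\<sigma> v. if v \<in> J then \<sigma> (card {u\<in>J. u < v}) else 0) Phat)"

definition system_pmf ::
  "nat \<Rightarrow> nat \<Rightarrow> nat \<Rightarrow> (nat \<Rightarrow> 'r::zero) pmf \<Rightarrow> 'r pmf \<Rightarrow> ((nat \<Rightarrow> nat \<Rightarrow> 'r) \<times> (nat \<Rightarrow> 'r)) pmf" where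
  "system_pmf k n m Phat Q =
     pair_pmf (Pi_pmf {..<m} (\<lambda>_. 0) (\<lambda>_. row_pmf k n Phat)) (Pi_pmf {..<m} 0 (\<lambda>_. Q))"

definition satisfiable :: "nat \<Rightarrow> nat \<Rightarrow> (nat \<Rightarrow> nat \<Rightarrow> 'r::comm_ring_1) \<Rightarrow> (nat \<Rightarrow> 'r) \<Rightarrow> bool" where
  "satisfiable m n B b \<longleftrightarrow> (\<exists>x :: nat \<Rightarrow> 'r. \<forall>a<m. (\<Sum>v<n. B a v * x v) = b a)"

definition sat_prob :: "nat \<Rightarrow> (nat \<Rightarrow> 'r::comm_ring_1) pmf \<Rightarrow> 'r pmf \<Rightarrow> nat \<Rightarrow> nat \<Rightarrow> real" where
  "sat_prob k Phat Q n m =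
     measure_pmf.prob (system_pmf k n m Phat Q) {(B, b). satisfiable m n B b}"

definition A1 :: "nat \<Rightarrow> (nat \<Rightarrow> 'r::comm_ring_1) pmf \<Rightarrow> 'r pmf \<Rightarrow> bool" where
  "A1 k Phat Q \<longleftrightarrow> (\<exists>a\<in>set_pmf Phat. \<exists>b\<in>set_pmf Q. b \<in> ideal_gen (a ` {..<k}))"

definition A2 :: "nat \<Rightarrow> (nat \<Rightarrow> 'r::comm_ring_1) pmf \<Rightarrow> 'r pmf \<Rightarrow> bool" where
  "A2 k Phat Q \<longleftrightarrow>
     \<not> (\<exists>\<sigma>. \<forall>a\<in>set_pmf Phat. \<forall>b\<in>set_pmf Q. (\<Sum>i<k. a i * \<sigma>) = b)"

text \<open>
  The relation \<open>f \<lless> g\<close> is rendered by \<open>f \<in> o(g)\<close> rather than by convergence of the quotient to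
  \<open>0\<close>: as \<open>x / 0 = 0\<close> in HOL, the latter would count sequences \<open>m\<close> that vanish as \<open>m \<ggreater> g\<close>.
\<close>

end

theory Submission
  imports Defs "HOL-Real_Asymp.Real_Asymp"
begin

text \<open>
  Satisfiability. By linearity it suffices to solve, for each row \<open>f\<close>, the system in which the
  right-hand sides of all other rows are replaced by \<open>0\<close>. Putting a value at a vertex \<open>v\<close> of \<open>f\<close>
  disturbs the other rows through \<open>v\<close>; each is repaired at one of its other vertices, and so on.
  The ideals \<open>I\<^sub>l\<close> are made so that this process ends at depth \<open>l\<close> unless a tree of
  \<open>1 + (\<Sum>i=1..l. k (k-1)\<^bsup>i-1\<^esup>)\<close> rows contains \<open>f\<close>, and connected sets of that many rows are counted by a
  union bound. At the threshold they are boundedly many with positive probability, and they are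
  harmless if all their coefficients agree.

  Unsatisfiability. An idempotent \<open>e\<close> separates some \<open>b \<in> supp Q\<close> from \<open>I\<^sub>l\<close> in such a way that the
  multiples of \<open>e\<close> are comparable under divisibility. Let \<open>e r\<close> be the least and \<open>e s\<close> the greatest
  multiple with \<open>r, s \<in> supp P\<close>. A row with coefficient \<open>s\<close> at \<open>v\<close> and \<open>r\<close> elsewhere passes constraints
  modulo the \<open>I\<^sub>j\<close> on to \<open>v\<close>, and a row with all coefficients \<open>r\<close>, right-hand side \<open>b\<close> and all
  vertices constrained at depth \<open>l\<close> is contradictory. Splitting the rows into \<open>l + 1\<close> batches, each batch
  produces the constrained vertices of the next depth. If the level is infinite, a first moment bound
  over all assignments suffices.
\<close>

section \<open>Rings in which every ideal is principal\<close>

text \<open>The exponent is a first moment computation. In a connected list of t rows each row after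
  the first must hit one of boundedly many vertices, so about m^t / n^(t-1) such lists are expected.
  For t = 1 + s with s = \<open>k * obstruction_size k l\<close> this is of constant order when m is
  n^(s/(1+s)), and s/(1+s) is \<open>alpha\<close>. The obstruction must also appear at that scale:
  about n^(1 - N/(1+s)) vertices are constrained at depth j, where N =
  \<open>obstruction_size k j\<close>, because a row constrains a further vertex only if its other
  k-1 vertices are already constrained. Two obstacles shape the proof. On the unsatisfiable side the
  intersections that define the ideals may be witnessed by different coefficients at each depth; the
  ordering produced by \<open>e\<close> lets one pair r, s witness all of them. On the satisfiable
  side a repair may run around a cycle and return to a row already treated. Measuring an assignment
  by what it contributes to each row makes such returns harmless; cycles then matter only for the
  size of a blocking family, and lists with an extra incidence are rare enough to exclude.\<close>

lemma finite_ring_idempotent_power: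
  fixes x :: "'r::{comm_ring_1, finite}"
  obtains N where "N \<ge> 1" "x ^ N * x ^ N = x ^ N"
proof -
  have "\<not> inj (\<lambda>i::nat. x ^ Suc i)"
    using finite_imageD[of "\<lambda>i::nat. x ^ Suc i" UNIV] by auto
  then obtain i' j' :: nat where "i' \<noteq> j'" "x ^ Suc i' = x ^ Suc j'"
    by (auto simp: inj_on_def)
  then obtain i p where i: "i \<ge> 1" "p \<ge> 1" "x ^ i = x ^ (i + p)"
  proof (cases "i' < j'")
    case True
    with that[of "Suc i'" "j' - i'"] \<open>x ^ Suc i' = x ^ Suc j'\<close> show ?thesis by simp
  next
    case False
    with that[of "Suc j'" "i' - j'"] \<open>x ^ Suc i' = x ^ Suc j'\<close> \<open>i' \<noteq> j'\<close> show ?thesis by simp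
  qed
  have per: "x ^ (i + c * p) = x ^ i" for c
  proof (induction c)
    case (Suc c)
    have "x ^ (i + Suc c * p) = x ^ (i + c * p) * x ^ p" by (simp add: power_add)
    also have "\<dots> = x ^ (i + p)" unfolding Suc by (simp only: power_add)
    finally show ?case using i(3) by simp
  qed simp
  \<comment> \<open>The exponent \<open>i * p\<close> is a multiple of the period and at least
    \<open>i\<close>, so doubling it only adds full periods.\<close>
  have "x ^ (i * p) * x ^ (i * p) = x ^ (i + i * p) * x ^ (i * p - i)"
    using i(2) by (simp flip: power_add)
  also have "x ^ (i + i * p) = x ^ i" by (rule per)
  also have "x ^ i * x ^ (i * p - i) = x ^ (i + (i * p - i))" by (simp only: power_add)
  also have "i + (i * p - i) = i * p" using i(2) by simp
  finally show ?thesis using that[of "i * p"] i(1,2) by simp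
qed

text \<open>
  The summand of the ring cut out by a primitive idempotent is local, and in a local ring whose
  two-generated ideals are principal any two elements are comparable under divisibility.
\<close>

lemma primitive_idempotent_chain:
  fixes e :: "'r::{comm_ring_1, finite}"
  assumes prin: "principal_ring TYPE('r)" and e: "e * e = e"
    and prim: "\<And>f. f * f = f \<Longrightarrow> e * f = f \<Longrightarrow> f = 0 \<or> f = e"
  shows "(\<exists>z. e * x = e * y * z) \<or> (\<exists>z. e * y = e * x * z)"
proof -
  define I where "I = {u * (e * x) + v * (e * y) | u v. True}"
  have "is_ideal I"
    unfolding is_ideal_iff
  proof (intro conjI ballI allI)
    show "0 \<in> I" unfolding I_def by (auto intro!: exI[of _ 0])
  next
    fix a b assume "a \<in> I" "b \<in> I"
    then obtain u v u' v' where "a = u * (e * x) + v * (e * y)" "b = u' * (e * x) + v' * (e * y)"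
      unfolding I_def by blast
    then have "a + b = (u + u') * (e * x) + (v + v') * (e * y)" by (simp add: algebra_simps)
    then show "a + b \<in> I" unfolding I_def by blast
  next
    fix r a assume "a \<in> I"
    then obtain u v where "a = u * (e * x) + v * (e * y)"
      unfolding I_def by blast
    then have "r * a = (r * u) * (e * x) + (r * v) * (e * y)" by (simp add: algebra_simps)
    then show "r * a \<in> I" unfolding I_def by blast
  qed
  then obtain d where d: "I = principal d" using prin unfolding principal_ring_def by blast
  have "1 * (e * x) + 0 * (e * y) \<in> I" "0 * (e * x) + 1 * (e * y) \<in> I" unfolding I_def by blast+
  then obtain x' y' where x': "e * x = d * x'" and y': "e * y = d * y'"
    unfolding d principal_def by auto
  have "d \<in> I" unfolding d principal_def by (metis mult.right_neutral rangeI)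
  then obtain u v where uv: "d = u * (e * x) + v * (e * y)" unfolding I_def by blast
  have "e * x * e = e * x" "e * y * e = e * y"
    using e by (metis mult.assoc mult.commute)+
  then have de: "d * e = d" unfolding uv by (simp add: distrib_right mult.assoc)
  \<comment> \<open>\<open>e * z ^ n\<close> is an idempotent below \<open>e\<close>, hence
    \<open>0\<close> or \<open>e\<close>: in the summand cut out by \<open>e\<close> every element
    is nilpotent or a unit with inverse \<open>w\<close>.\<close>
  have local: "e * z * w = e \<or> (\<exists>N. e * z ^ N = 0)" if "w = (z ^ (n - 1))" "n \<ge> 1" "z ^ n * z ^ n = z ^ n" for z w n
  proof -
    have "(e * z ^ n) * (e * z ^ n) = (e * e) * (z ^ n * z ^ n)" by (simp only: mult_ac)
    then have "(e * z ^ n) * (e * z ^ n) = e * z ^ n" by (simp only: e that(3))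
    moreover have "e * (e * z ^ n) = e * z ^ n" by (simp only: e flip: mult.assoc)
    ultimately have "e * z ^ n = 0 \<or> e * z ^ n = e" using prim by blast
    moreover have "e * z ^ n = e * z * w" using that by (cases n) auto
    ultimately show ?thesis by metis
  qed
  have dich: "(\<exists>w. e * z * w = e) \<or> (\<exists>N. e * z ^ N = 0)" for z
  proof -
    obtain N where "N \<ge> 1" "z ^ N * z ^ N = z ^ N" using finite_ring_idempotent_power .
    then show ?thesis using local[OF refl] by blast
  qed
  \<comment> \<open>If \<open>u * x'\<close> is a unit of the summand, then \<open>d\<close> is a
    multiple of \<open>d * x' = e * x\<close>, and so is \<open>e * y\<close>.\<close>
  have fin: "\<exists>z. e * y = e * x * z" if "e * (u * x') * w = e" for w
  proof -
    have "d = d * e" by (simp add: de)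
    also have "\<dots> = (d * x') * (e * u * w)" by (subst that[symmetric]) (simp add: mult_ac)
    finally have "d = e * x * (e * u * w)" by (simp add: x')
    then have "e * y = e * x * ((e * u * w) * y')" using y' by (simp add: mult_ac)
    then show ?thesis by blast
  qed
  have fin': "\<exists>z. e * x = e * y * z" if "e * (v * y') * w = e" for w
  proof -
    have "d = d * e" by (simp add: de)
    also have "\<dots> = (d * y') * (e * v * w)" by (subst that[symmetric]) (simp add: mult_ac)
    finally have "d = e * y * (e * v * w)" by (simp add: y')
    then have "e * x = e * y * ((e * v * w) * x')" using x' by (simp add: mult_ac)
    then show ?thesis by blast
  qed
  \<comment> \<open>If neither is a unit, both are nilpotent. On multiples of \<open>d\<close> the
    geometric series \<open>g\<close> inverts \<open>1 - a\<close>, so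
    \<open>d * (1 - a) = d * b\<close> becomes \<open>d = d * (b * g)\<close> with a nilpotent
    factor, and iterating gives \<open>d = 0\<close>.\<close>
  have "d = 0" if N: "e * (u * x') ^ N = 0" and M: "e * (v * y') ^ M = 0" for N M
  proof -
    define a b where "a = u * x'" and "b = v * y'"
    have dab: "d = d * a + d * b"
      using uv x' y' by (simp add: a_def b_def mult_ac)
    define g where "g = (\<Sum>i<N. a ^ i)"
    have "(1 - a) * g = 1 - a ^ N"
      unfolding g_def by (simp add: one_diff_power_eq)
    then have "d * (1 - a) * g = d * e * (1 - a ^ N)" by (simp add: mult.assoc de)
    also have "\<dots> = d * e - d * (e * a ^ N)" by (simp only: right_diff_distrib mult_1_right mult.assoc)
    also have "\<dots> = d" using N de by (simp add: a_def)
    finally have "d = d * (1 - a) * g" by simp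
    also have "d * (1 - a) = d * b" using dab by (simp add: algebra_simps)
    finally have step: "d = d * (b * g)" by (simp add: mult.assoc)
    have "d = d * (b * g) ^ i" for i
    proof (induction i)
      case (Suc i)
      have "d * (b * g) ^ Suc i = d * (b * g) * (b * g) ^ i" by (simp only: power_Suc mult.assoc)
      then show ?case using Suc step by simp
    qed simp
    then have "d = d * (b * g) ^ M" .
    also have "\<dots> = (d * e) * (b * g) ^ M" by (simp only: de)
    also have "\<dots> = d * (e * b ^ M) * g ^ M" by (simp only: power_mult_distrib mult.assoc)
    finally show ?thesis using M by (simp add: b_def)
  qed
  moreover have ?thesis if "d = 0"
    using that x' by (auto intro: exI[of _ 0])
  ultimately show ?thesis
    using dich[of "u * x'"] dich[of "v * y'"] fin fin' by blast
qed

text \<open>If \<open>e\<close> splits as \<open>f + (e - f)\<close>, then \<open>f * b\<close> and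
  \<open>(e - f) * b\<close> cannot both lie in the ideal. So an idempotent that still separates
  \<open>b\<close> and has the fewest multiples is primitive.\<close>

lemma separating_idempotent:
  fixes b :: "'r::{comm_ring_1, finite}"
  assumes prin: "principal_ring TYPE('r)" and I: "is_ideal I" and b: "b \<notin> I"
  obtains e where "e * b \<notin> I"
    "\<And>x y. (\<exists>z. e * x = e * y * z) \<or> (\<exists>z. e * y = e * x * z)"
proof -
  define E where "E = {e. e * e = e \<and> e * b \<notin> I}"
  have "1 \<in> E" using b by (simp add: E_def)
  then obtain e where e: "e \<in> E" and min: "\<And>f. f \<in> E \<Longrightarrow> card (range ((*) e)) \<le> card (range ((*) f))"
    using ex_has_least_nat[of "\<lambda>e. e \<in> E" 1 "\<lambda>e. card (range ((*) e))"] by blast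
  have small: "f = e" if f: "f \<in> E" "e * f = f" for f
  proof -
    have "range ((*) f) \<subseteq> range ((*) e)"
    proof
      fix x assume "x \<in> range ((*) f)"
      then obtain t where "x = e * (f * t)" using f(2) by (auto simp flip: mult.assoc)
      then show "x \<in> range ((*) e)" by blast
    qed
    then have "range ((*) f) = range ((*) e)"
      using min[OF f(1)] by (simp add: card_seteq)
    moreover have "e * 1 \<in> range ((*) e)" by blast
    ultimately obtain t where t: "e = f * t" by auto
    have "f * f = f" using f(1) by (simp add: E_def)
    then have "f * e = e" unfolding t by (simp flip: mult.assoc)
    then show ?thesis using f(2) by (simp add: mult.commute)
  qed
  have "f = 0 \<or> f = e" if f: "f * f = f" "e * f = f" for f
  proof (cases "f * b \<in> I")
    case False
    then show ?thesis using small[of f] f by (simp add: E_def)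
  next
    case True
    have ee: "e * e = e" using e by (simp add: E_def)
    have "(e - f) * b \<notin> I"
    proof
      assume "(e - f) * b \<in> I"
      then have "(e - f) * b + f * b \<in> I" using True I unfolding is_ideal_iff by blast
      then show False using e by (simp add: E_def algebra_simps)
    qed
    moreover have "(e - f) * (e - f) = e - f" "e * (e - f) = e - f"
      using f ee by (simp_all add: algebra_simps)
    ultimately have "e - f = e" using small[of "e - f"] by (simp add: E_def)
    then show ?thesis by simp
  qed
  then show ?thesis
    using that[of e] e primitive_idempotent_chain[OF prin, of e] unfolding E_def by blast
qed

section \<open>Level ideals and extremal coefficients\<close>

lemma is_ideal_times_image:
  assumes "is_ideal K"
  shows "is_ideal ((*) r ` K)"
  unfolding is_ideal_iff
proof (intro conjI ballI allI)
  show "0 \<in> (*) r ` K" using assms unfolding is_ideal_iff by (auto intro!: image_eqI[of _ _ 0])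
next
  fix x y assume "x \<in> (*) r ` K" "y \<in> (*) r ` K"
  then obtain u v where "x = r * u" "y = r * v" "u \<in> K" "v \<in> K" by blast
  then show "x + y \<in> (*) r ` K"
    using assms unfolding is_ideal_iff by (auto intro!: image_eqI[of _ _ "u + v"] simp: distrib_left)
next
  fix t x assume "x \<in> (*) r ` K"
  then obtain u where "x = r * u" "u \<in> K" by blast
  then show "t * x \<in> (*) r ` K"
    using assms unfolding is_ideal_iff by (auto intro!: image_eqI[of _ _ "t * u"] simp: mult.left_commute)
qed

lemma is_ideal_INT:
  assumes "\<And>i. i \<in> A \<Longrightarrow> is_ideal (I i)"
  shows "is_ideal (\<Inter>i\<in>A. I i)"
  using assms unfolding is_ideal_iff by blast

lemma is_ideal_level_ideal: "is_ideal (level_ideal P l)"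
proof (induction l)
  case 0
  have "is_ideal (principal r)" for r :: 'a
    unfolding principal_def by (rule is_ideal_times_image) (simp add: is_ideal_iff)
  then show ?case unfolding level_ideal.simps by (rule is_ideal_INT)
next
  case (Suc l)
  then have "is_ideal (ideal_quotient (level_ideal P l) s)" for s
    unfolding ideal_quotient_def is_ideal_iff by (simp add: distrib_left mult.left_commute)
  then show ?case unfolding level_ideal.simps
    by (intro is_ideal_INT is_ideal_times_image)
qed

text \<open>Formulated for a total preorder because divisibility is not antisymmetric; it gives the
  least and, with the relation reversed, the greatest coefficient.\<close>

lemma finite_total_extremum:
  assumes "finite F" "F \<noteq> {}"
    and total: "\<And>x y. Q x y \<or> Q y x" and trans: "\<And>x y z. Q x y \<Longrightarrow> Q y z \<Longrightarrow> Q x z"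
  shows "\<exists>m\<in>F. \<forall>x\<in>F. Q m x"
  using assms(1,2)
proof (induction F rule: finite_ne_induct)
  case (singleton x)
  then show ?case using total by blast
next
  case (insert x F)
  then show ?case using total trans by (metis insert_iff)
qed

text \<open>Under the order on the multiples of \<open>e\<close>, the outer intersection in
  \<open>level_ideal\<close> is decided by the coefficient generating the smallest ideal,
  \<open>r\<close>, and the inner one by the coefficient generating the largest, \<open>s\<close>.
  The same pair serves every depth, so that one kind of row can be used in all rounds.\<close>

lemma extremal_coefficients:
  fixes P :: "'r::{comm_ring_1, finite} pmf"
  assumes chain: "\<And>x y. (\<exists>z. e * x = e * y * z) \<or> (\<exists>z. e * y = e * x * z)"
  obtains r s where "r \<in> set_pmf P" "s \<in> set_pmf P"
    "\<And>y. e * r * y \<in> level_ideal P 0"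
    "\<And>y l. e * s * y \<in> level_ideal P l \<Longrightarrow> e * r * y \<in> level_ideal P (Suc l)"
proof -
  define D where "D = (\<lambda>x y. \<exists>z. e * x = e * y * z)"
  have tot: "D x y \<or> D y x" for x y using chain by (simp add: D_def)
  have tr: "D x z" if "D x y" "D y z" for x y z
    using that unfolding D_def by (metis mult.assoc)
  obtain r where r: "r \<in> set_pmf P" "\<And>x. x \<in> set_pmf P \<Longrightarrow> D r x"
  proof -
    have "\<exists>r\<in>set_pmf P. \<forall>x\<in>set_pmf P. D r x"
      by (rule finite_total_extremum[of "set_pmf P" D, OF finite set_pmf_not_empty tot]) (rule tr)
    with that show thesis by blast
  qed
  obtain s where s: "s \<in> set_pmf P" "\<And>x. x \<in> set_pmf P \<Longrightarrow> D x s"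
  proof -
    have "\<exists>s\<in>set_pmf P. \<forall>x\<in>set_pmf P. D x s"
      by (rule finite_total_extremum[of "set_pmf P" "\<lambda>x y. D y x", OF finite set_pmf_not_empty tot])
        (rule tr)
    with that show thesis by blast
  qed
  show ?thesis
  proof (rule that[OF r(1) s(1)])
    fix y
    show "e * r * y \<in> level_ideal P 0"
    proof (clarsimp simp: principal_def)
      fix x assume "x \<in> set_pmf P"
      then obtain z where "e * r = e * x * z" using r(2) by (auto simp: D_def)
      then have "e * r * y = x * (e * z * y)" by (simp add: mult_ac)
      then show "e * r * y \<in> range ((*) x)" by blast
    qed
  next
    fix y l assume *: "e * s * y \<in> level_ideal P l"
    show "e * r * y \<in> level_ideal P (Suc l)"
    proof (clarsimp simp: ideal_quotient_def)
      fix x assume "x \<in> set_pmf P"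
      then obtain z where z: "e * r = e * x * z" using r(2) by (auto simp: D_def)
      have "e * r * y = x * (z * (e * y))" by (simp add: z mult_ac)
      moreover have "t * (z * (e * y)) \<in> level_ideal P l" if "t \<in> set_pmf P" for t
      proof -
        obtain w where "e * t = e * s * w" using s(2)[OF \<open>t \<in> set_pmf P\<close>] unfolding D_def by blast
        moreover have "t * (z * (e * y)) = z * y * (e * t)" by (simp only: mult_ac)
        ultimately have "t * (z * (e * y)) = (z * w) * (e * s * y)" by (simp only: mult_ac)
        then show ?thesis using * is_ideal_level_ideal[of P l] unfolding is_ideal_iff by simp
      qed
      ultimately show "e * r * y \<in> (*) x ` (\<Inter>t\<in>set_pmf P. {t'. t * t' \<in> level_ideal P l})"
        by blast
    qed
  qed
qed

section \<open>Homogeneous extensions and obstructions\<close>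

text \<open>
  The smallest unsatisfiable system is a tree of rows: \<open>k\<close> subtrees of size \<open>obstruction_size k l\<close>
  hang off a root row. A vertex \<open>v\<close> of the row \<open>f\<close> is blocked at depth \<open>l\<close> if such a subtree hangs at
  \<open>v\<close> on the side away from \<open>f\<close>.
\<close>

fun obstruction_size :: "nat \<Rightarrow> nat \<Rightarrow> nat" where
  "obstruction_size k 0 = 0"
| "obstruction_size k (Suc l) = 1 + (k - 1) * obstruction_size k l"

fun blocked :: "(nat \<Rightarrow> nat set) \<Rightarrow> nat \<Rightarrow> nat \<Rightarrow> nat \<Rightarrow> nat \<Rightarrow> bool" where
  "blocked H m 0 f v \<longleftrightarrow> True"
| "blocked H m (Suc l) f v \<longleftrightarrow>
     (\<exists>g<m. g \<noteq> f \<and> v \<in> H g \<and> (\<forall>u\<in>H g - {v}. blocked H m l g u))"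

text \<open>The values that may be placed at a vertex not blocked at depth \<open>Suc l\<close>. For
  \<open>l = 0\<close> no other row contains the vertex, hence \<open>UNIV\<close>; otherwise every
  row through it, whatever its coefficient there, must receive a contribution from
  \<open>level_ideal P j\<close>. The shift of index lets \<open>level_ideal_eq\<close> cover both
  clauses of the definition at once.\<close>

definition free_ideal :: "'r::comm_ring_1 pmf \<Rightarrow> nat \<Rightarrow> 'r set" where
  "free_ideal P l = (case l of 0 \<Rightarrow> UNIV | Suc j \<Rightarrow> {y. \<forall>s\<in>set_pmf P. s * y \<in> level_ideal P j})"

lemma level_ideal_eq: "level_ideal P l = (\<Inter>r\<in>set_pmf P. (*) r ` free_ideal P l)"
proof (cases l)
  case (Suc j)
  have "free_ideal P (Suc j) = (\<Inter>s\<in>set_pmf P. ideal_quotient (level_ideal P j) s)"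
    by (auto simp: free_ideal_def ideal_quotient_def)
  then show ?thesis using Suc by simp
qed (simp add: free_ideal_def principal_def)

section \<open>Repairing rows by linearity\<close>

definition dot :: "nat \<Rightarrow> (nat \<Rightarrow> nat \<Rightarrow> 'r::comm_ring_1) \<Rightarrow> nat \<Rightarrow> (nat \<Rightarrow> 'r) \<Rightarrow> 'r" where
  "dot n c f x = (\<Sum>v<n. c f v * x v)"

lemma dot_diff: "dot n c f (\<lambda>v. x v - y v) = dot n c f x - dot n c f y"
  by (simp add: dot_def algebra_simps sum_subtractf)

lemma dot_sum: "dot n c f (\<lambda>v. \<Sum>g\<in>G. x g v) = (\<Sum>g\<in>G. dot n c f (x g))"
  unfolding dot_def by (simp add: sum_distrib_left) (rule sum.swap)

lemma dot_single: "u < n \<Longrightarrow> dot n c f (\<lambda>v. if v = u then y else 0) = c f u * y"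
proof -
  assume "u < n"
  have "dot n c f (\<lambda>v. if v = u then y else 0) = (\<Sum>v<n. if v = u then c f u * y else 0)"
    unfolding dot_def by (intro sum.cong) auto
  then show ?thesis using \<open>u < n\<close> by simp
qed

text \<open>
  Only the contributions to the rows are prescribed, not the values at the other vertices of \<open>f\<close>.
  This is what makes the construction below work in every hypergraph, acyclic or not.
\<close>

definition extends :: "nat \<Rightarrow> nat \<Rightarrow> (nat \<Rightarrow> nat \<Rightarrow> 'r::comm_ring_1) \<Rightarrow> nat \<Rightarrow> nat \<Rightarrow> 'r \<Rightarrow> bool" where
  "extends m n c f v y \<longleftrightarrow>
     (\<exists>x. dot n c f x = c f v * y \<and> (\<forall>g<m. g \<noteq> f \<longrightarrow> dot n c g x = 0))"

lemma superposition:
  assumes "\<And>f. f < m \<Longrightarrow> \<exists>x. dot n c f x = b f \<and> (\<forall>g<m. g \<noteq> f \<longrightarrow> dot n c g x = 0)"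
  shows "\<exists>x. \<forall>f<m. dot n c f x = b f"
proof -
  obtain X where X: "\<And>f. f < m \<Longrightarrow> dot n c f (X f) = b f"
    "\<And>f g. f < m \<Longrightarrow> g < m \<Longrightarrow> g \<noteq> f \<Longrightarrow> dot n c g (X f) = 0"
    using assms by metis
  have "dot n c f (\<lambda>v. \<Sum>g<m. X g v) = b f" if "f < m" for f
  proof -
    have "dot n c f (\<lambda>v. \<Sum>g<m. X g v) = (\<Sum>g<m. if g = f then b f else 0)"
      unfolding dot_sum using X that by (intro sum.cong) auto
    then show ?thesis using that by simp
  qed
  then show ?thesis by blast
qed

text \<open>Place \<open>y\<close> at \<open>v\<close> and subtract, for every other row through
  \<open>v\<close>, an assignment that contributes the same amount to that row and nothing to any
  other. The subtracted assignments may overlap, even on \<open>f\<close>: by linearity only their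
  row contributions count.\<close>

lemma extends_step:
  assumes f: "f < m" and v: "v < n" and supp: "\<And>g u. g < m \<Longrightarrow> u \<notin> H g \<Longrightarrow> c g u = 0"
    and "\<And>g. g < m \<Longrightarrow> g \<noteq> f \<Longrightarrow> v \<in> H g \<Longrightarrow> \<exists>u z. c g v * y = c g u * z \<and> extends m n c g u z"
  shows "extends m n c f v y"
proof -
  define G where "G = {g. g < m \<and> g \<noteq> f \<and> v \<in> H g}"
  have fin: "finite G" by (simp add: G_def)
  have "\<exists>x. dot n c g x = c g v * y \<and> (\<forall>h<m. h \<noteq> g \<longrightarrow> dot n c h x = 0)" if "g \<in> G" for g
    using assms(4)[of g] that by (auto simp: G_def extends_def)
  then obtain X where X: "\<And>g. g \<in> G \<Longrightarrow> dot n c g (X g) = c g v * y"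
    "\<And>g h. g \<in> G \<Longrightarrow> h < m \<Longrightarrow> h \<noteq> g \<Longrightarrow> dot n c h (X g) = 0"
    by metis
  define x where "x = (\<lambda>u. (if u = v then y else 0) - (\<Sum>g\<in>G. X g u))"
  have dx: "dot n c h x = c h v * y - (\<Sum>g\<in>G. dot n c h (X g))" for h
    unfolding x_def dot_diff dot_sum dot_single[OF v] ..
  have "dot n c h x = 0" if "h < m" "h \<noteq> f" for h
  proof (cases "v \<in> H h")
    case True
    then have h: "h \<in> G" using that by (simp add: G_def)
    have "(\<Sum>g\<in>G. dot n c h (X g)) = (\<Sum>g\<in>G. if g = h then c h v * y else 0)"
      using X that(1) by (intro sum.cong) auto
    then show ?thesis using dx h fin by simp
  next
    case False
    then have "(\<Sum>g\<in>G. dot n c h (X g)) = 0"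
      using X(2) that(1) by (intro sum.neutral) (auto simp: G_def)
    then show ?thesis using dx supp[OF that(1) False] by simp
  qed
  moreover have "dot n c f x = c f v * y"
  proof -
    have "(\<Sum>g\<in>G. dot n c f (X g)) = 0"
      using X(2) f by (intro sum.neutral) (auto simp: G_def)
    then show ?thesis using dx by simp
  qed
  ultimately show ?thesis unfolding extends_def by blast
qed


text \<open>\<open>free_ideal P (Suc l)\<close> puts \<open>c g v * y\<close> into
  \<open>level_ideal P l\<close>, and an element of that ideal is divisible by every coefficient in
  the support with a quotient in \<open>free_ideal P l\<close>. So the contribution can be passed to
  whichever vertex of \<open>g\<close> is not blocked, at one depth less.\<close>

lemma extends_if_not_blocked:
  assumes H: "\<And>g. g < m \<Longrightarrow> H g \<subseteq> {..<n}"
    and supp: "\<And>g u. g < m \<Longrightarrow> u \<notin> H g \<Longrightarrow> c g u = 0"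
    and cP: "\<And>g u. g < m \<Longrightarrow> u \<in> H g \<Longrightarrow> c g u \<in> set_pmf P"
    and "f < m" "v \<in> H f" "\<not> blocked H m (Suc l) f v" "y \<in> free_ideal P l"
  shows "extends m n c f v y"
  using assms(4-7)
proof (induction l arbitrary: f v y)
  case 0
  have "v < n" using H 0(1,2) by blast
  show ?case using 0 by (intro extends_step[OF 0(1) \<open>v < n\<close> supp]) auto
next
  case (Suc l)
  have "v < n" using H Suc.prems(1,2) by blast
  show ?case
  proof (rule extends_step[OF Suc.prems(1) \<open>v < n\<close> supp])
    fix g assume g: "g < m" "g \<noteq> f" "v \<in> H g"
    then obtain u where u: "u \<in> H g" "\<not> blocked H m (Suc l) g u"
      using Suc.prems(3) unfolding blocked.simps(2)[of H m "Suc l"] by blast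
    have "c g v * y \<in> level_ideal P l"
      using Suc.prems(4) cP[OF g(1,3)] by (simp add: free_ideal_def)
    then have "c g v * y \<in> (*) (c g u) ` free_ideal P l"
      unfolding level_ideal_eq using cP[OF g(1) u(1)] by blast
    then obtain z where "c g v * y = c g u * z" "z \<in> free_ideal P l" by blast
    then show "\<exists>u z. c g v * y = c g u * z \<and> extends m n c g u z"
      using Suc.IH[OF g(1) u] by blast
  qed
qed

text \<open>The head of the list is the row that was attached last.\<close>

fun conn :: "(nat \<Rightarrow> nat set) \<Rightarrow> nat list \<Rightarrow> bool" where
  "conn H [] \<longleftrightarrow> True"
| "conn H (g # gs) \<longleftrightarrow> g \<notin> set gs \<and> (gs = [] \<or> H g \<inter> \<Union>(H ` set gs) \<noteq> {}) \<and> conn H gs"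

text \<open>The list \<open>g # gs\<close>, closed up by a second incidence of its last row. It
  costs one more factor 1/n than a tree, so for a fixed number t of rows the expected number is at
  most of order (m/n)^t, which vanishes whenever m is small against n.\<close>

definition dense :: "(nat \<Rightarrow> nat set) \<Rightarrow> nat \<Rightarrow> nat list \<Rightarrow> bool" where
  "dense H g gs \<longleftrightarrow> conn H gs \<and> g \<notin> set gs \<and>
     (\<exists>v w. v \<noteq> w \<and> {v, w} \<subseteq> H g \<inter> \<Union>(H ` set gs))"

lemma conn_append: "conn H (es @ gs) \<Longrightarrow> conn H gs"
  by (induction es) auto

text \<open>\<open>step\<close> is a hypothesis because it is the induction hypothesis in
  \<open>blocked_grow\<close> and the conclusion of that lemma in \<open>blocked_edge_grow\<close>.
  The bound on the intersection is carried along since a row attached for one vertex of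
  \<open>F\<close> must not contain the next one.\<close>

lemma blocked_family_grow:
  assumes step: "\<And>gs g v. conn H gs \<Longrightarrow> set gs \<subseteq> {..<m} \<Longrightarrow> g \<in> set gs \<Longrightarrow> v \<in> H g \<Longrightarrow>
      (\<forall>h\<in>set gs. h \<noteq> g \<longrightarrow> v \<notin> H h) \<Longrightarrow> blocked H m l g v \<Longrightarrow> length gs + N \<le> L \<Longrightarrow>
      \<exists>es. length es = N \<and> conn H (es @ gs) \<and> set es \<subseteq> {..<m} \<and>
        \<Union>(H ` set es) \<inter> \<Union>(H ` set gs) \<subseteq> {v}"
    and F: "finite F" "F \<subseteq> H g"
    and gs: "conn H gs" "set gs \<subseteq> {..<m}" "g \<in> set gs"
    and fresh: "\<And>v h. v \<in> F \<Longrightarrow> h \<in> set gs \<Longrightarrow> h \<noteq> g \<Longrightarrow> v \<notin> H h"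
    and bl: "\<And>v. v \<in> F \<Longrightarrow> blocked H m l g v"
    and len: "length gs + card F * N \<le> L"
  shows "\<exists>es. length es = card F * N \<and> conn H (es @ gs) \<and> set es \<subseteq> {..<m} \<and>
        \<Union>(H ` set es) \<inter> \<Union>(H ` set gs) \<subseteq> F"
  using F fresh bl len
proof (induction F rule: finite_induct)
  case empty
  then show ?case using gs by (intro exI[of _ "[]"]) auto
next
  case (insert u F)
  have "length gs + card F * N \<le> L" using insert.prems(4) insert.hyps by simp
  then obtain es where es: "length es = card F * N" "conn H (es @ gs)" "set es \<subseteq> {..<m}"
    "\<Union>(H ` set es) \<inter> \<Union>(H ` set gs) \<subseteq> F"
    using insert.IH insert.prems(1-3) by (metis insertCI insert_subset)
  have "u \<in> H g" "u \<notin> F" using insert by auto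
  have "\<forall>h\<in>set (es @ gs). h \<noteq> g \<longrightarrow> u \<notin> H h"
    using es(4) insert.prems(2)[of u] \<open>u \<in> H g\<close> \<open>u \<notin> F\<close> gs(3) by auto
  moreover have "length (es @ gs) + N \<le> L" using insert.prems(4) insert.hyps es(1) by simp
  ultimately obtain es' where es': "length es' = N" "conn H (es' @ es @ gs)" "set es' \<subseteq> {..<m}"
    "\<Union>(H ` set es') \<inter> \<Union>(H ` set (es @ gs)) \<subseteq> {u}"
    using step[of "es @ gs" g u] es gs insert.prems(3)[of u] \<open>u \<in> H g\<close> by auto
  have "\<Union>(H ` set (es' @ es)) \<inter> \<Union>(H ` set gs) \<subseteq> insert u F"
    using es(4) es'(4) by auto
  moreover have "length (es' @ es) = card (insert u F) * N"
    using es(1) es'(1) insert.hyps by simp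
  ultimately show ?case
    using es(3) es'(2,3) by (intro exI[of _ "es' @ es"]) auto
qed

text \<open>Turns the recursive predicate into an actual list of rows. A row could serve twice only
  if a newly attached row met the old ones outside \<open>v\<close>, and such a list is dense; hence
  the list has exactly the size of the tree.\<close>

lemma blocked_grow:
  assumes card: "\<And>g. g < m \<Longrightarrow> finite (H g) \<and> card (H g) = k"
    and nodense: "\<And>g gs. Suc (length gs) \<le> L \<Longrightarrow> set (g # gs) \<subseteq> {..<m} \<Longrightarrow> \<not> dense H g gs"
    and "conn H gs" "set gs \<subseteq> {..<m}" "g \<in> set gs" "v \<in> H g"
    and "\<forall>h\<in>set gs. h \<noteq> g \<longrightarrow> v \<notin> H h"
    and "blocked H m l g v" "length gs + obstruction_size k l \<le> L"
  shows "\<exists>es. length es = obstruction_size k l \<and> conn H (es @ gs) \<and> set es \<subseteq> {..<m} \<and>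
        \<Union>(H ` set es) \<inter> \<Union>(H ` set gs) \<subseteq> {v}"
  using assms(3-)
proof (induction l arbitrary: gs g v)
  case 0
  then show ?case by (intro exI[of _ "[]"]) auto
next
  case (Suc l)
  obtain h where h: "h < m" "h \<noteq> g" "v \<in> H h" "\<And>u. u \<in> H h - {v} \<Longrightarrow> blocked H m l h u"
    using Suc.prems(6) by auto
  have hgs: "h \<notin> set gs" using h Suc.prems(5) by blast
  have meet: "H h \<inter> \<Union>(H ` set gs) = {v}"
  proof -
    have "v \<in> H h \<inter> \<Union>(H ` set gs)" using h(3) Suc.prems(3,4) by blast
    moreover have "\<not> dense H h gs"
      using nodense[of gs h] h(1) Suc.prems(2,7) by simp
    ultimately show ?thesis
      using Suc.prems(1) hgs unfolding dense_def by blast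
  qed
  have conn: "conn H (h # gs)" using hgs meet Suc.prems(1) by simp
  define F where "F = H h - {v}"
  have F: "finite F" "F \<subseteq> H h" "card F = k - 1" using card[OF h(1)] h(3) by (auto simp: F_def)
  have "\<exists>es. length es = card F * obstruction_size k l \<and> conn H (es @ h # gs) \<and>
      set es \<subseteq> {..<m} \<and> \<Union>(H ` set es) \<inter> \<Union>(H ` set (h # gs)) \<subseteq> F"
  proof (rule blocked_family_grow[where l = l and L = L and g = h, OF Suc.IH F(1,2) conn])
    show "\<And>v h'. v \<in> F \<Longrightarrow> h' \<in> set (h # gs) \<Longrightarrow> h' \<noteq> h \<Longrightarrow> v \<notin> H h'"
      using meet by (auto simp: F_def)
    show "length (h # gs) + card F * obstruction_size k l \<le> L" using Suc.prems(7) F(3) by simp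
    show "set (h # gs) \<subseteq> {..<m}" using h(1) Suc.prems(2) by simp
    show "\<And>v. v \<in> F \<Longrightarrow> blocked H m l h v" using h(4) by (simp add: F_def)
  qed simp_all
  then obtain es where es: "length es = card F * obstruction_size k l" "conn H (es @ h # gs)"
      "set es \<subseteq> {..<m}" "\<Union>(H ` set es) \<inter> \<Union>(H ` set (h # gs)) \<subseteq> F" by blast
  have "\<Union>(H ` set (es @ [h])) \<inter> \<Union>(H ` set gs) \<subseteq> {v}"
    using es(4) meet by (auto simp: F_def)
  then show ?case using es h(1) F(3) by (intro exI[of _ "es @ [h]"]) auto
qed

text \<open>\<open>F\<close> is the whole row in the main argument, and the row without one vertex
  in the critical case, where that vertex is grown to a greater depth.\<close>

lemma blocked_edge_grow:
  assumes card: "\<And>g. g < m \<Longrightarrow> finite (H g) \<and> card (H g) = k"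
    and nodense: "\<And>g gs. Suc (length gs) \<le> L \<Longrightarrow> set (g # gs) \<subseteq> {..<m} \<Longrightarrow> \<not> dense H g gs"
    and f: "f < m" and F: "F \<subseteq> H f" and bl: "\<And>v. v \<in> F \<Longrightarrow> blocked H m l f v"
    and L: "1 + card F * obstruction_size k l \<le> L"
  shows "\<exists>es. length es = card F * obstruction_size k l \<and> conn H (es @ [f]) \<and> set es \<subseteq> {..<m} \<and>
        \<Union>(H ` set es) \<inter> H f \<subseteq> F"
proof -
  have "\<exists>es. length es = card F * obstruction_size k l \<and> conn H (es @ [f]) \<and> set es \<subseteq> {..<m} \<and>
        \<Union>(H ` set es) \<inter> \<Union>(H ` set [f]) \<subseteq> F"
  proof (rule blocked_family_grow[where l = l and L = L and g = f, OF blocked_grow[OF card nodense]])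
    show "finite F" using card[OF f] F finite_subset by blast
    show "length [f] + card F * obstruction_size k l \<le> L" using L by simp
  qed (use f F bl in auto)
  then show ?thesis by simp
qed

section \<open>Trails and closed trails\<close>

fun trail :: "(nat \<Rightarrow> nat set) \<Rightarrow> nat list \<Rightarrow> bool" where
  "trail H [] \<longleftrightarrow> True"
| "trail H (g # gs) \<longleftrightarrow> g \<notin> set gs \<and> (gs = [] \<or> H g \<inter> H (hd gs) \<noteq> {}) \<and> trail H gs"

text \<open>A cycle in the incidence graph of rows and vertices: \<open>g\<close> joins both ends of
  the trail through different vertices. A trail of one row is allowed, so two rows with two common
  vertices form a cycle.\<close>

definition closed_trail :: "(nat \<Rightarrow> nat set) \<Rightarrow> nat \<Rightarrow> nat list \<Rightarrow> bool" where
  "closed_trail H g gs \<longleftrightarrow> trail H gs \<and> gs \<noteq> [] \<and> g \<notin> set gs \<and>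
     (\<exists>v w. v \<noteq> w \<and> v \<in> H g \<inter> H (hd gs) \<and> w \<in> H g \<inter> H (last gs))"

lemma trail_prefix: "trail H (as @ bs) \<Longrightarrow> trail H as"
  by (induction as) (auto simp: hd_append)

lemma trail_distinct: "trail H gs \<Longrightarrow> distinct gs"
  by (induction gs) auto

text \<open>Follow one blocking row after another. The vertex \<open>w\<close> by which the trail
  entered \<open>g\<close> differs from the vertex \<open>v\<close> by which it leaves, so returning
  to a row used before would close a trail.\<close>

lemma blocked_trail:
  assumes card: "\<And>g. g < m \<Longrightarrow> finite (H g) \<and> card (H g) = k" and k: "k \<ge> 2"
    and acyclic: "\<And>g gs. set (g # gs) \<subseteq> {..<m} \<Longrightarrow> \<not> closed_trail H g gs"
    and "trail H (g # gs)" "set (g # gs) \<subseteq> {..<m}" "v \<in> H g"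
    and "gs \<noteq> [] \<Longrightarrow> \<exists>w\<in>H g \<inter> H (hd gs). w \<noteq> v"
    and "blocked H m l g v"
  shows "\<exists>hs. trail H hs \<and> length hs = Suc (length gs) + l \<and> set hs \<subseteq> {..<m}"
  using assms(4-)
proof (induction l arbitrary: g gs v)
  case 0
  then show ?case by (intro exI[of _ "g # gs"]) auto
next
  case (Suc l)
  obtain h where h: "h < m" "h \<noteq> g" "v \<in> H h" "\<And>u. u \<in> H h - {v} \<Longrightarrow> blocked H m l h u"
    using Suc.prems(5) by auto
  have "h \<notin> set gs"
  proof
    assume "h \<in> set gs"
    then obtain as bs where gs: "gs = as @ h # bs" by (meson split_list)
    have "trail H (as @ [h])" using Suc.prems(1) trail_prefix[of H "as @ [h]" bs] by (simp add: gs)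
    moreover obtain w where "w \<in> H g \<inter> H (hd gs)" "w \<noteq> v" using Suc.prems(4) gs by auto
    moreover have "w \<in> H (hd (as @ [h]))" using calculation(2) by (cases as) (auto simp: gs)
    moreover have "g \<notin> set (as @ [h])" using Suc.prems(1) by (auto simp: gs)
    ultimately have "closed_trail H g (as @ [h])"
      unfolding closed_trail_def using Suc.prems(3) h(3) by fastforce
    then show False using acyclic Suc.prems(2) by (auto simp: gs)
  qed
  have "card (H h - {v}) = k - 1" using card[OF h(1)] h(3) by simp
  then have "H h - {v} \<noteq> {}" using k by (metis One_nat_def card.empty diff_is_0_eq not_less_eq_eq numeral_2_eq_2)
  then obtain u where u: "u \<in> H h" "u \<noteq> v" by blast
  have "\<exists>hs. trail H hs \<and> length hs = Suc (length (g # gs)) + l \<and> set hs \<subseteq> {..<m}"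
  proof (rule Suc.IH[of h "g # gs" u])
    show "trail H (h # g # gs)" using Suc.prems h \<open>h \<notin> set gs\<close> by auto
    show "\<exists>w\<in>H h \<inter> H (hd (g # gs)). w \<noteq> u" using u h(3) Suc.prems(3) by auto
  qed (use u h Suc.prems in auto)
  then show ?case by simp
qed

text \<open>Being blocked at depth \<open>m\<close> would need a trail of \<open>Suc m\<close>
  distinct rows among only \<open>m\<close>.\<close>

lemma not_blocked_if_acyclic:
  assumes card: "\<And>g. g < m \<Longrightarrow> finite (H g) \<and> card (H g) = k" and k: "k \<ge> 2"
    and acyclic: "\<And>g gs. set (g # gs) \<subseteq> {..<m} \<Longrightarrow> \<not> closed_trail H g gs"
    and f: "f < m" "v \<in> H f"
  shows "\<not> blocked H m m f v"
proof
  assume "blocked H m m f v"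
  then obtain hs where "trail H hs" "length hs = Suc m" "set hs \<subseteq> {..<m}"
    using blocked_trail[OF card k acyclic, where g = f and gs = "[]" and v = v and l = m] f by auto
  then show False
    using trail_distinct[of H hs] card_mono[of "{..<m}" "set hs"] by (simp add: distinct_card)
qed

section \<open>Sparse random hypergraphs\<close>

lemma prob_bind_pmf:
  "measure_pmf.prob (bind_pmf p f) A = measure_pmf.expectation p (\<lambda>x. measure_pmf.prob (f x) A)"
proof -
  have "ennreal (measure_pmf.prob (bind_pmf p f) A) = (\<integral>\<^sup>+x. ennreal (measure_pmf.prob (f x) A) \<partial>p)"
    by (simp flip: measure_pmf.emeasure_eq_measure)
  also have "\<dots> = ennreal (measure_pmf.expectation p (\<lambda>x. measure_pmf.prob (f x) A))"
    by (intro nn_integral_eq_integral measure_pmf.integrable_const_bound[where B = 1]) auto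
  finally show ?thesis by (simp add: integral_nonneg_AE)
qed

lemma integrable_measure_pmf_bounded:
  fixes f :: "'a \<Rightarrow> real"
  assumes "\<And>x. \<bar>f x\<bar> \<le> B"
  shows "integrable (measure_pmf p) f"
  using assms by (intro measure_pmf.integrable_const_bound[where B = B]) auto

lemma prob_bind_pmf_le:
  assumes "\<And>x. x \<in> set_pmf p \<Longrightarrow> measure_pmf.prob (f x) A \<le> c * indicator E x"
  shows "measure_pmf.prob (bind_pmf p f) A \<le> c * measure_pmf.prob p E"
proof -
  have "measure_pmf.prob (bind_pmf p f) A \<le> measure_pmf.expectation p (\<lambda>x. c * indicator E x)"
    unfolding prob_bind_pmf using assms
    by (intro integral_mono_AE integrable_measure_pmf_bounded[where B = 1]
          integrable_measure_pmf_bounded[where B = "\<bar>c\<bar>"])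
      (auto simp: AE_measure_pmf_iff indicator_def)
  then show ?thesis by simp
qed

lemma prob_bind_pmf_ge:
  assumes "\<And>x. x \<in> set_pmf p \<Longrightarrow> c * indicator E x \<le> measure_pmf.prob (f x) A"
  shows "c * measure_pmf.prob p E \<le> measure_pmf.prob (bind_pmf p f) A"
proof -
  have "measure_pmf.expectation p (\<lambda>x. c * indicator E x) \<le> measure_pmf.prob (bind_pmf p f) A"
    unfolding prob_bind_pmf using assms
    by (intro integral_mono_AE integrable_measure_pmf_bounded[where B = 1]
          integrable_measure_pmf_bounded[where B = "\<bar>c\<bar>"])
      (auto simp: AE_measure_pmf_iff indicator_def)
  then show ?thesis by simp
qed

lemma prob_bind_pmf_split:
  assumes "c \<ge> 0" and "\<And>x. x \<in> set_pmf p \<Longrightarrow> x \<notin> E \<Longrightarrow> measure_pmf.prob (f x) A \<le> c"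
  shows "measure_pmf.prob (bind_pmf p f) A \<le> measure_pmf.prob p E + c"
proof -
  have "measure_pmf.prob (bind_pmf p f) A \<le> measure_pmf.expectation p (\<lambda>x. indicator E x + c)"
    unfolding prob_bind_pmf using assms
    by (intro integral_mono_AE integrable_measure_pmf_bounded[where B = 1]
          integrable_measure_pmf_bounded[where B = "1 + c"])
      (auto simp: AE_measure_pmf_iff indicator_def intro: add_increasing2)
  also have "\<dots> = measure_pmf.prob p E + c"
    by (subst Bochner_Integration.integral_add) (auto intro!: integrable_measure_pmf_bounded[where B = 1])
  finally show ?thesis .
qed

text \<open>Draws all coordinates except \<open>g\<close> first. \<open>E\<close> does not depend on
  \<open>g\<close>, so the fresh coordinate contributes the factor \<open>c\<close> whatever the
  others are; the bounds for lists of rows multiply one such factor per row.\<close>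

lemma Pi_pmf_update_prob_le:
  assumes A: "finite A" "g \<in> A"
    and E: "\<And>f y. E (f(g := y)) = E f"
    and F: "\<And>f. E f \<Longrightarrow> (\<And>h. h \<in> A - {g} \<Longrightarrow> f h \<in> set_pmf (p h)) \<Longrightarrow>
      measure_pmf.prob (p g) {y. F (f(g := y))} \<le> c"
    and c: "c \<ge> 0"
  shows "measure_pmf.prob (Pi_pmf A d p) {f. E f \<and> F f} \<le> c * measure_pmf.prob (Pi_pmf A d p) {f. E f}"
proof -
  define A' where "A' = A - {g}"
  have A': "finite A'" "g \<notin> A'" "A = insert g A'" using A by (auto simp: A'_def)
  have eq: "Pi_pmf A d p = bind_pmf (Pi_pmf A' d p) (\<lambda>f. map_pmf (\<lambda>y. f(g := y)) (p g))"
    unfolding A'(3) Pi_pmf_insert'[OF A'(1,2)] map_pmf_def by (rule bind_commute_pmf)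
  have "measure_pmf.prob (Pi_pmf A d p) {f. E f \<and> F f} \<le> c * measure_pmf.prob (Pi_pmf A' d p) {f. E f}"
    unfolding eq
  proof (rule prob_bind_pmf_le)
    fix f assume f: "f \<in> set_pmf (Pi_pmf A' d p)"
    have "f h \<in> set_pmf (p h)" if "h \<in> A - {g}" for h
      using f that A' by (auto simp: set_Pi_pmf PiE_dflt_def)
    then show "measure_pmf.prob (map_pmf (\<lambda>y. f(g := y)) (p g)) {f. E f \<and> F f} \<le> c * indicator {f. E f} f"
      using F[of f] E c by (auto simp: vimage_def indicator_def)
  qed
  moreover have "measure_pmf.prob (Pi_pmf A d p) {f. E f} = measure_pmf.prob (Pi_pmf A' d p) {f. E f}"
  proof -
    have "(\<lambda>f. measure_pmf.prob (map_pmf (\<lambda>y. f(g := y)) (p g)) {f. E f}) = indicator {f. E f}"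
      by (auto simp: vimage_def E indicator_def)
    then show ?thesis unfolding eq prob_bind_pmf by simp
  qed
  ultimately show ?thesis by simp
qed

lemma prob_union_le:
  assumes "finite I" "\<And>i. i \<in> I \<Longrightarrow> measure_pmf.prob p (A i) \<le> c"
  shows "measure_pmf.prob p (\<Union>i\<in>I. A i) \<le> real (card I) * c"
proof -
  have "measure_pmf.prob p (\<Union>i\<in>I. A i) \<le> (\<Sum>i\<in>I. measure_pmf.prob p (A i))"
    using assms(1) by (intro measure_pmf.finite_measure_subadditive_finite) auto
  also have "\<dots> \<le> (\<Sum>i\<in>I. c)" using assms(2) by (rule sum_mono)
  finally show ?thesis by simp
qed

section \<open>Uniformly random edges\<close>

definition edges :: "nat \<Rightarrow> nat \<Rightarrow> nat set set" where
  "edges k n = {J. J \<subseteq> {..<n} \<and> card J = k}"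

definition edge_pmf :: "nat \<Rightarrow> nat \<Rightarrow> nat set pmf" where
  "edge_pmf k n = pmf_of_set (edges k n)"

lemma edges_facts:
  assumes "k \<le> n"
  shows "finite (edges k n)" "edges k n \<noteq> {}" "card (edges k n) = n choose k"
    "set_pmf (edge_pmf k n) = edges k n"
proof -
  show fin: "finite (edges k n)" unfolding edges_def by (rule finite_subset[of _ "Pow {..<n}"]) auto
  show "card (edges k n) = n choose k" unfolding edges_def by (simp add: n_subsets)
  then show "edges k n \<noteq> {}" using assms by (metis card.empty zero_less_binomial less_irrefl)
  then show "set_pmf (edge_pmf k n) = edges k n" unfolding edge_pmf_def using fin by simp
qed

lemma prob_edge_pmf:
  "k \<le> n \<Longrightarrow> measure_pmf.prob (edge_pmf k n) A = real (card (edges k n \<inter> A)) / real (n choose k)"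
  unfolding edge_pmf_def using edges_facts[of k n] by (simp add: measure_pmf_of_set)

lemma edge_finite: "J \<in> edges k n \<Longrightarrow> finite J \<and> card J = k \<and> J \<subseteq> {..<n}"
  unfolding edges_def using finite_subset by auto

text \<open>The quotient of the binomials is the probability of containing a given
  \<open>t\<close>-set; its factors (k-i)/(n-i) are at most k/n.\<close>

lemma binomial_ratio_le:
  assumes "t \<le> k" "k \<le> n"
  shows "real ((n - t) choose (k - t)) \<le> (real k / real n) ^ t * real (n choose k)"
  using assms(1)
proof (induction t)
  case (Suc t)
  have pos: "k - t > 0" "n - t > 0" using Suc.prems assms(2) by auto
  have "real (k - t) * real ((n - t) choose (k - t)) = real (n - t) * real ((n - Suc t) choose (k - Suc t))"
    using times_binomial_minus1_eq[OF pos(1), of "n - t"]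
    by (simp only: diff_diff_left add_Suc_right add_0_right plus_1_eq_Suc add.commute[of _ 1] flip: of_nat_mult)
  then have "real ((n - Suc t) choose (k - Suc t)) = real (k - t) / real (n - t) * real ((n - t) choose (k - t))"
    using pos by (simp add: field_simps)
  also have "\<dots> \<le> real k / real n * ((real k / real n) ^ t * real (n choose k))"
  proof (rule mult_mono)
    have "(real k - real t) * real n \<le> real k * (real n - real t)"
      using mult_right_mono[of "real k" "real n" "real t"] assms(2) by (simp add: algebra_simps)
    then show "real (k - t) / real (n - t) \<le> real k / real n"
      using pos by (simp add: field_simps of_nat_diff)
  qed (use Suc in auto)
  finally show ?case by (simp add: mult.assoc)
qed simp

lemma prob_contains_le:
  assumes k: "k \<le> n" and T: "finite T" "card T \<le> k"
  shows "measure_pmf.prob (edge_pmf k n) {J. T \<subseteq> J} \<le> (real k / real n) ^ card T"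
proof (cases "T \<subseteq> {..<n}")
  case True
  have "edges k n \<inter> {J. T \<subseteq> J} \<subseteq> (\<union>) T ` {K. K \<subseteq> {..<n} - T \<and> card K = k - card T}"
  proof
    fix J assume J: "J \<in> edges k n \<inter> {J. T \<subseteq> J}"
    then have "J = T \<union> (J - T)" "J - T \<subseteq> {..<n} - T" "card (J - T) = k - card T"
      using T(1) by (auto simp: edges_def card_Diff_subset)
    then show "J \<in> (\<union>) T ` {K. K \<subseteq> {..<n} - T \<and> card K = k - card T}" by blast
  qed
  then have "card (edges k n \<inter> {J. T \<subseteq> J}) \<le> card {K. K \<subseteq> {..<n} - T \<and> card K = k - card T}"
  proof (rule surj_card_le[rotated])
    show "finite {K. K \<subseteq> {..<n} - T \<and> card K = k - card T}"
      by (rule finite_subset[of _ "Pow {..<n}"]) auto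
  qed
  also have "\<dots> = (n - card T) choose (k - card T)"
    using True T(1) by (subst n_subsets) (auto simp: card_Diff_subset)
  finally have "real (card (edges k n \<inter> {J. T \<subseteq> J})) \<le> (real k / real n) ^ card T * real (n choose k)"
    using binomial_ratio_le[OF T(2) k] by linarith
  moreover have "real (n choose k) > 0" using k by (simp add: zero_less_binomial)
  ultimately show ?thesis using k by (simp add: prob_edge_pmf divide_le_eq)
next
  case False
  then have "edges k n \<inter> {J. T \<subseteq> J} = {}" by (auto simp: edges_def)
  then show ?thesis using k by (simp add: prob_edge_pmf)
qed

lemma prob_meets_le:
  assumes k: "1 \<le> k" "k \<le> n" and U: "finite U"
  shows "measure_pmf.prob (edge_pmf k n) {J. J \<inter> U \<noteq> {}} \<le> real (card U) * (real k / real n)"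
proof -
  have "measure_pmf.prob (edge_pmf k n) (\<Union>u\<in>U. {J. {u} \<subseteq> J}) \<le> real (card U) * (real k / real n)"
  proof (rule prob_union_le[OF U])
    show "measure_pmf.prob (edge_pmf k n) {J. {u} \<subseteq> J} \<le> real k / real n" for u
      using prob_contains_le[OF k(2), of "{u}"] k(1) by simp
  qed
  also have "(\<Union>u\<in>U. {J. {u} \<subseteq> J}) = {J. J \<inter> U \<noteq> {}}" by auto
  finally show ?thesis .
qed

text \<open>Two sets, because a dense list has \<open>U = V\<close> whereas a closed trail is met at
  its two end rows.\<close>

lemma prob_meets_twice_le:
  assumes k: "2 \<le> k" "k \<le> n" and U: "finite U" and V: "finite V"
  shows "measure_pmf.prob (edge_pmf k n) {J. \<exists>v w. v \<noteq> w \<and> v \<in> J \<inter> U \<and> w \<in> J \<inter> V} \<le>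
    real (card U) * real (card V) * (real k / real n)\<^sup>2"
proof -
  define I where "I = (U \<times> V) \<inter> {(v, w). v \<noteq> w}"
  have I: "finite I" "card I \<le> card U * card V"
  proof -
    show "finite I" using U V by (simp add: I_def)
    have "card I \<le> card (U \<times> V)" using U V by (intro card_mono) (auto simp: I_def)
    then show "card I \<le> card U * card V" by (simp add: card_cartesian_product)
  qed
  have "measure_pmf.prob (edge_pmf k n) (\<Union>i\<in>I. {J. {fst i, snd i} \<subseteq> J}) \<le> real (card I) * (real k / real n)\<^sup>2"
  proof (rule prob_union_le[OF I(1)])
    fix i assume "i \<in> I"
    then have "card {fst i, snd i} = 2" by (auto simp: I_def)
    then show "measure_pmf.prob (edge_pmf k n) {J. {fst i, snd i} \<subseteq> J} \<le> (real k / real n)\<^sup>2"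
      using prob_contains_le[OF k(2), of "{fst i, snd i}"] k(1) by simp
  qed
  also have "\<dots> \<le> (real (card U) * real (card V)) * (real k / real n)\<^sup>2"
    using I(2) by (intro mult_right_mono) (simp_all only: of_nat_mult[symmetric] of_nat_le_iff, simp)
  finally show ?thesis
    by (rule order_trans[rotated]) (auto intro!: measure_pmf.finite_measure_mono bexI simp: I_def)
qed

section \<open>Probabilities of connected, dense and closed lists\<close>

definition hyper_pmf :: "nat \<Rightarrow> nat \<Rightarrow> nat \<Rightarrow> (nat \<Rightarrow> nat set) pmf" where
  "hyper_pmf k n m = Pi_pmf {..<m} {} (\<lambda>_. edge_pmf k n)"

lemma conn_cong: "(\<And>g. g \<in> set gs \<Longrightarrow> H g = H' g) \<Longrightarrow> conn H gs = conn H' gs"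
  by (induction gs) auto

lemma trail_cong: "(\<And>g. g \<in> set gs \<Longrightarrow> H g = H' g) \<Longrightarrow> trail H gs = trail H' gs"
proof (induction gs)
  case (Cons g gs)
  then show ?case by (cases gs) auto
qed simp

lemma card_union_edges_le:
  assumes "\<And>h. h \<in> set gs \<Longrightarrow> H h \<in> edges k n"
  shows "finite (\<Union>(H ` set gs)) \<and> card (\<Union>(H ` set gs)) \<le> k * length gs"
proof -
  have "card (\<Union>(H ` set gs)) \<le> (\<Sum>h\<in>set gs. card (H h))" by (rule card_UN_le) simp
  also have "\<dots> = (\<Sum>h\<in>set gs. k)" using assms edge_finite by (intro sum.cong) auto
  also have "\<dots> \<le> k * length gs" by (simp add: card_length)
  finally show ?thesis using assms edge_finite by auto
qed

text \<open>At most \<open>k * L\<close> vertices are covered so far, and each is hit with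
  probability at most k/n. The bound \<open>L\<close> on the length keeps the base of the power
  constant along the induction; the first row is free, whence the exponent.\<close>

lemma prob_conn_le:
  assumes k: "1 \<le> k" "k \<le> n" and "set gs \<subseteq> {..<m}" "length gs \<le> L"
  shows "measure_pmf.prob (hyper_pmf k n m) {H. conn H gs} \<le> (real (k\<^sup>2 * L) / real n) ^ (length gs - 1)"
  using assms(3,4)
proof (induction gs)
  case (Cons g gs)
  consider "gs = []" | "g \<in> set gs" | "gs \<noteq> []" "g \<notin> set gs" by blast
  then show ?case
  proof cases
    case 3
    have "measure_pmf.prob (hyper_pmf k n m) {H. conn H (g # gs)} \<le>
       measure_pmf.prob (hyper_pmf k n m) {H. conn H gs \<and> H g \<inter> \<Union>(H ` set gs) \<noteq> {}}"
      using 3 by (intro measure_pmf.finite_measure_mono) auto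
    also have "\<dots> \<le> real (k\<^sup>2 * L) / real n * measure_pmf.prob (hyper_pmf k n m) {H. conn H gs}"
      unfolding hyper_pmf_def
    proof (rule Pi_pmf_update_prob_le)
      show "conn (H(g := J)) gs = conn H gs" for H J
        using 3 by (intro conn_cong) auto
      fix H assume H: "\<And>h. h \<in> {..<m} - {g} \<Longrightarrow> H h \<in> set_pmf (edge_pmf k n)"
      have *: "finite (\<Union>(H ` set gs)) \<and> card (\<Union>(H ` set gs)) \<le> k * length gs"
        using card_union_edges_le[of gs H k n] H 3(2) Cons.prems k by (auto simp: edges_facts)
      have "measure_pmf.prob (edge_pmf k n)
          {J. (H(g := J)) g \<inter> \<Union>(H(g := J) ` set gs) \<noteq> {}} =
        measure_pmf.prob (edge_pmf k n) {J. J \<inter> \<Union>(H ` set gs) \<noteq> {}}"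
        using 3 by (intro arg_cong2[where f = measure]) (auto simp: fun_upd_def)
      also have "\<dots> \<le> real (card (\<Union>(H ` set gs))) * (real k / real n)"
        using prob_meets_le[OF k] * by blast
      also have "\<dots> \<le> real (k * L) * (real k / real n)"
      proof (intro mult_right_mono)
        have "k * length gs \<le> k * L" using Cons.prems(2) by (intro mult_left_mono) auto
        then show "real (card (\<Union>(H ` set gs))) \<le> real (k * L)" using * by linarith
      qed simp
      finally show "measure_pmf.prob (edge_pmf k n)
          {J. (H(g := J)) g \<inter> \<Union>(H(g := J) ` set gs) \<noteq> {}} \<le> real (k\<^sup>2 * L) / real n"
        by (simp add: power2_eq_square mult_ac)
    qed (use Cons.prems in auto)
    also have "\<dots> \<le> real (k\<^sup>2 * L) / real n * (real (k\<^sup>2 * L) / real n) ^ (length gs - 1)"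
      using Cons by (intro mult_left_mono) auto
    also have "\<dots> = (real (k\<^sup>2 * L) / real n) ^ (length (g # gs) - 1)"
      using 3 by (cases gs) simp_all
    finally show ?thesis .
  qed simp_all
qed simp

text \<open>The row \<open>g\<close> has to hit the covered set twice and so pays the factor twice:
  the exponent is \<open>length gs - 1\<close> plus 2.\<close>

lemma prob_dense_le:
  assumes k: "2 \<le> k" "k \<le> n" and gs: "set (g # gs) \<subseteq> {..<m}" "length gs \<le> L"
  shows "measure_pmf.prob (hyper_pmf k n m) {H. dense H g gs} \<le>
    (real (k\<^sup>2 * L) / real n) ^ (length gs + 1)"
proof -
  consider "gs = []" | "g \<in> set gs" | "gs \<noteq> []" "g \<notin> set gs" by blast
  then show ?thesis
  proof cases
    case 3
    have "measure_pmf.prob (hyper_pmf k n m) {H. dense H g gs} \<le>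
       measure_pmf.prob (hyper_pmf k n m) {H. conn H gs \<and>
         (\<exists>v w. v \<noteq> w \<and> {v, w} \<subseteq> H g \<inter> \<Union>(H ` set gs))}"
      by (intro measure_pmf.finite_measure_mono) (auto simp: dense_def)
    also have "\<dots> \<le> (real (k\<^sup>2 * L) / real n)\<^sup>2 * measure_pmf.prob (hyper_pmf k n m) {H. conn H gs}"
      unfolding hyper_pmf_def
    proof (rule Pi_pmf_update_prob_le)
      show "conn (H(g := J)) gs = conn H gs" for H J
        using 3 by (intro conn_cong) auto
      fix H assume H: "\<And>h. h \<in> {..<m} - {g} \<Longrightarrow> H h \<in> set_pmf (edge_pmf k n)"
      define U where "U = \<Union>(H ` set gs)"
      have *: "finite U \<and> card U \<le> k * length gs" unfolding U_def
        using card_union_edges_le[of gs H k n] H 3(2) gs k by (auto simp: edges_facts)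
      have U': "\<Union>(H(g := J) ` set gs) = U" for J
        using 3 by (auto simp: U_def fun_upd_def)
      have "measure_pmf.prob (edge_pmf k n)
          {J. \<exists>v w. v \<noteq> w \<and> {v, w} \<subseteq> (H(g := J)) g \<inter> \<Union>(H(g := J) ` set gs)} =
        measure_pmf.prob (edge_pmf k n) {J. \<exists>v w. v \<noteq> w \<and> v \<in> J \<inter> U \<and> w \<in> J \<inter> U}"
        unfolding U' by (intro arg_cong2[where f = measure]) auto
      also have "\<dots> \<le> real (card U) * real (card U) * (real k / real n)\<^sup>2"
        using prob_meets_twice_le[OF k] * by blast
      also have "\<dots> \<le> real (k * L) * real (k * L) * (real k / real n)\<^sup>2"
      proof -
        have "k * length gs \<le> k * L" using gs(2) by (intro mult_left_mono) auto
        then have "real (card U) \<le> real (k * L)" using * by linarith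
        then show ?thesis by (intro mult_right_mono mult_mono) auto
      qed
      finally show "measure_pmf.prob (edge_pmf k n)
          {J. \<exists>v w. v \<noteq> w \<and> {v, w} \<subseteq> (H(g := J)) g \<inter> \<Union>(H(g := J) ` set gs)} \<le>
          (real (k\<^sup>2 * L) / real n)\<^sup>2"
        by (simp add: power2_eq_square mult_ac)
    qed (use gs in auto)
    also have "\<dots> \<le> (real (k\<^sup>2 * L) / real n)\<^sup>2 * (real (k\<^sup>2 * L) / real n) ^ (length gs - 1)"
      using prob_conn_le[of k n gs m L] k gs by (intro mult_left_mono) auto
    also have "\<dots> = (real (k\<^sup>2 * L) / real n) ^ (length gs + 1)"
      using 3 by (cases gs) (simp_all add: power2_eq_square mult_ac)
    finally show ?thesis .
  qed (simp_all add: dense_def)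
qed

text \<open>Each row has to hit only the \<open>k\<close> vertices of its predecessor, so in
  contrast to \<open>prob_conn_le\<close> the base is independent of the length. This permits
  summing over trails of all lengths in \<open>prob_has_cycle_le\<close>.\<close>

lemma prob_trail_le:
  assumes k: "1 \<le> k" "k \<le> n" and "set gs \<subseteq> {..<m}"
  shows "measure_pmf.prob (hyper_pmf k n m) {H. trail H gs} \<le> (real (k\<^sup>2) / real n) ^ (length gs - 1)"
  using assms(3)
proof (induction gs)
  case (Cons g gs)
  consider "gs = []" | "g \<in> set gs" | "gs \<noteq> []" "g \<notin> set gs" by blast
  then show ?case
  proof cases
    case 3
    have hd: "hd gs \<in> set gs" "hd gs \<noteq> g" using 3 by (auto dest: hd_in_set)
    have "measure_pmf.prob (hyper_pmf k n m) {H. trail H (g # gs)} \<le>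
       measure_pmf.prob (hyper_pmf k n m) {H. trail H gs \<and> H g \<inter> H (hd gs) \<noteq> {}}"
      using 3 by (intro measure_pmf.finite_measure_mono) auto
    also have "\<dots> \<le> real (k\<^sup>2) / real n * measure_pmf.prob (hyper_pmf k n m) {H. trail H gs}"
      unfolding hyper_pmf_def
    proof (rule Pi_pmf_update_prob_le)
      show "trail (H(g := J)) gs = trail H gs" for H J
        using 3 by (intro trail_cong) auto
      fix H assume H: "\<And>h. h \<in> {..<m} - {g} \<Longrightarrow> H h \<in> set_pmf (edge_pmf k n)"
      then have *: "H (hd gs) \<in> edges k n"
        using hd Cons.prems k by (auto simp: edges_facts)
      have "measure_pmf.prob (edge_pmf k n) {J. (H(g := J)) g \<inter> (H(g := J)) (hd gs) \<noteq> {}} =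
        measure_pmf.prob (edge_pmf k n) {J. J \<inter> H (hd gs) \<noteq> {}}"
        using hd by simp
      also have "\<dots> \<le> real (card (H (hd gs))) * (real k / real n)"
        using prob_meets_le[OF k] edge_finite[OF *] by blast
      finally show "measure_pmf.prob (edge_pmf k n) {J. (H(g := J)) g \<inter> (H(g := J)) (hd gs) \<noteq> {}}
          \<le> real (k\<^sup>2) / real n"
        using edge_finite[OF *] by (simp add: power2_eq_square mult_ac)
    qed (use Cons.prems in auto)
    also have "\<dots> \<le> real (k\<^sup>2) / real n * (real (k\<^sup>2) / real n) ^ (length gs - 1)"
      using Cons by (intro mult_left_mono) auto
    also have "\<dots> = (real (k\<^sup>2) / real n) ^ (length (g # gs) - 1)"
      using 3 by (cases gs) simp_all
    finally show ?thesis .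
  qed simp_all
qed simp

lemma prob_cycle_le:
  assumes k: "2 \<le> k" "k \<le> n" and gs: "set (g # gs) \<subseteq> {..<m}"
  shows "measure_pmf.prob (hyper_pmf k n m) {H. closed_trail H g gs} \<le> (real (k\<^sup>2) / real n) ^ (length gs + 1)"
proof -
  consider "gs = []" | "g \<in> set gs" | "gs \<noteq> []" "g \<notin> set gs" by blast
  then show ?thesis
  proof cases
    case 3
    have ends: "hd gs \<in> set gs" "hd gs \<noteq> g" "last gs \<in> set gs" "last gs \<noteq> g"
      using 3 by (auto dest: hd_in_set last_in_set)
    have "measure_pmf.prob (hyper_pmf k n m) {H. closed_trail H g gs} \<le>
       measure_pmf.prob (hyper_pmf k n m) {H. trail H gs \<and>
         (\<exists>v w. v \<noteq> w \<and> v \<in> H g \<inter> H (hd gs) \<and> w \<in> H g \<inter> H (last gs))}"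
      by (intro measure_pmf.finite_measure_mono) (auto simp: closed_trail_def)
    also have "\<dots> \<le> (real (k\<^sup>2) / real n)\<^sup>2 * measure_pmf.prob (hyper_pmf k n m) {H. trail H gs}"
      unfolding hyper_pmf_def
    proof (rule Pi_pmf_update_prob_le)
      show "trail (H(g := J)) gs = trail H gs" for H J
        using 3 by (intro trail_cong) auto
      fix H assume H: "\<And>h. h \<in> {..<m} - {g} \<Longrightarrow> H h \<in> set_pmf (edge_pmf k n)"
      then have *: "H (hd gs) \<in> edges k n" "H (last gs) \<in> edges k n"
        using ends gs k by (auto simp: edges_facts)
      have "measure_pmf.prob (edge_pmf k n) {J. \<exists>v w. v \<noteq> w \<and>
            v \<in> (H(g := J)) g \<inter> (H(g := J)) (hd gs) \<and> w \<in> (H(g := J)) g \<inter> (H(g := J)) (last gs)} =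
        measure_pmf.prob (edge_pmf k n) {J. \<exists>v w. v \<noteq> w \<and> v \<in> J \<inter> H (hd gs) \<and> w \<in> J \<inter> H (last gs)}"
        using ends by simp
      also have "\<dots> \<le> real (card (H (hd gs))) * real (card (H (last gs))) * (real k / real n)\<^sup>2"
        using prob_meets_twice_le[OF k] edge_finite[OF *(1)] edge_finite[OF *(2)] by blast
      finally show "measure_pmf.prob (edge_pmf k n) {J. \<exists>v w. v \<noteq> w \<and>
            v \<in> (H(g := J)) g \<inter> (H(g := J)) (hd gs) \<and> w \<in> (H(g := J)) g \<inter> (H(g := J)) (last gs)} \<le>
          (real (k\<^sup>2) / real n)\<^sup>2"
        using edge_finite[OF *(1)] edge_finite[OF *(2)] by (simp add: power2_eq_square mult_ac)
    qed (use gs in auto)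
    also have "\<dots> \<le> (real (k\<^sup>2) / real n)\<^sup>2 * (real (k\<^sup>2) / real n) ^ (length gs - 1)"
      using prob_trail_le[of k n gs m] k gs by (intro mult_left_mono) auto
    also have "\<dots> = (real (k\<^sup>2) / real n) ^ (length gs + 1)"
      using 3 by (cases gs) (simp_all add: power2_eq_square mult_ac)
    finally show ?thesis .
  qed (simp_all add: closed_trail_def)
qed

section \<open>The system as a list of independent rows\<close>

definition pos :: "nat set \<Rightarrow> nat \<Rightarrow> nat" where
  "pos J v = card {u\<in>J. u < v}"

definition coef :: "nat set \<Rightarrow> (nat \<Rightarrow> 'r::zero) \<Rightarrow> nat \<Rightarrow> 'r" where
  "coef J \<sigma> v = (if v \<in> J then \<sigma> (pos J v) else 0)"

fun solves :: "nat \<Rightarrow> (nat \<Rightarrow> 'r::comm_ring_1) \<Rightarrow> nat set \<times> (nat \<Rightarrow> 'r) \<times> 'r \<Rightarrow> bool" where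
  "solves n x (J, \<sigma>, b) \<longleftrightarrow> (\<Sum>v<n. coef J \<sigma> v * x v) = b"

lemma solves_iff: "solves n x d \<longleftrightarrow> (\<Sum>v<n. coef (fst d) (fst (snd d)) v * x v) = snd (snd d)"
  by (cases d) auto

definition datum_pmf ::
  "nat \<Rightarrow> nat \<Rightarrow> (nat \<Rightarrow> 'r) pmf \<Rightarrow> 'r pmf \<Rightarrow> (nat set \<times> (nat \<Rightarrow> 'r) \<times> 'r) pmf" where
  "datum_pmf k n Phat Q = pair_pmf (edge_pmf k n) (pair_pmf Phat Q)"

section \<open>Lists of independent draws\<close>

lemma replicate_pmf_Suc: "replicate_pmf (Suc m) p = bind_pmf p (\<lambda>x. map_pmf ((#) x) (replicate_pmf m p))"
  by (simp add: map_pmf_def)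

lemma replicate_pmf_Suc_right:
  "replicate_pmf (Suc m) p = bind_pmf p (\<lambda>x. map_pmf (\<lambda>xs. xs @ [x]) (replicate_pmf m p))"
  using replicate_pmf_distrib[of m 1 p]
  by (simp add: map_pmf_def bind_assoc_pmf bind_return_pmf bind_commute_pmf[of p])

lemma map_replicate_pmf: "replicate_pmf m (map_pmf f p) = map_pmf (map f) (replicate_pmf m p)"
  by (induction m) (simp_all add: map_pmf_def bind_assoc_pmf bind_return_pmf)

lemma Pi_pmf_to_list: "map_pmf (\<lambda>f. map f [0..<m]) (Pi_pmf {..<m} d (\<lambda>_. p)) = replicate_pmf m p"
proof (induction m)
  case (Suc m)
  have *: "map (f(m := y)) [0..<m] = map f [0..<m]" for f :: "nat \<Rightarrow> 'a" and y by simp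
  show ?case
    unfolding replicate_pmf_Suc_right Suc[symmetric] lessThan_Suc
    by (simp add: Pi_pmf_insert' map_pmf_def bind_assoc_pmf bind_return_pmf * del: fun_upd_apply)
      simp
qed simp

lemma replicate_pair_pmf:
  "replicate_pmf m (pair_pmf p q) =
     map_pmf (\<lambda>(xs, ys). zip xs ys) (pair_pmf (replicate_pmf m p) (replicate_pmf m q))"
proof (induction m)
  case (Suc m)
  show ?case
    unfolding replicate_pmf_Suc Suc.IH
    unfolding pair_pmf_def map_pmf_def bind_assoc_pmf bind_return_pmf
      bind_commute_pmf[of q "replicate_pmf m p"]
    by (simp add: bind_return_pmf)
qed (simp add: pair_pmf_def map_pmf_def bind_return_pmf)

lemma row_pmf_eq: "row_pmf k n Phat = map_pmf (\<lambda>(J, \<sigma>). coef J \<sigma>) (pair_pmf (edge_pmf k n) Phat)"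
  unfolding row_pmf_def edge_pmf_def edges_def
  by (simp add: pair_pmf_def map_pmf_def bind_assoc_pmf bind_return_pmf coef_def[abs_def] pos_def cong: if_cong)

lemma set_zip_upt:
  assumes "length ys = m"
  shows "set (zip (map f [0..<m]) ys) = (\<lambda>a. (f a, ys ! a)) ` {..<m}"
  using assms by (auto simp: set_zip intro!: exI)

lemma sat_prob_eq_list:
  "sat_prob k Phat Q n m =
     measure_pmf.prob (replicate_pmf m (datum_pmf k n Phat Q)) {rows. \<exists>x. \<forall>d\<in>set rows. solves n x d}"
proof -
  define \<Phi> where "\<Phi> = (\<lambda>rows. \<exists>x. \<forall>(r, b)\<in>set rows. (\<Sum>v<n. r v * x v) = (b::'a))"
  have "satisfiable m n B b \<longleftrightarrow> \<Phi> (zip (map B [0..<m]) (map b [0..<m]))"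
    for B and b :: "nat \<Rightarrow> 'a"
    unfolding satisfiable_def \<Phi>_def using set_zip_upt[of "map b [0..<m]" m B] by (simp, simp add: Ball_def)
  then have "sat_prob k Phat Q n m = measure_pmf.prob
      (map_pmf (\<lambda>(B, b). zip (map B [0..<m]) (map b [0..<m])) (system_pmf k n m Phat Q)) {rows. \<Phi> rows}"
    unfolding sat_prob_def by (simp add: vimage_def case_prod_unfold)
  also have "map_pmf (\<lambda>(B, b). zip (map B [0..<m]) (map b [0..<m])) (system_pmf k n m Phat Q) =
      map_pmf (\<lambda>(xs, ys). zip xs ys) (map_pmf (\<lambda>(B, b). (map B [0..<m], map b [0..<m]))
        (system_pmf k n m Phat Q))"
    by (simp add: pmf.map_comp o_def case_prod_unfold)
  also have "\<dots> = replicate_pmf m (pair_pmf (row_pmf k n Phat) Q)"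
    unfolding system_pmf_def map_pair Pi_pmf_to_list replicate_pair_pmf ..
  also have "pair_pmf (row_pmf k n Phat) Q = map_pmf (\<lambda>(J, \<sigma>, b). (coef J \<sigma>, b)) (datum_pmf k n Phat Q)"
    unfolding row_pmf_eq datum_pmf_def
    by (simp add: pair_pmf_def map_pmf_def bind_assoc_pmf bind_return_pmf)
  also have "measure_pmf.prob (replicate_pmf m \<dots>) {rows. \<Phi> rows} =
    measure_pmf.prob (replicate_pmf m (datum_pmf k n Phat Q)) {rows. \<exists>x. \<forall>d\<in>set rows. solves n x d}"
    unfolding map_replicate_pmf measure_map_pmf vimage_def
  proof (intro arg_cong2[where f = measure] Collect_cong refl)
    fix rows :: "(nat set \<times> (nat \<Rightarrow> 'a) \<times> 'a) list"
    show "(map (\<lambda>(J, \<sigma>, b). (coef J \<sigma>, b)) rows \<in> {rows. \<Phi> rows}) =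
        (\<exists>x. \<forall>d\<in>set rows. solves n x d)"
      unfolding \<Phi>_def solves_iff by (simp add: split_beta)
  qed
  finally show ?thesis .
qed

text \<open>Hypergraph and labels are independent, so the structure of the hypergraph can be fixed
  before coefficients and right-hand sides are drawn.\<close>

lemma sat_prob_eq_hyper:
  "sat_prob k Phat Q n m =
     measure_pmf.prob (pair_pmf (hyper_pmf k n m) (replicate_pmf m (pair_pmf Phat Q)))
       {(H, ls). \<exists>x. \<forall>a<m. dot n (\<lambda>a. coef (H a) (fst (ls ! a))) a x = snd (ls ! a)}"
proof -
  let ?L = "replicate_pmf m (pair_pmf Phat Q)"
  have "replicate_pmf m (datum_pmf k n Phat Q) =
      map_pmf (\<lambda>(H, ls). zip (map H [0..<m]) ls) (pair_pmf (hyper_pmf k n m) ?L)"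
    unfolding datum_pmf_def replicate_pair_pmf[of m "edge_pmf k n"] hyper_pmf_def
      Pi_pmf_to_list[of m "{}" "edge_pmf k n", symmetric]
    by (simp add: pair_map_pmf1 pmf.map_comp o_def case_prod_unfold)
  then have "sat_prob k Phat Q n m = measure_pmf.prob (pair_pmf (hyper_pmf k n m) ?L)
     {(H, ls). \<exists>x. \<forall>d\<in>set (zip (map H [0..<m]) ls). solves n x d}"
    unfolding sat_prob_eq_list by (simp add: vimage_def case_prod_unfold)
  also have "\<dots> = measure_pmf.prob (pair_pmf (hyper_pmf k n m) ?L)
       {(H, ls). \<exists>x. \<forall>a<m. dot n (\<lambda>a. coef (H a) (fst (ls ! a))) a x = snd (ls ! a)}"
  proof (rule measure_pmf.finite_measure_eq_AE)
    show "AE y in measure_pmf (pair_pmf (hyper_pmf k n m) ?L).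
      y \<in> {(H, ls). \<exists>x. \<forall>d\<in>set (zip (map H [0..<m]) ls). solves n x d} \<longleftrightarrow>
      y \<in> {(H, ls). \<exists>x. \<forall>a<m. dot n (\<lambda>a. coef (H a) (fst (ls ! a))) a x = snd (ls ! a)}"
    proof (clarsimp simp: AE_measure_pmf_iff set_replicate_pmf)
      fix H :: "nat \<Rightarrow> nat set" and ls :: "((nat \<Rightarrow> 'a) \<times> 'a) list" assume "m = length ls"
      then show "(\<exists>x. \<forall>d\<in>set (zip (map H [0..<length ls]) ls). solves n x d) =
          (\<exists>x. \<forall>a<length ls. dot n (\<lambda>a. coef (H a) (fst (ls ! a))) a x = snd (ls ! a))"
        by (simp add: set_zip_upt solves_iff dot_def, simp add: Ball_def)
    qed
  qed auto
  finally show ?thesis .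
qed

lemma prob_replicate_all:
  "measure_pmf.prob (replicate_pmf m p) {xs. set xs \<subseteq> A} = measure_pmf.prob p A ^ m"
proof (induction m)
  case (Suc m)
  have "measure_pmf.prob (map_pmf ((#) x) (replicate_pmf m p)) {xs. set xs \<subseteq> A} =
      indicator A x * measure_pmf.prob p A ^ m" for x
    by (simp add: vimage_def indicator_def Suc flip: Suc)
  then show ?case unfolding replicate_pmf_Suc prob_bind_pmf by simp
qed simp

text \<open>The potential \<open>2 ^ (- card D)\<close> shrinks by a factor \<open>1 - p / 2\<close> in expectation at every draw.\<close>

lemma growth:
  fixes n t :: nat
  assumes p: "0 \<le> p" "p \<le> 1" and new: "\<And>d. new d \<subseteq> {..<n}"
    and ge: "\<And>D. D \<subseteq> {..<n} \<Longrightarrow> card D < t \<Longrightarrow> p \<le> measure_pmf.prob M {d. \<not> new d \<subseteq> D}"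
    and D: "D \<subseteq> {..<n}"
  shows "measure_pmf.prob (replicate_pmf q M) {ds. card (D \<union> \<Union>(new ` set ds)) < t} \<le>
    2 ^ t / 2 ^ card D * (1 - p / 2) ^ q"
  using D
proof (induction q arbitrary: D)
  \<comment> \<open>Markov's inequality for the potential: \<open>2 ^ t / 2 ^ card D\<close> exceeds
    1 when \<open>card D < t\<close>.\<close>
  case 0
  have "2 ^ card D \<le> (2::real) ^ t" if "card D < t" using that by (intro power_increasing) auto
  then show ?case by (simp add: indicator_def)
next
  case (Suc q)
  have fin: "finite (D \<union> X)" if "X \<subseteq> {..<n}" for X using that Suc.prems
    by (intro finite_subset[of "D \<union> X" "{..<n}"]) auto
  show ?case
  proof (cases "card D < t")
    case False
    have "\<not> card (D \<union> \<Union>(new ` set ds)) < t" for ds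
    proof -
      have "\<Union>(new ` set ds) \<subseteq> {..<n}" using new by blast
      from fin[OF this] have "card D \<le> card (D \<union> \<Union>(new ` set ds))" by (rule card_mono) blast
      then show ?thesis using False by linarith
    qed
    then have "{ds. card (D \<union> \<Union>(new ` set ds)) < t} = {}" by blast
    then have "measure_pmf.prob (replicate_pmf (Suc q) M) {ds. card (D \<union> \<Union>(new ` set ds)) < t} = 0"
      by (simp only: measure_empty)
    then show ?thesis using p by simp
  next
    case True
    define X where "X = 2 ^ t / 2 ^ card D * (1 - p / 2) ^ q"
    have X: "X \<ge> 0" using p by (simp add: X_def)
    \<comment> \<open>A draw that adds something to \<open>D\<close> at least halves the
      potential.\<close>
    have inner: "measure_pmf.prob (map_pmf ((#) d) (replicate_pmf q M))
        {ds. card (D \<union> \<Union>(new ` set ds)) < t} \<le> X - X / 2 * indicator {d. \<not> new d \<subseteq> D} d" for d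
    proof -
      have D': "D \<union> new d \<subseteq> {..<n}" using Suc.prems new by blast
      have "measure_pmf.prob (map_pmf ((#) d) (replicate_pmf q M))
          {ds. card (D \<union> \<Union>(new ` set ds)) < t} =
          measure_pmf.prob (replicate_pmf q M) {ds. card ((D \<union> new d) \<union> \<Union>(new ` set ds)) < t}"
        by (simp add: vimage_def Un_assoc)
      also have "\<dots> \<le> 2 ^ t / 2 ^ card (D \<union> new d) * (1 - p / 2) ^ q" by (rule Suc.IH[OF D'])
      also have "\<dots> \<le> X - X / 2 * indicator {d. \<not> new d \<subseteq> D} d"
      proof (cases "new d \<subseteq> D")
        case True
        then have "D \<union> new d = D" by blast
        then show ?thesis using True by (simp add: X_def)
      next
        case False
        then have "card D < card (D \<union> new d)" using fin[OF new] by (intro psubset_card_mono) auto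
        then have "(2::real) ^ Suc (card D) \<le> 2 ^ card (D \<union> new d)" by (intro power_increasing) auto
        then have "2 ^ t / 2 ^ card (D \<union> new d) * (1 - p / 2) ^ q \<le>
            2 ^ t / 2 ^ Suc (card D) * (1 - p / 2) ^ q"
          using p by (intro mult_right_mono divide_left_mono) auto
        also have "\<dots> = X / 2" by (simp add: X_def)
        finally show ?thesis using False by simp
      qed
      finally show ?thesis .
    qed
    have "measure_pmf.prob (replicate_pmf (Suc q) M) {ds. card (D \<union> \<Union>(new ` set ds)) < t} \<le>
        measure_pmf.expectation M (\<lambda>d. X - X / 2 * indicator {d. \<not> new d \<subseteq> D} d)"
      unfolding replicate_pmf_Suc prob_bind_pmf using inner X
      by (intro integral_mono integrable_measure_pmf_bounded[where B = 1]
          integrable_measure_pmf_bounded[where B = X]) (auto simp: indicator_def)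
    also have "\<dots> = X - X / 2 * measure_pmf.prob M {d. \<not> new d \<subseteq> D}"
    proof (subst Bochner_Integration.integral_diff)
      show "integrable (measure_pmf M) (\<lambda>d. X / 2 * indicator {d. \<not> new d \<subseteq> D} d)"
        by (rule integrable_measure_pmf_bounded[where B = X]) (use X in \<open>simp add: indicator_def\<close>)
    qed auto
    also have "\<dots> \<le> X - X / 2 * p"
      using ge[OF Suc.prems True] X by (simp add: mult_left_mono)
    also have "\<dots> = 2 ^ t / 2 ^ card D * (1 - p / 2) ^ Suc q" by (simp add: X_def algebra_simps)
    finally show ?thesis .
  qed
qed

section \<open>Lower bounds for the probability of useful rows\<close>

lemma prob_datum_ge:
  assumes k: "k \<le> n" and F: "F \<subseteq> edges k n"
    and ge: "\<And>J. J \<in> F \<Longrightarrow> q \<le> measure_pmf.prob L {l. (J, l) \<in> A}"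
  shows "q * (real (card F) / real (n choose k)) \<le> measure_pmf.prob (pair_pmf (edge_pmf k n) L) A"
proof -
  have "q * measure_pmf.prob (edge_pmf k n) F \<le>
      measure_pmf.prob (bind_pmf (edge_pmf k n) (\<lambda>J. map_pmf (Pair J) L)) A"
    by (rule prob_bind_pmf_ge) (use ge in \<open>auto simp: vimage_def indicator_def\<close>)
  moreover have "edges k n \<inter> F = F" using F by blast
  ultimately show ?thesis
    using k by (simp add: prob_edge_pmf pair_pmf_def map_pmf_def)
qed

lemma edges_within_ratio:
  assumes k: "1 \<le> k" "k \<le> n" and U: "U \<subseteq> {..<n}" "k \<le> card U"
  shows "(real (card U) / (real k * real n)) ^ k \<le> real (card {J\<in>edges k n. J \<subseteq> U}) / real (n choose k)"
proof -
  have fin: "finite U" using U(1) finite_subset by blast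
  have "{J\<in>edges k n. J \<subseteq> U} = {J. J \<subseteq> U \<and> card J = k}" using U by (auto simp: edges_def)
  then have "card {J\<in>edges k n. J \<subseteq> U} = card U choose k" using fin by (simp add: n_subsets)
  moreover have "(real (card U) / real k) ^ k \<le> real (card U choose k)"
    using binomial_ge_n_over_k_pow_k[OF U(2), where 'a = real] by simp
  moreover have "n choose k \<le> n ^ k" using k(2) by (rule binomial_le_pow)
  then have "real (n choose k) \<le> real n ^ k" by (metis of_nat_le_iff of_nat_power)
  moreover have "real (n choose k) > 0" using k by simp
  ultimately have "(real (card U) / real k) ^ k / real n ^ k \<le>
      real (card {J\<in>edges k n. J \<subseteq> U}) / real (n choose k)"
    by (intro frac_le) auto
  then show ?thesis by (simp add: power_divide power_mult_distrib)
qed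

text \<open>Only vertices \<open>v\<close> outside \<open>D\<close> as well as \<open>E\<close> are
  counted: then \<open>v\<close> is the one vertex of the edge outside \<open>D\<close>, which makes
  the count injective. \<open>D\<close> and \<open>E\<close> take up at most half of all vertices,
  leaving the factor 1/2.\<close>

lemma edges_pointed_ratio:
  assumes k: "2 \<le> k" "k \<le> n" and D: "D \<subseteq> {..<n}" "k \<le> card D" "4 * card D \<le> n"
    and E: "E \<subseteq> {..<n}" "4 * card E \<le> n"
  shows "(real (card D) / (real k * real n)) ^ (k - 1) / 2 \<le>
    real (card {J\<in>edges k n. \<exists>v\<in>J. v \<notin> E \<and> J - {v} \<subseteq> D}) / real (n choose k)"
proof -
  have fin: "finite D" "finite E" using D(1) E(1) finite_subset by blast+
  define W where "W = {..<n} - (D \<union> E)"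
  define Ks where "Ks = {K. K \<subseteq> D \<and> card K = k - 1}"
  let ?F = "{J\<in>edges k n. \<exists>v\<in>J. v \<notin> E \<and> J - {v} \<subseteq> D}"
  have inj: "inj_on (\<lambda>(v, K). insert v K) (W \<times> Ks)"
  proof (rule inj_onI, clarsimp)
    fix v K v' K' assume *: "v \<in> W" "K \<in> Ks" "v' \<in> W" "K' \<in> Ks" "insert v K = insert v' K'"
    have "insert v K - D = {v}" "insert v' K' - D = {v'}" using * by (auto simp: W_def Ks_def)
    then have "v = v'" using *(5) by auto
    moreover have "insert v K \<inter> D = K" "insert v' K' \<inter> D = K'" using * by (auto simp: W_def Ks_def)
    ultimately show "v = v' \<and> K = K'" using *(5) by metis
  qed
  have "(\<lambda>(v, K). insert v K) ` (W \<times> Ks) \<subseteq> ?F"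
  proof
    fix J assume "J \<in> (\<lambda>(v, K). insert v K) ` (W \<times> Ks)"
    then obtain v K where *: "v \<in> W" "K \<in> Ks" and J: "J = insert v K" by auto
    have K: "finite K" "v \<notin> K" "K \<subseteq> D" "card K = k - 1" using * fin(1) finite_subset
      by (auto simp: W_def Ks_def)
    then have "insert v K \<in> edges k n" using * D(1) k(1) by (auto simp: W_def edges_def)
    moreover have "v \<notin> E" "insert v K - {v} \<subseteq> D" using * K by (auto simp: W_def)
    ultimately show "J \<in> ?F" unfolding J by blast
  qed
  moreover have "finite ?F" using edges_facts(1)[OF k(2)] by simp
  ultimately have "card (W \<times> Ks) \<le> card ?F" using card_inj_on_le[OF inj] by blast
  then have "card W * (card D choose (k - 1)) \<le> card ?F"
    unfolding card_cartesian_product using fin(1) by (simp add: Ks_def n_subsets)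
  then have "real (card W) * real (card D choose (k - 1)) \<le> real (card ?F)"
    by (simp flip: of_nat_mult)
  moreover have "real (card W) \<ge> real n / 2"
  proof -
    have "card W \<ge> n - card (D \<union> E)" unfolding W_def using fin by (metis card_lessThan diff_card_le_card_Diff finite_UnI)
    moreover have "card (D \<union> E) \<le> card D + card E" by (rule card_Un_le)
    ultimately have "2 * card W \<ge> n" using D E by linarith
    then show ?thesis by linarith
  qed
  moreover have "(real (card D) / real k) ^ (k - 1) \<le> real (card D choose (k - 1))"
  proof -
    have "(real (card D) / real k) ^ (k - 1) \<le> (real (card D) / real (k - 1)) ^ (k - 1)"
      using k by (intro power_mono divide_left_mono) auto
    also have "\<dots> \<le> real (card D choose (k - 1))"
      using binomial_ge_n_over_k_pow_k[of "k - 1" "card D", where 'a = real] D(2) by simp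
    finally show ?thesis .
  qed
  ultimately have num: "real n / 2 * (real (card D) / real k) ^ (k - 1) \<le> real (card ?F)"
    using mult_mono[of "real n / 2" "real (card W)" "(real (card D) / real k) ^ (k - 1)"
        "real (card D choose (k - 1))"] by simp
  have "n choose k \<le> n ^ k" using k(2) by (rule binomial_le_pow)
  then have den: "real (n choose k) \<le> real n ^ k" by (metis of_nat_le_iff of_nat_power)
  have "real (n choose k) > 0" using k by simp
  with num den have "real n / 2 * (real (card D) / real k) ^ (k - 1) / real n ^ k \<le>
      real (card ?F) / real (n choose k)"
    by (intro frac_le) auto
  moreover have "real n ^ k = real n * real n ^ (k - 1)" using k by (cases k) auto
  moreover have "real n > 0" using k by simp
  ultimately show ?thesis by (simp add: power_divide power_mult_distrib)
qed

section \<open>Forced values\<close>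

lemma pos_less: "finite J \<Longrightarrow> v \<in> J \<Longrightarrow> pos J v < card J"
  unfolding pos_def by (rule psubset_card_mono) auto

lemma pos_inj:
  assumes "finite J" "u \<in> J" "v \<in> J" "u \<noteq> v"
  shows "pos J u \<noteq> pos J v"
proof -
  have *: "pos J a < pos J b" if "a \<in> J" "b \<in> J" "a < b" for a b
    unfolding pos_def using assms(1) that by (intro psubset_card_mono) auto
  show ?thesis using assms *[of u v] *[of v u] by (cases "u < v") auto
qed

lemma sum_coef:
  assumes "J \<subseteq> {..<n}"
  shows "(\<Sum>v<n. coef J \<sigma> v * x v) = (\<Sum>v\<in>J. \<sigma> (pos J v) * (x v :: 'r::comm_ring_1))"
  using assms by (intro sum.mono_neutral_cong_right) (auto simp: coef_def)

lemma prob_labels_ge: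
  fixes P Q :: "'r::{comm_ring_1, finite} pmf"
  assumes "\<And>\<sigma>. (\<And>i. i < k \<Longrightarrow> \<sigma> i = \<tau> i) \<Longrightarrow> (\<sigma>, b) \<in> A"
  shows "(\<Prod>i<k. pmf P (\<tau> i)) * pmf Q b \<le> measure_pmf.prob (pair_pmf (power_pmf k P) Q) A"
proof -
  \<comment> \<open>Coordinates from \<open>k\<close> on carry the default value of
    \<open>Pi_pmf\<close>, so this is the one representative of \<tau> that can have positive
    mass.\<close>
  define \<sigma> where "\<sigma> = (\<lambda>i. if i < k then \<tau> i else 0)"
  have "pmf (power_pmf k P) \<sigma> = (\<Prod>i<k. pmf P (\<tau> i))"
    unfolding power_pmf_def by (subst pmf_Pi') (auto simp: \<sigma>_def)
  then have "(\<Prod>i<k. pmf P (\<tau> i)) * pmf Q b = measure_pmf.prob (pair_pmf (power_pmf k P) Q) {(\<sigma>, b)}"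
    by (simp add: measure_pmf_single pmf_pair)
  also have "\<dots> \<le> measure_pmf.prob (pair_pmf (power_pmf k P) Q) A"
    using assms[of \<sigma>] by (intro measure_pmf.finite_measure_mono) (auto simp: \<sigma>_def)
  finally show ?thesis .
qed

text \<open>The counterpart of \<open>free_ideal\<close> with the same shift of index;
  \<open>a\<close> will be \<open>e * s\<close>. Depth 0 imposes nothing, so all vertices start out
  constrained.\<close>

definition forced_value :: "'r::comm_ring_1 pmf \<Rightarrow> 'r \<Rightarrow> nat \<Rightarrow> 'r \<Rightarrow> bool" where
  "forced_value P a j y \<longleftrightarrow> (case j of 0 \<Rightarrow> True | Suc i \<Rightarrow> a * y \<in> level_ideal P i)"

text \<open>All solutions of the rows drawn so far are considered. If there is none, every vertex is
  vacuously in the set, which does no harm to a proof of unsatisfiability.\<close>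

definition forced ::
  "'r::comm_ring_1 pmf \<Rightarrow> 'r \<Rightarrow> nat \<Rightarrow> nat \<Rightarrow> (nat set \<times> (nat \<Rightarrow> 'r) \<times> 'r) list \<Rightarrow> nat set" where
  "forced P a n j ds =
     {v. v < n \<and> (\<forall>x. (\<forall>d\<in>set ds. solves n x d) \<longrightarrow> forced_value P a j (x v))}"

fun forcing ::
  "'r \<Rightarrow> 'r \<Rightarrow> 'r \<Rightarrow> nat \<Rightarrow> nat \<Rightarrow> nat set \<Rightarrow> nat set \<times> (nat \<Rightarrow> 'r) \<times> 'r \<Rightarrow> nat set" where
  "forcing r s b k n D (J, \<sigma>, b') = {v\<in>J. J \<in> edges k n \<and> b' = b \<and> J - {v} \<subseteq> D \<and>
     (\<forall>i<k. \<sigma> i = (if i = pos J v then s else r))}"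

text \<open>Multiply the row by \<open>e\<close>: then \<open>e * b\<close> is
  \<open>e * s * x v\<close> plus the terms \<open>e * r * x u\<close>. The latter lie in
  \<open>level_ideal P j\<close>, by \<open>e0\<close> at depth 0 and by \<open>e1\<close>
  otherwise, and so does \<open>e * b\<close>.\<close>

lemma forcing_forced:
  fixes P :: "'r::{comm_ring_1, finite} pmf"
  assumes e0: "\<And>y. e * r * y \<in> level_ideal P 0"
    and e1: "\<And>y l. e * s * y \<in> level_ideal P l \<Longrightarrow> e * r * y \<in> level_ideal P (Suc l)"
    and b: "b \<in> level_ideal P j"
    and D: "D \<subseteq> forced P (e * s) n j ds" and d: "d \<in> set ds'"
  shows "forcing r s b k n D d \<subseteq> forced P (e * s) n (Suc j) (ds @ ds')"
proof
  fix v assume v: "v \<in> forcing r s b k n D d"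
  obtain J \<sigma> b' where dd: "d = (J, \<sigma>, b')" by (cases d)
  have J: "J \<in> edges k n" "v \<in> J" "b' = b" "J - {v} \<subseteq> D"
      "\<And>i. i < k \<Longrightarrow> \<sigma> i = (if i = pos J v then s else r)"
    using v unfolding dd by auto
  note fin = edge_finite[OF J(1)]
  have "e * s * x v \<in> level_ideal P j" if x: "\<forall>d\<in>set (ds @ ds'). solves n x d" for x
  proof -
    have "solves n x d" using x d by auto
    then have "b = (\<Sum>u\<in>J. \<sigma> (pos J u) * x u)"
      using fin by (simp add: sum_coef J(3) dd)
    also have "\<dots> = s * x v + (\<Sum>u\<in>J - {v}. r * x u)"
    proof -
      have "\<sigma> (pos J u) = (if u = v then s else r)" if "u \<in> J" for u
        using J(5)[of "pos J u"] pos_less[of J u] pos_inj[of J u v] fin J(2) that by auto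
      then show ?thesis using fin J(2) by (simp add: sum.remove[of J v])
    qed
    finally have "e * b = e * s * x v + (\<Sum>u\<in>J - {v}. e * r * x u)"
      by (simp add: distrib_left sum_distrib_left mult.assoc)
    then have eq: "e * s * x v = e * b + (- 1) * (\<Sum>u\<in>J - {v}. e * r * x u)" by simp
    have "e * r * x u \<in> level_ideal P j" if "u \<in> J - {v}" for u
    proof -
      have "forced_value P (e * s) j (x u)" using that J(4) D x unfolding forced_def by auto
      then show ?thesis using e0 e1 by (cases j) (auto simp: forced_value_def simp del: level_ideal.simps)
    qed
    then have "(\<Sum>u\<in>J - {v}. e * r * x u) \<in> level_ideal P j"
      by (intro module.subspace_sum[OF module_times is_ideal_level_ideal])
    then have "(- 1) * (\<Sum>u\<in>J - {v}. e * r * x u) \<in> level_ideal P j" "e * b \<in> level_ideal P j"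
      using b module.subspace_scale[OF module_times is_ideal_level_ideal] by blast+
    then show ?thesis
      unfolding eq by (rule module.subspace_add[OF module_times is_ideal_level_ideal, rotated])
  qed
  then show "v \<in> forced P (e * s) n (Suc j) (ds @ ds')"
    using fin J(2) by (auto simp: forced_def forced_value_def)
qed

fun contradicting :: "'r \<Rightarrow> 'r \<Rightarrow> nat \<Rightarrow> nat \<Rightarrow> nat set \<Rightarrow> nat set \<times> (nat \<Rightarrow> 'r) \<times> 'r \<Rightarrow> bool" where
  "contradicting r b k n D (J, \<sigma>, b') \<longleftrightarrow> J \<in> edges k n \<and> J \<subseteq> D \<and> b' = b \<and> (\<forall>i<k. \<sigma> i = r)"

text \<open>The same computation without a distinguished vertex, at a depth where
  \<open>e * b\<close> is outside the ideal.\<close>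

lemma contradicting_unsolvable:
  fixes P :: "'r::{comm_ring_1, finite} pmf"
  assumes e0: "\<And>y. e * r * y \<in> level_ideal P 0"
    and e1: "\<And>y l. e * s * y \<in> level_ideal P l \<Longrightarrow> e * r * y \<in> level_ideal P (Suc l)"
    and b: "e * b \<notin> level_ideal P j"
    and D: "D \<subseteq> forced P (e * s) n j ds" and d: "d \<in> set ds'" "contradicting r b k n D d"
  shows "\<not> (\<forall>d\<in>set (ds @ ds'). solves n x d)"
proof
  assume x: "\<forall>d\<in>set (ds @ ds'). solves n x d"
  obtain J \<sigma> where d': "d = (J, \<sigma>, b)" and J: "J \<in> edges k n" "J \<subseteq> D" "\<And>i. i < k \<Longrightarrow> \<sigma> i = r"
    using d(2) by (cases d) auto
  note fin = edge_finite[OF J(1)]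
  have "solves n x d" using x d by auto
  then have "b = (\<Sum>u\<in>J. \<sigma> (pos J u) * x u)"
    using fin by (simp add: sum_coef d')
  also have "\<dots> = (\<Sum>u\<in>J. r * x u)"
    using fin pos_less J(3) by (intro sum.cong) auto
  finally have eb: "e * b = (\<Sum>u\<in>J. e * r * x u)" by (simp add: sum_distrib_left mult.assoc)
  have "e * r * x u \<in> level_ideal P j" if "u \<in> J" for u
  proof -
    have "forced_value P (e * s) j (x u)" using that J(2) D x unfolding forced_def by auto
    then show ?thesis using e0 e1 by (cases j) (auto simp: forced_value_def simp del: level_ideal.simps)
  qed
  then have "e * b \<in> level_ideal P j"
    unfolding eb by (intro module.subspace_sum[OF module_times is_ideal_level_ideal])
  then show False using b by contradiction
qed

lemma replicate_split_prob_le: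
  assumes c: "c \<ge> 0"
    and le: "\<And>xs. xs \<notin> E \<Longrightarrow> measure_pmf.prob (replicate_pmf q M) {ys. xs @ ys \<in> A} \<le> c"
  shows "measure_pmf.prob (replicate_pmf (q0 + q) M) A \<le> measure_pmf.prob (replicate_pmf q0 M) E + c"
proof -
  have "replicate_pmf (q0 + q) M = bind_pmf (replicate_pmf q0 M) (\<lambda>xs. map_pmf ((@) xs) (replicate_pmf q M))"
    by (simp add: replicate_pmf_distrib map_pmf_def)
  then show ?thesis
    using le by (auto intro!: prob_bind_pmf_split[OF c] simp: vimage_def)
qed

text \<open>\<open>D\<close> depends on the first \<open>q0\<close> rows only, so the next
  \<open>q\<close> rows are independent of it and \<open>growth\<close> applies. As long as fewer
  than \<open>t'\<close> vertices have been found, a row yields a new one with probability at least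
  \<open>p\<close>.\<close>

lemma forced_round:
  fixes P Q :: "'r::{comm_ring_1, finite} pmf"
  assumes e0: "\<And>y. e * r * y \<in> level_ideal P 0"
    and e1: "\<And>y l. e * s * y \<in> level_ideal P l \<Longrightarrow> e * r * y \<in> level_ideal P (Suc l)"
    and b: "b \<in> level_ideal P j"
    and k: "2 \<le> k" "k \<le> n" and t: "k \<le> t" "4 * t \<le> n" and t': "0 < t'" "4 * t' \<le> n"
    and \<pi>: "\<pi> = (pmf P r * pmf P s) ^ k * pmf Q b"
    and p: "0 \<le> p" "p \<le> \<pi> * ((real t / (real k * real n)) ^ (k - 1) / 2)"
  shows "measure_pmf.prob (replicate_pmf (q0 + q) (datum_pmf k n (power_pmf k P) Q))
      {ds. card (forced P (e * s) n (Suc j) ds) < t'} \<le>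
    measure_pmf.prob (replicate_pmf q0 (datum_pmf k n (power_pmf k P) Q))
      {ds. card (forced P (e * s) n j ds) < t} + 2 ^ t' * (1 - p / 2) ^ q"
proof (rule replicate_split_prob_le)
  let ?M = "datum_pmf k n (power_pmf k P) Q"
  have prob: "p \<le> measure_pmf.prob ?M {d. \<not> forcing r s b k n D d \<subseteq> E}"
    if D: "D \<subseteq> {..<n}" "card D = t" and E: "E \<subseteq> {..<n}" "card E < t'" for D E
  proof -
    define F where "F = {J\<in>edges k n. \<exists>v\<in>J. v \<notin> E \<and> J - {v} \<subseteq> D}"
    have "\<pi> * (real (card F) / real (n choose k)) \<le> measure_pmf.prob ?M {d. \<not> forcing r s b k n D d \<subseteq> E}"
      unfolding datum_pmf_def
    proof (rule prob_datum_ge[OF k(2)])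
      fix J assume "J \<in> F"
      then obtain v where J: "J \<in> edges k n" and v: "v \<in> J" "v \<notin> E" "J - {v} \<subseteq> D" by (auto simp: F_def)
      define \<tau> where "\<tau> = (\<lambda>i. if i = pos J v then s else r)"
      \<comment> \<open>Bounding every factor below by \<open>pmf P r * pmf P s\<close> makes the
        estimate independent of the position of \<open>v\<close> in the edge.\<close>
      have "(pmf P r * pmf P s) ^ k = (\<Prod>i<k. pmf P r * pmf P s)" by simp
      also have "\<dots> \<le> (\<Prod>i<k. pmf P (\<tau> i))"
        by (intro prod_mono) (auto simp: \<tau>_def pmf_le_1 mult_le_one intro: mult_left_le mult_left_le_one_le)
      finally have "\<pi> \<le> (\<Prod>i<k. pmf P (\<tau> i)) * pmf Q b" unfolding \<pi> by (intro mult_right_mono) auto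
      also have "\<dots> \<le> measure_pmf.prob (pair_pmf (power_pmf k P) Q)
          {l. (J, l) \<in> {d. \<not> forcing r s b k n D d \<subseteq> E}}"
      proof (rule prob_labels_ge)
        fix \<sigma> assume "\<And>i. i < k \<Longrightarrow> \<sigma> i = \<tau> i"
        then have "v \<in> forcing r s b k n D (J, \<sigma>, b)" using v J by (auto simp: \<tau>_def)
        then show "(\<sigma>, b) \<in> {l. (J, l) \<in> {d. \<not> forcing r s b k n D d \<subseteq> E}}" using v(2) by blast
      qed
      finally show "\<pi> \<le> \<dots>" .
    qed (auto simp: F_def)
    moreover have "(real t / (real k * real n)) ^ (k - 1) / 2 \<le> real (card F) / real (n choose k)"
      using edges_pointed_ratio[OF k D(1), of E] D(2) t t' E by (simp add: F_def)
    then have "\<pi> * ((real t / (real k * real n)) ^ (k - 1) / 2) \<le> \<pi> * (real (card F) / real (n choose k))"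
      unfolding \<pi> by (intro mult_left_mono) auto
    ultimately show ?thesis using p(2) by linarith
  qed
  \<comment> \<open>\<open>p\<close> bounds a probability from below; any admissible
    \<open>D\<close> and \<open>E\<close> show this.\<close>
  have p1: "p \<le> 1"
  proof -
    have "card {..<t} = t" "{..<t} \<subseteq> {..<n}" using t by auto
    then have "p \<le> measure_pmf.prob ?M {d. \<not> forcing r s b k n {..<t} d \<subseteq> {}}" using prob[of "{..<t}" "{}"] t' by auto
    also have "\<dots> \<le> 1" by simp
    finally show ?thesis .
  qed
  show "0 \<le> 2 ^ t' * (1 - p / 2) ^ q" using p1 by simp
  fix ds assume "ds \<notin> {ds. card (forced P (e * s) n j ds) < t}"
  then have "t \<le> card (forced P (e * s) n j ds)" by simp
  \<comment> \<open>Cut down to exactly \<open>t\<close> elements, as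
    \<open>edges_pointed_ratio\<close> needs a set of at most n/4 vertices.\<close>
  then obtain D where D: "D \<subseteq> forced P (e * s) n j ds" "card D = t" by (meson obtain_subset_with_card_n)
  then have Dn: "D \<subseteq> {..<n}" by (auto simp: forced_def)
  define new where "new = forcing r s b k n D"
  have "measure_pmf.prob (replicate_pmf q ?M)
      {ds'. ds @ ds' \<in> {ds. card (forced P (e * s) n (Suc j) ds) < t'}} \<le>
    measure_pmf.prob (replicate_pmf q ?M) {ds. card ({} \<union> \<Union>(new ` set ds)) < t'}"
  proof (intro measure_pmf.finite_measure_mono Collect_mono impI; clarsimp)
    fix ds' assume *: "card (forced P (e * s) n (Suc j) (ds @ ds')) < t'"
    have "\<Union>(new ` set ds') \<subseteq> forced P (e * s) n (Suc j) (ds @ ds')"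
      unfolding new_def using forcing_forced[OF e0 e1 b D(1)] by blast
    moreover have "finite (forced P (e * s) n (Suc j) (ds @ ds'))"
      by (rule finite_subset[of _ "{..<n}"]) (auto simp: forced_def)
    ultimately show "card (\<Union>(new ` set ds')) < t'" using * card_mono le_less_trans by blast
  qed
  also have "\<dots> \<le> 2 ^ t' / 2 ^ card ({} :: nat set) * (1 - p / 2) ^ q"
  proof (rule growth[OF p(1) p1, where n = n])
    show "new d \<subseteq> {..<n}" for d unfolding new_def by (cases d) (auto simp: edges_def)
    show "p \<le> measure_pmf.prob ?M {d. \<not> new d \<subseteq> E}" if "E \<subseteq> {..<n}" "card E < t'" for E
      unfolding new_def using prob[OF Dn D(2) that] .
  qed simp
  finally show "measure_pmf.prob (replicate_pmf q ?M)
      {ds'. ds @ ds' \<in> {ds. card (forced P (e * s) n (Suc j) ds) < t'}} \<le>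
    2 ^ t' * (1 - p / 2) ^ q" by simp
qed

lemma one_minus_power_le_exp: "0 \<le> y \<Longrightarrow> y \<le> 1 \<Longrightarrow> (1 - y) ^ N \<le> exp (- (y * real N))"
proof -
  assume y: "0 \<le> y" "y \<le> 1"
  have "(1 - y) ^ N \<le> exp (- y) ^ N" using y exp_ge_add_one_self[of "- y"] by (intro power_mono) auto
  then show ?thesis by (simp add: exp_of_nat_mult[symmetric] mult.commute)
qed

text \<open>Conditionally on the first \<open>q0\<close> rows leaving enough constrained vertices,
  each further row is contradictory with probability at least \<open>p\<close>, and one such row is
  enough.\<close>

lemma final_round:
  fixes P Q :: "'r::{comm_ring_1, finite} pmf"
  assumes e0: "\<And>y. e * r * y \<in> level_ideal P 0"
    and e1: "\<And>y l. e * s * y \<in> level_ideal P l \<Longrightarrow> e * r * y \<in> level_ideal P (Suc l)"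
    and b: "e * b \<notin> level_ideal P j"
    and k: "1 \<le> k" "k \<le> n" and t: "k \<le> t" "t \<le> n"
    and p: "0 \<le> p" "p \<le> pmf P r ^ k * pmf Q b * (real t / (real k * real n)) ^ k"
  shows "sat_prob k (power_pmf k P) Q n (q0 + q) \<le>
    measure_pmf.prob (replicate_pmf q0 (datum_pmf k n (power_pmf k P) Q))
      {ds. card (forced P (e * s) n j ds) < t} + exp (- (p * real q))"
  unfolding sat_prob_eq_list
proof (rule replicate_split_prob_le)
  let ?M = "datum_pmf k n (power_pmf k P) Q"
  fix ds assume "ds \<notin> {ds. card (forced P (e * s) n j ds) < t}"
  then have "t \<le> card (forced P (e * s) n j ds)" by simp
  then obtain D where D: "D \<subseteq> forced P (e * s) n j ds" "card D = t" by (meson obtain_subset_with_card_n)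
  then have Dn: "D \<subseteq> {..<n}" by (auto simp: forced_def)
  define \<pi> where "\<pi> = pmf P r ^ k * pmf Q b"
  define F where "F = {J\<in>edges k n. J \<subseteq> D}"
  define C where "C = {d. contradicting r b k n D d}"
  have "\<pi> * (real (card F) / real (n choose k)) \<le> measure_pmf.prob ?M C"
    unfolding datum_pmf_def
  proof (rule prob_datum_ge[OF k(2)])
    fix J assume J: "J \<in> F"
    have "(\<Prod>i<k. pmf P r) * pmf Q b \<le> measure_pmf.prob (pair_pmf (power_pmf k P) Q) {l. (J, l) \<in> C}"
      by (rule prob_labels_ge) (use J in \<open>auto simp: F_def C_def\<close>)
    then show "\<pi> \<le> measure_pmf.prob (pair_pmf (power_pmf k P) Q) {l. (J, l) \<in> C}" by (simp add: \<pi>_def)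
  qed (auto simp: F_def)
  moreover have "\<pi> * (real t / (real k * real n)) ^ k \<le> \<pi> * (real (card F) / real (n choose k))"
    using edges_within_ratio[OF k Dn] D(2) t unfolding \<pi>_def F_def by (intro mult_left_mono) auto
  ultimately have pC: "p \<le> measure_pmf.prob ?M C" using p(2) by (simp add: \<pi>_def)
  have "measure_pmf.prob (replicate_pmf q ?M) {ys. ds @ ys \<in> {ds. \<exists>x. \<forall>d\<in>set ds. solves n x d}} \<le>
      measure_pmf.prob (replicate_pmf q ?M) {ys. set ys \<subseteq> - C}"
    by (intro measure_pmf.finite_measure_mono)
      (use contradicting_unsolvable[OF e0 e1 b D(1)] in \<open>unfold C_def, blast, simp\<close>)
  also have "\<dots> = (1 - measure_pmf.prob ?M C) ^ q"
    unfolding prob_replicate_all by (simp add: measure_pmf.prob_compl[of C, simplified] Compl_eq_Diff_UNIV)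
  also have "\<dots> \<le> (1 - p) ^ q" using pC by (intro power_mono) auto
  also have "\<dots> \<le> exp (- (p * real q))"
    by (rule one_minus_power_le_exp) (use p pC in \<open>auto intro: order_trans\<close>)
  finally show "measure_pmf.prob (replicate_pmf q ?M)
     {ys. ds @ ys \<in> {ds. \<exists>x. \<forall>d\<in>set ds. solves n x d}} \<le> exp (- (p * real q))" .
qed simp

section \<open>Unsatisfiable systems\<close>

lemma obstruction_size_eq:
  assumes "k \<ge> 1"
  shows "real (obstruction_size k l) = (\<Sum>i<l. (real k - 1) ^ i)"
proof (induction l)
  case (Suc l)
  have "(\<Sum>i<Suc l. (real k - 1) ^ i) = 1 + (real k - 1) * (\<Sum>i<l. (real k - 1) ^ i)"
    unfolding sum.lessThan_Suc_shift sum_distrib_left by simp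
  then show ?case using Suc assms by (simp add: of_nat_diff)
qed simp

text \<open>The sum in \<open>alpha\<close> counts the rows of the obstruction without its
  root.\<close>

lemma alpha_enat:
  assumes "k \<ge> 1" "level P Q = enat l" and S: "S = real (k * obstruction_size k l)"
  shows "alpha k P Q = S / (1 + S)"
proof -
  have "(\<Sum>i=1..l. real k * (real k - 1) ^ (i - 1)) = (\<Sum>i<l. real k * (real k - 1) ^ i)"
    using sum.atLeast1_atMost_eq[of "\<lambda>i. real k * (real k - 1) ^ (i - 1)" l] by simp
  also have "\<dots> = S" using assms(1) by (simp add: S obstruction_size_eq sum_distrib_left)
  finally show ?thesis using assms(2) by (simp add: alpha_def Let_def)
qed

lemma level_enatD:
  assumes "level P Q = enat l"
  shows "\<not> set_pmf Q \<subseteq> level_ideal P l" "j < l \<Longrightarrow> set_pmf Q \<subseteq> level_ideal P j"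
proof -
  define A where "A = {l. \<not> set_pmf Q \<subseteq> level_ideal P l}"
  have lev: "level P Q = Inf (enat ` A)" by (simp add: level_def A_def)
  have "enat ` A \<noteq> {}" using assms lev by (auto simp: top_enat_def)
  then have "Inf (enat ` A) \<in> enat ` A" by (metis ex_in_conv wellorder_InfI)
  then show "\<not> set_pmf Q \<subseteq> level_ideal P l" using assms lev by (auto simp: A_def)
  show "set_pmf Q \<subseteq> level_ideal P j" if "j < l"
  proof (rule ccontr)
    assume "\<not> ?thesis"
    then have "level P Q \<le> enat j" unfolding lev by (intro Inf_lower) (auto simp: A_def)
    then show False using that assms by simp
  qed
qed

lemma level_infD:
  assumes "level P Q = \<infinity>"
  shows "set_pmf Q \<subseteq> level_ideal P j"
proof (rule ccontr)
  assume "\<not> ?thesis"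
  then have "level P Q \<le> enat j" unfolding level_def by (intro INF_lower) simp
  then show False using assms by simp
qed

section \<open>The number of constrained vertices at each depth\<close>

lemma obstruction_size_mono: "i \<le> j \<Longrightarrow> obstruction_size k i \<le> obstruction_size k j"
proof (induction rule: dec_induct)
  case (step j)
  have "obstruction_size k j \<le> obstruction_size k (Suc j)"
  proof (induction j)
    case (Suc j)
    then have "(k - 1) * obstruction_size k j \<le> (k - 1) * obstruction_size k (Suc j)"
      by (rule mult_le_mono2)
    then show ?case by (simp only: obstruction_size.simps add_le_cancel_left)
  qed simp
  then show ?case using step by linarith
qed simp

lemma powr_at_top: "0 < x \<Longrightarrow> 0 < c \<Longrightarrow> filterlim (\<lambda>n. c * real n powr x) at_top at_top"
  by real_asymp

lemma powr_exceeds: "0 < x \<Longrightarrow> 0 < c \<Longrightarrow> eventually (\<lambda>n. K \<le> c * real n powr x) at_top"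
  using powr_at_top[of x c] by (simp add: filterlim_at_top)

lemma real_nat_ceiling_le: "0 \<le> y \<Longrightarrow> real (nat \<lceil>y\<rceil>) \<le> y + 1"
  by linarith

lemma ceiling_le_quarter:
  assumes "x \<le> 1" "0 < c" "c \<le> 1 / 8" "n \<ge> 16"
  shows "4 * nat \<lceil>c * real n powr x\<rceil> \<le> n"
proof -
  have "real n powr x \<le> real n powr 1" using assms by (intro powr_mono) auto
  then have "c * real n powr x \<le> 1 / 8 * real n" using assms by (intro mult_mono) auto
  moreover have "real (nat \<lceil>c * real n powr x\<rceil>) \<le> c * real n powr x + 1"
    using assms(2) by (intro real_nat_ceiling_le) simp
  ultimately have "real (4 * nat \<lceil>c * real n powr x\<rceil>) \<le> real n" using assms(4) by simp
  then show ?thesis by (simp only: of_nat_le_iff)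
qed

lemma powr_nat_power: "0 < n \<Longrightarrow> (real n powr x) ^ m = real n powr (x * real m)"
  by (simp add: powr_powr flip: powr_realpow)

lemma ratio_power_ge:
  assumes "0 < n" "0 < k" "0 \<le> \<gamma>" "\<gamma> * real n powr x \<le> real t"
  shows "(\<gamma> / real k) ^ i * real n powr ((x - 1) * real i) \<le> (real t / (real k * real n)) ^ i"
proof -
  have "(\<gamma> / real k) ^ i * real n powr ((x - 1) * real i) = (\<gamma> / real k * real n powr (x - 1)) ^ i"
    by (simp only: power_mult_distrib powr_nat_power[OF assms(1)])
  also have "\<gamma> / real k * real n powr (x - 1) = \<gamma> * real n powr x / (real k * real n)"
    using assms(1) by (simp add: powr_diff)
  also have "\<dots> ^ i \<le> (real t / (real k * real n)) ^ i"
    using assms by (intro power_mono divide_right_mono) auto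
  finally show ?thesis .
qed

text \<open>If n^x vertices are constrained, a row constrains a further vertex with probability of
  order n^((x-1)(k-1)), so n^(S/(1+S)) rows produce n^x' of them with x' = S/(1+S) + (x-1)(k-1).
  This is exactly the recursion of \<open>obstruction_size\<close>, see \<open>xx'\<close>.\<close>

lemma rounds_tendsto:
  fixes P Q :: "'r::{comm_ring_1, finite} pmf" and q :: "nat \<Rightarrow> nat"
  assumes e0: "\<And>y. e * r * y \<in> level_ideal P 0"
    and e1: "\<And>y l. e * s * y \<in> level_ideal P l \<Longrightarrow> e * r * y \<in> level_ideal P (Suc l)"
    and rs: "r \<in> set_pmf P" "s \<in> set_pmf P"
    and Q: "\<And>j. j < l \<Longrightarrow> set_pmf Q \<subseteq> level_ideal P j"
    and k: "k \<ge> 2" and S: "S = real (k * obstruction_size k l)"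
    and \<epsilon>: "\<epsilon> > 0" and q: "eventually (\<lambda>n. \<epsilon> * real n powr (S / (1 + S)) \<le> real (q n)) at_top"
    and j: "j \<le> l"
  shows "\<exists>\<gamma>>0. \<gamma> \<le> 1 / 8 \<and>
    (\<lambda>n. measure_pmf.prob (replicate_pmf (j * q n) (datum_pmf k n (power_pmf k P) Q))
       {ds. card (forced P (e * s) n j ds) <
         nat \<lceil>\<gamma> * real n powr (1 - real (obstruction_size k j) / (1 + S))\<rceil>}) \<longlonglongrightarrow> 0"
  using j
proof (induction j)
  case 0
  have "forced P (e * s) n 0 ds = {..<n}" for n ds by (auto simp: forced_def forced_value_def)
  moreover have "\<not> n < nat \<lceil>1 / 8 * real n\<rceil>" for n
  proof -
    have "nat \<lceil>1 / 8 * real n\<rceil> \<le> n" by linarith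
    then show ?thesis by (simp only: not_less)
  qed
  ultimately show ?case by (intro exI[of _ "1 / 8"]) (simp cong: if_cong)
next
  case (Suc j)
  define x where "x = 1 - real (obstruction_size k j) / (1 + S)"
  define x' where "x' = 1 - real (obstruction_size k (Suc j)) / (1 + S)"
  define M where "M = (\<lambda>n. datum_pmf k n (power_pmf k P) Q)"
  obtain \<gamma> where \<gamma>: "\<gamma> > 0" "\<gamma> \<le> 1 / 8" and lim: "(\<lambda>n. measure_pmf.prob (replicate_pmf (j * q n) (M n))
       {ds. card (forced P (e * s) n j ds) < nat \<lceil>\<gamma> * real n powr x\<rceil>}) \<longlonglongrightarrow> 0"
    using Suc unfolding x_def M_def by auto
  have S0: "S \<ge> 0" by (simp add: S)
  have size: "real (obstruction_size k j') < 1 + S" if "j' \<le> l" for j'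
  proof -
    have "obstruction_size k j' \<le> 1 * obstruction_size k l"
      using obstruction_size_mono[OF that] by simp
    also have "\<dots> \<le> k * obstruction_size k l" using k by (intro mult_right_mono) auto
    finally show ?thesis by (simp add: S flip: of_nat_mult)
  qed
  have x: "0 < x" "x \<le> 1" and x': "0 < x'" "x' \<le> 1"
    using size[of j] size[of "Suc j"] Suc.prems S0 by (auto simp: x_def x'_def divide_less_eq)
  have xx': "x' = S / (1 + S) + (x - 1) * real (k - 1)"
  proof -
    define y where "y = real (k - 1) * real (obstruction_size k j)"
    have "x' = 1 - (1 + y) / (1 + S)" by (simp add: x'_def y_def)
    also have "\<dots> = ((1 + S) - (1 + y)) / (1 + S)" using S0 by (simp only: diff_divide_distrib) simp
    also have "\<dots> = S / (1 + S) - y / (1 + S)" by (simp add: diff_divide_distrib)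
    also have "y / (1 + S) = - ((x - 1) * real (k - 1))" by (simp add: x_def y_def)
    finally show ?thesis by simp
  qed
  obtain b where b: "b \<in> set_pmf Q" by (meson ex_in_conv set_pmf_not_empty)
  have bI: "b \<in> level_ideal P j" using Q[of j] b Suc.prems by auto
  define \<pi> where "\<pi> = (pmf P r * pmf P s) ^ k * pmf Q b"
  have \<pi>: "\<pi> > 0" using rs b by (simp add: \<pi>_def pmf_positive)
  have \<pi>1: "\<pi> \<le> 1" unfolding \<pi>_def by (intro mult_le_one power_le_one) (auto simp: pmf_le_1 mult_le_one)
  define c where "c = \<pi> / 2 * (\<gamma> / real k) ^ (k - 1)"
  have c: "c > 0" using \<pi> \<gamma> k by (simp add: c_def)
  \<comment> \<open>The bound 1/8 keeps the rounded size below n/4. The other bound makes p q / 2 at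
    least 4 \<gamma>' n^x', which outweighs the factor \<open>2 ^ t'\<close> of
    \<open>growth\<close> with 2 \<gamma>' n^x' to spare.\<close>
  define \<gamma>' where "\<gamma>' = min (1 / 8) (\<epsilon> * c / 8)"
  have \<gamma>': "\<gamma>' > 0" "\<gamma>' \<le> 1 / 8" "8 * \<gamma>' \<le> \<epsilon> * c" using \<epsilon> c by (auto simp: \<gamma>'_def)
  define t where "t = (\<lambda>n. nat \<lceil>\<gamma> * real n powr x\<rceil>)"
  define t' where "t' = (\<lambda>n. nat \<lceil>\<gamma>' * real n powr x'\<rceil>)"
  define p where "p = (\<lambda>n. c * real n powr ((x - 1) * real (k - 1)))"
  have ev: "eventually (\<lambda>n. measure_pmf.prob (replicate_pmf (Suc j * q n) (M n))
       {ds. card (forced P (e * s) n (Suc j) ds) < t' n} \<le>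
     measure_pmf.prob (replicate_pmf (j * q n) (M n)) {ds. card (forced P (e * s) n j ds) < t n} +
     exp (- (2 * \<gamma>' * real n powr x'))) at_top"
    using eventually_ge_at_top[of "max 16 k"] q powr_exceeds[OF x(1) \<gamma>(1), of "real k"]
      powr_exceeds[OF x'(1) \<gamma>'(1), of 2]
  proof eventually_elim
    case (elim n)
    have n: "n \<ge> 16" "k \<le> n" "0 < n" using elim(1) by auto
    have t: "\<gamma> * real n powr x \<le> real (t n)" unfolding t_def by linarith
    have "real k \<le> real (t n)" using t elim(3) by linarith
    then have kt: "k \<le> t n" "4 * t n \<le> n" using ceiling_le_quarter[OF x(2) \<gamma> n(1)] by (simp_all add: t_def)
    have t': "\<gamma>' * real n powr x' \<le> real (t' n)" unfolding t'_def by linarith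
    have t'_le: "real (t' n) \<le> \<gamma>' * real n powr x' + 1" using \<gamma>'(1) unfolding t'_def
      by (intro real_nat_ceiling_le) simp
    have kt': "0 < t' n" "4 * t' n \<le> n"
      using t' elim(4) ceiling_le_quarter[OF x'(2) \<gamma>'(1,2) n(1)] by (auto simp: t'_def)
    have p: "p n \<le> \<pi> * ((real (t n) / (real k * real n)) ^ (k - 1) / 2)"
      using mult_left_mono[OF ratio_power_ge[OF n(3) _ _ t, of k "k - 1"], of "\<pi> / 2"] \<pi> \<gamma> k
      by (simp add: p_def c_def mult_ac)
    have p0: "p n \<ge> 0" using c by (simp add: p_def)
    have "(real (t n) / (real k * real n)) ^ (k - 1) \<le> 1"
    proof (rule power_le_one)
      have "t n \<le> k * n" using kt(2) k by (metis le_trans mult_le_mono1 mult_1 one_le_numeral mult.commute mult_le_mono2 nat_mult_1_right)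
      then have "real (t n) \<le> real k * real n" by (metis of_nat_le_iff of_nat_mult)
      then show "real (t n) / (real k * real n) \<le> 1" using n k by (simp add: divide_le_eq)
    qed simp
    then have p1: "p n \<le> 1"
      using p \<pi>1 \<pi> mult_le_one[of \<pi> "(real (t n) / (real k * real n)) ^ (k - 1) / 2"] by simp
    have "measure_pmf.prob (replicate_pmf (j * q n + q n) (M n))
       {ds. card (forced P (e * s) n (Suc j) ds) < t' n} \<le>
     measure_pmf.prob (replicate_pmf (j * q n) (M n)) {ds. card (forced P (e * s) n j ds) < t n} +
     2 ^ t' n * (1 - p n / 2) ^ q n"
      unfolding M_def by (rule forced_round[OF e0 e1 bI k n(2) kt kt' \<pi>_def p0 p])
    moreover have "2 ^ t' n * (1 - p n / 2) ^ q n \<le> exp (- (2 * \<gamma>' * real n powr x'))"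
    proof -
      have "8 * \<gamma>' * real n powr x' \<le> \<epsilon> * c * real n powr x'"
        using \<gamma>'(3) by (intro mult_right_mono) auto
      also have "\<dots> = (\<epsilon> * real n powr (S / (1 + S))) * p n"
        unfolding xx' p_def by (simp add: powr_add)
      also have "\<dots> \<le> real (q n) * p n" using elim(2) p0 by (intro mult_right_mono) auto
      finally have qp: "8 * \<gamma>' * real n powr x' \<le> real (q n) * p n" .
      have "(2::real) ^ t' n \<le> exp 1 ^ t' n"
        by (rule power_mono) (use exp_ge_add_one_self[of 1] in auto)
      moreover have "(1 - p n / 2) ^ q n \<le> exp (- (p n / 2 * real (q n)))"
        by (rule one_minus_power_le_exp) (use p0 p1 in auto)
      moreover have "0 \<le> (1 - p n / 2) ^ q n" using p1 by simp
      ultimately have "2 ^ t' n * (1 - p n / 2) ^ q n \<le> exp 1 ^ t' n * exp (- (p n / 2 * real (q n)))"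
        by (intro mult_mono) simp_all
      also have "\<dots> = exp (real (t' n)) * exp (- (p n / 2 * real (q n)))"
        using exp_of_nat_mult[of "t' n" "1 :: real"] by simp
      also have "\<dots> = exp (real (t' n) - p n / 2 * real (q n))" by (simp flip: exp_add)
      also have "\<dots> \<le> exp (- (2 * \<gamma>' * real n powr x'))"
      proof -
        have "8 * (\<gamma>' * real n powr x') \<le> p n * real (q n)" using qp by (simp only: mult_ac)
        moreover have "p n / 2 * real (q n) = (p n * real (q n)) / 2" by simp
        ultimately have "real (t' n) - p n / 2 * real (q n) \<le> - (2 * (\<gamma>' * real n powr x'))"
          using t'_le elim(4) by linarith
        then show ?thesis by (simp add: mult.assoc)
      qed
      finally show ?thesis .
    qed
    ultimately show ?case by (simp add: add.commute)
  qed
  have "(\<lambda>n. exp (- (2 * \<gamma>' * real n powr x'))) \<longlonglongrightarrow> 0"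
    using \<gamma>'(1) x'(1) by real_asymp
  from tendsto_add[OF lim this]
  have "(\<lambda>n. measure_pmf.prob (replicate_pmf (Suc j * q n) (M n))
       {ds. card (forced P (e * s) n (Suc j) ds) < t' n}) \<longlonglongrightarrow> 0"
    by (intro tendsto_sandwich[OF _ ev tendsto_const]) (auto simp: t_def)
  then show ?case unfolding t'_def M_def x'_def using \<gamma>'(1,2) by blast
qed

text \<open>The size \<open>q'\<close> of the last batch stays free and \<open>err\<close> does not
  depend on it: at the threshold it is a constant multiple of n^alpha, above it an arbitrarily large
  one.\<close>

lemma unsat_core:
  fixes P Q :: "'r::{comm_ring_1, finite} pmf" and q :: "nat \<Rightarrow> nat"
  assumes prin: "principal_ring TYPE('r)" and k: "k \<ge> 2" and lev: "level P Q = enat l"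
    and \<epsilon>: "\<epsilon> > 0" and q: "eventually (\<lambda>n. \<epsilon> * real n powr alpha k P Q \<le> real (q n)) at_top"
  obtains c err where "c > 0" "err \<longlonglongrightarrow> 0"
    "eventually (\<lambda>n. \<forall>q'. sat_prob k (power_pmf k P) Q n (l * q n + q') \<le>
       err n + exp (- (c * real n powr (- alpha k P Q) * real q'))) at_top"
proof -
  have k1: "1 \<le> k" using k by simp
  define S where "S = real (k * obstruction_size k l)"
  have \<alpha>: "alpha k P Q = S / (1 + S)" using alpha_enat[OF k1 lev S_def] .
  have S0: "S \<ge> 0" by (simp add: S_def)
  obtain b where b: "b \<in> set_pmf Q" "b \<notin> level_ideal P l" using level_enatD(1)[OF lev] by blast
  obtain e where e: "e * b \<notin> level_ideal P l"
    and chain: "\<And>x y. (\<exists>z. e * x = e * y * z) \<or> (\<exists>z. e * y = e * x * z)"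
    using separating_idempotent[OF prin is_ideal_level_ideal b(2)] by blast
  obtain r s where rs: "r \<in> set_pmf P" "s \<in> set_pmf P"
    and e0: "\<And>y. e * r * y \<in> level_ideal P 0"
    and e1: "\<And>y l. e * s * y \<in> level_ideal P l \<Longrightarrow> e * r * y \<in> level_ideal P (Suc l)"
    using extremal_coefficients[OF chain, of P] by blast
  define x where "x = 1 - real (obstruction_size k l) / (1 + S)"
  define M where "M = (\<lambda>n. datum_pmf k n (power_pmf k P) Q)"
  obtain \<gamma> where \<gamma>: "\<gamma> > 0" "\<gamma> \<le> 1 / 8" and lim: "(\<lambda>n. measure_pmf.prob (replicate_pmf (l * q n) (M n))
       {ds. card (forced P (e * s) n l ds) < nat \<lceil>\<gamma> * real n powr x\<rceil>}) \<longlonglongrightarrow> 0"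
    using rounds_tendsto[OF e0 e1 rs level_enatD(2)[OF lev] k S_def \<epsilon>, of q l] q
    unfolding x_def M_def \<alpha> by auto
  have "real (obstruction_size k l) < 1 + S"
  proof -
    have "1 * obstruction_size k l \<le> k * obstruction_size k l" using k by (intro mult_right_mono) auto
    then have "real (obstruction_size k l) \<le> S" unfolding S_def by (simp only: of_nat_le_iff mult_1)
    then show ?thesis by simp
  qed
  then have x: "0 < x" "x \<le> 1" using S0 by (auto simp: x_def divide_less_eq)
  \<comment> \<open>A row of the last batch is contradictory with probability of order (n^x / n)^k,
    which is n^(-alpha).\<close>
  have x\<alpha>: "(x - 1) * real k = - alpha k P Q" unfolding \<alpha> x_def by (simp add: S_def)
  define \<pi> where "\<pi> = pmf P r ^ k * pmf Q b"
  have \<pi>: "\<pi> > 0" using rs b by (simp add: \<pi>_def pmf_positive)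
  define c where "c = \<pi> * (\<gamma> / real k) ^ k"
  have "c > 0" using \<pi> \<gamma> k by (simp add: c_def)
  moreover have "eventually (\<lambda>n. \<forall>q'. sat_prob k (power_pmf k P) Q n (l * q n + q') \<le>
       measure_pmf.prob (replicate_pmf (l * q n) (M n))
         {ds. card (forced P (e * s) n l ds) < nat \<lceil>\<gamma> * real n powr x\<rceil>} +
       exp (- (c * real n powr (- alpha k P Q) * real q'))) at_top"
    using eventually_ge_at_top[of "max 16 k"] powr_exceeds[OF x(1) \<gamma>(1), of "real k"]
  proof eventually_elim
    case (elim n)
    define t where "t = nat \<lceil>\<gamma> * real n powr x\<rceil>"
    have n: "n \<ge> 16" "k \<le> n" "0 < n" using elim(1) by auto
    have t: "\<gamma> * real n powr x \<le> real t" unfolding t_def by linarith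
    have "real k \<le> real t" using t elim(2) by linarith
    moreover have "4 * t \<le> n" using ceiling_le_quarter[OF x(2) \<gamma> n(1)] by (simp only: t_def)
    ultimately have kt: "k \<le> t" "t \<le> n" by linarith+
    have p: "c * real n powr (- alpha k P Q) \<le> pmf P r ^ k * pmf Q b * (real t / (real k * real n)) ^ k"
      using mult_left_mono[OF ratio_power_ge[OF n(3) _ _ t, of k k], of \<pi>] \<pi> \<gamma> k
      unfolding x\<alpha> c_def \<pi>_def by (simp add: mult_ac)
    have p0: "0 \<le> c * real n powr (- alpha k P Q)" using \<open>c > 0\<close> by simp
    show ?case
      unfolding M_def t_def[symmetric]
      by (intro allI final_round[OF e0 e1 e k1 n(2) kt p0 p])
  qed
  ultimately show ?thesis using that lim by blast
qed

lemma alpha_bounds: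
  assumes "k \<ge> 1" "level P Q = enat l"
  shows "0 \<le> alpha k P Q" "alpha k P Q < 1" "l > 0 \<Longrightarrow> alpha k P Q > 0" "l = 0 \<Longrightarrow> alpha k P Q = 0"
proof -
  define S where "S = real (k * obstruction_size k l)"
  have S: "S \<ge> 0" by (simp add: S_def)
  have \<alpha>: "alpha k P Q = S / (1 + S)" using alpha_enat[OF assms S_def] .
  show "0 \<le> alpha k P Q" "alpha k P Q < 1" using S by (auto simp: \<alpha> divide_less_eq)
  show "l = 0 \<Longrightarrow> alpha k P Q = 0" by (simp add: \<alpha> S_def)
  show "alpha k P Q > 0" if "l > 0"
  proof -
    have "S > 0" using that assms(1) by (cases l) (simp_all add: S_def del: of_nat_mult)
    then show ?thesis by (simp add: \<alpha>)
  qed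
qed

lemma unsat_limsup:
  fixes P Q :: "'r::{comm_ring_1, finite} pmf"
  assumes prin: "principal_ring TYPE('r)" and k: "k \<ge> 2" and lev: "level P Q = enat l" and C: "C > 0"
  obtains \<delta> where "\<delta> < 1"
    "eventually (\<lambda>n. sat_prob k (power_pmf k P) Q n (nat \<lceil>C * real n powr alpha k P Q\<rceil>) \<le> \<delta>) at_top"
proof -
  define a where "a = alpha k P Q"
  have k1: "k \<ge> 1" using k by simp
  note ab = alpha_bounds[OF k1 lev, folded a_def]
  define m where "m = (\<lambda>n. nat \<lceil>C * real n powr a\<rceil>)"
  \<comment> \<open>\<open>Suc l\<close> batches of equal size; what the division leaves over joins
    the last one. The 2 in \<epsilon> absorbs this rounding.\<close>
  define q where "q = (\<lambda>n. m n div Suc l)"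
  define \<epsilon> where "\<epsilon> = C / (2 * real (Suc l))"
  have \<epsilon>: "\<epsilon> > 0" using C by (simp add: \<epsilon>_def)
  \<comment> \<open>At level 0 the exponent is 0 and \<open>m n\<close> is eventually constant, but
    one row is enough; otherwise \<open>m n\<close> tends to infinity.\<close>
  have big: "eventually (\<lambda>n. Suc l \<le> m n) at_top"
  proof (cases "l = 0")
    case True
    show ?thesis using eventually_gt_at_top[of 0]
      by eventually_elim (use True C in \<open>simp add: m_def Suc_le_eq\<close>)
  next
    case False
    then have "eventually (\<lambda>n. real (Suc l) \<le> C * real n powr a) at_top" using powr_exceeds ab C by blast
    then show ?thesis by eventually_elim (simp add: m_def, linarith)
  qed
  then have q: "eventually (\<lambda>n. \<epsilon> * real n powr a \<le> real (q n)) at_top"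
  proof eventually_elim
    case (elim n)
    have "m n \<le> 2 * Suc l * q n"
    proof -
      have "m n = Suc l * q n + m n mod Suc l"
        unfolding q_def by (simp only: mult_div_mod_eq)
      moreover have "m n mod Suc l < Suc l" by simp
      moreover have "q n \<ge> 1" using elim by (simp add: q_def div_greater_zero_iff Suc_le_eq)
      then have "Suc l \<le> Suc l * q n" using mult_le_mono2[of 1 "q n" "Suc l"] by simp
      ultimately show ?thesis by linarith
    qed
    then have "real (m n) \<le> 2 * real (Suc l) * real (q n)" by (metis of_nat_le_iff of_nat_mult of_nat_numeral)
    moreover have "C * real n powr a \<le> real (m n)" unfolding m_def by linarith
    ultimately show ?case by (simp add: \<epsilon>_def field_simps)
  qed
  obtain c err where c: "c > 0" and err: "err \<longlonglongrightarrow> 0" and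
    bd: "eventually (\<lambda>n. \<forall>q'. sat_prob k (power_pmf k P) Q n (l * q n + q') \<le>
       err n + exp (- (c * real n powr (- a) * real q'))) at_top"
    using unsat_core[OF prin k lev \<epsilon> q[unfolded a_def]] unfolding a_def by blast
  define \<eta> where "\<eta> = exp (- (c * \<epsilon>))"
  have \<eta>: "\<eta> < 1" using c \<epsilon> by (simp add: \<eta>_def)
  have "eventually (\<lambda>n. err n < (1 - \<eta>) / 2) at_top" using err \<eta> by (intro order_tendstoD) auto
  then have "eventually (\<lambda>n. sat_prob k (power_pmf k P) Q n (m n) \<le> (1 - \<eta>) / 2 + \<eta>) at_top"
    using bd q eventually_gt_at_top[of 0]
  proof eventually_elim
    case (elim n)
    have "l * q n + q n \<le> m n" unfolding q_def
      by (metis add.commute mult_Suc mult.commute div_times_less_eq_dividend)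
    then obtain q' where q': "m n = l * q n + q'" "q n \<le> q'"
      by (metis add_le_cancel_left le_add1 le_Suc_ex le_trans add.assoc)
    have "c * \<epsilon> = c * real n powr (- a) * (\<epsilon> * real n powr a)"
      using elim(4) by (simp add: powr_minus field_simps)
    also have "\<dots> \<le> c * real n powr (- a) * real q'"
      using c elim(3) q'(2) by (intro mult_left_mono) auto
    finally have "exp (- (c * real n powr (- a) * real q')) \<le> \<eta>" by (simp add: \<eta>_def)
    moreover have "sat_prob k (power_pmf k P) Q n (m n) \<le> err n + exp (- (c * real n powr (- a) * real q'))"
      unfolding q'(1) using elim(2) by blast
    ultimately show ?case using elim(1) by linarith
  qed
  moreover have "(1 - \<eta>) / 2 + \<eta> < 1" using \<eta> by (simp add: field_simps)
  ultimately show ?thesis using that unfolding m_def a_def by blast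
qed

lemma unsat_tendsto_finite:
  fixes P Q :: "'r::{comm_ring_1, finite} pmf"
  assumes prin: "principal_ring TYPE('r)" and k: "k \<ge> 2" and lev: "level P Q = enat l"
    and m: "(\<lambda>n. real n powr alpha k P Q) \<in> o(\<lambda>n. real (m n))"
  shows "(\<lambda>n. sat_prob k (power_pmf k P) Q n (m n)) \<longlonglongrightarrow> 0"
proof -
  define a where "a = alpha k P Q"
  have k1: "k \<ge> 1" using k by simp
  note ab = alpha_bounds[OF k1 lev, folded a_def]
  define q where "q = (\<lambda>n. nat \<lceil>real n powr a\<rceil>)"
  have "eventually (\<lambda>n. 1 * real n powr a \<le> real (q n)) at_top"
    by (rule always_eventually) (auto simp: q_def of_nat_ceiling)
  then obtain c err where c: "c > 0" and err: "err \<longlonglongrightarrow> 0" and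
    bd: "eventually (\<lambda>n. \<forall>q'. sat_prob k (power_pmf k P) Q n (l * q n + q') \<le>
       err n + exp (- (c * real n powr (- a) * real q'))) at_top"
    using unsat_core[OF prin k lev, of 1 q] unfolding a_def by auto
  show ?thesis
  proof (rule tendstoI)
    fix \<delta> :: real assume \<delta>: "\<delta> > 0"
    obtain K where K: "K \<ge> 0" "exp (- (c * K)) < \<delta> / 2"
    proof
      show "0 \<le> max 0 ((1 - ln (\<delta> / 2)) / c)" by simp
      have "1 - ln (\<delta> / 2) \<le> c * max 0 ((1 - ln (\<delta> / 2)) / c)"
        using c by (simp add: max_def field_simps)
      then have "- (c * max 0 ((1 - ln (\<delta> / 2)) / c)) < ln (\<delta> / 2)" by simp
      then show "exp (- (c * max 0 ((1 - ln (\<delta> / 2)) / c))) < \<delta> / 2"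
        using \<delta> by (metis exp_less_mono exp_ln half_gt_zero)
    qed
    \<comment> \<open>The first \<open>l\<close> batches take at most 2 l n^a rows, as rounding up
      at most doubles n^a; at least K n^a rows are left for the last one.\<close>
    define K' where "K' = K + 2 * real l + 1"
    have "eventually (\<lambda>n. norm (real n powr a) \<le> (1 / K') * norm (real (m n))) at_top"
      using landau_o.smallD[OF m, of "1 / K'"] K(1) unfolding a_def K'_def by simp
    moreover have "eventually (\<lambda>n. err n < \<delta> / 2) at_top" using err \<delta> by (intro order_tendstoD) auto
    ultimately show "eventually (\<lambda>n. dist (sat_prob k (power_pmf k P) Q n (m n)) 0 < \<delta>) at_top"
      using bd eventually_gt_at_top[of 0]
    proof eventually_elim
      case (elim n)
      have n1: "1 \<le> real n powr a" using elim(4) ab(1) by (intro ge_one_powr_ge_zero) auto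
      have mK: "K' * real n powr a \<le> real (m n)"
        using elim(1) K(1) by (simp add: K'_def field_simps)
      have "real (q n) \<le> real n powr a + 1" unfolding q_def by (intro real_nat_ceiling_le) simp
      then have "real (q n) \<le> 2 * real n powr a" using n1 by linarith
      then have lq: "real (l * q n) \<le> 2 * real l * real n powr a"
        using mult_left_mono[of "real (q n)" "2 * real n powr a" "real l"] by simp
      have "real (l * q n) \<le> K' * real n powr a"
      proof -
        have "0 \<le> K * real n powr a" using K(1) by simp
        then show ?thesis using lq n1 by (simp add: K'_def distrib_right)
      qed
      then have "l * q n \<le> m n" using mK by linarith
      then obtain q' where q': "m n = l * q n + q'" using le_Suc_ex by blast
      have "K * real n powr a \<le> real q'"
        using lq mK q' n1 by (simp add: K'_def distrib_right)
      then have "c * real n powr (- a) * (K * real n powr a) \<le> c * real n powr (- a) * real q'"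
        using c by (intro mult_left_mono) auto
      moreover have "c * real n powr (- a) * (K * real n powr a) = c * K"
        using elim(4) by (simp add: powr_minus field_simps)
      ultimately have "exp (- (c * real n powr (- a) * real q')) \<le> exp (- (c * K))" by simp
      moreover have "sat_prob k (power_pmf k P) Q n (m n) \<le> err n + exp (- (c * real n powr (- a) * real q'))"
        unfolding q' using elim(3) by blast
      ultimately have "sat_prob k (power_pmf k P) Q n (m n) < \<delta>"
        using elim(2) K(2) by linarith
      then show ?case by (simp add: sat_prob_def)
    qed
  qed
qed


section \<open>Infinite level: the first moment over assignments\<close>

lemma bij_betw_pos:
  assumes "finite J"
  shows "bij_betw (pos J) J {..<card J}"
proof -
  have inj: "inj_on (pos J) J" using pos_inj[OF assms] unfolding inj_on_def by blast
  moreover have "pos J ` J \<subseteq> {..<card J}" using pos_less[OF assms] by auto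
  moreover have "card (pos J ` J) = card {..<card J}" using inj by (simp add: card_image)
  ultimately show ?thesis unfolding bij_betw_def using card_subset_eq[of "{..<card J}"] by blast
qed

lemma popular_value:
  fixes x :: "nat \<Rightarrow> 'r::finite"
  obtains \<sigma> where "n \<le> CARD('r) * card {v. v < n \<and> x v = \<sigma>}"
proof (rule ccontr)
  assume "\<not> thesis"
  then have less: "CARD('r) * card {v. v < n \<and> x v = \<sigma>} < n" for \<sigma> using that not_le by blast
  have "{..<n} = (\<Union>\<sigma>\<in>UNIV. {v. v < n \<and> x v = \<sigma>})" by auto
  then have "n = card (\<Union>\<sigma>\<in>UNIV. {v. v < n \<and> x v = \<sigma>})" by (metis card_lessThan)
  also have "\<dots> = (\<Sum>\<sigma>\<in>UNIV. card {v. v < n \<and> x v = \<sigma>})"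
    by (rule card_UN_disjoint) auto
  finally have "CARD('r) * n = (\<Sum>\<sigma>\<in>(UNIV :: 'r set). CARD('r) * card {v. v < n \<and> x v = \<sigma>})"
    unfolding sum_distrib_left[symmetric] by (rule arg_cong)
  also have "\<dots> < (\<Sum>\<sigma>\<in>(UNIV :: 'r set). n)" using less by (intro sum_strict_mono) auto
  finally show False by simp
qed

text \<open>Some value \<sigma> is taken on a share of at least 1/|R| of the vertices, and
  \<open>A2\<close> provides labels that the constant assignment \<sigma> violates. A row inside
  that set of vertices with these labels is violated; \<sigma> has finitely many possible values, so
  a minimum makes the bound uniform in \<open>x\<close>.\<close>

lemma row_violation_prob:
  fixes P Q :: "'r::{comm_ring_1, finite} pmf"
  assumes k: "k \<ge> 1" and A2: "A2 k (power_pmf k P) Q"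
  obtains c where "0 < c" "c \<le> 1"
    "\<And>n x. k * CARD('r) \<le> n \<Longrightarrow>
      c \<le> measure_pmf.prob (datum_pmf k n (power_pmf k P) Q) {d. \<not> solves n x d}"
proof -
  have "\<forall>\<sigma>. \<exists>a b. a \<in> set_pmf (power_pmf k P) \<and> b \<in> set_pmf Q \<and> (\<Sum>i<k. a i * \<sigma>) \<noteq> b"
    using A2 unfolding A2_def by blast
  then obtain A B where AB: "\<And>\<sigma>. A \<sigma> \<in> set_pmf (power_pmf k P)" "\<And>\<sigma>. B \<sigma> \<in> set_pmf Q"
    "\<And>\<sigma>. (\<Sum>i<k. A \<sigma> i * \<sigma>) \<noteq> B \<sigma>" by metis
  define \<pi> where "\<pi> = (\<lambda>\<sigma>. (\<Prod>i<k. pmf P (A \<sigma> i)) * pmf Q (B \<sigma>))"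
  have "A \<sigma> i \<in> set_pmf P" if "i < k" for \<sigma> i
    using AB(1)[of \<sigma>] that unfolding power_pmf_def by (auto simp: set_Pi_pmf PiE_dflt_def)
  then have pos: "\<pi> \<sigma> > 0" for \<sigma>
    unfolding \<pi>_def using AB(2) by (intro mult_pos_pos prod_pos) (auto simp: pmf_positive)
  define \<pi>m where "\<pi>m = Min (range \<pi>)"
  have "\<pi>m \<in> range \<pi>" unfolding \<pi>m_def by (rule Min_in) auto
  then have \<pi>m: "\<pi>m > 0" "\<pi>m \<le> \<pi> \<sigma>" for \<sigma> using pos by (auto simp: \<pi>m_def)
  define N where "N = k * CARD('r)"
  have N: "N > 0" using k by (simp add: N_def)
  define c where "c = \<pi>m * (1 / real N) ^ k"
  have c: "c > 0" using \<pi>m(1) N by (simp add: c_def)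
  have main: "c \<le> measure_pmf.prob (datum_pmf k n (power_pmf k P) Q) {d. \<not> solves n x d}" if n: "N \<le> n" for n x
  proof -
    obtain \<sigma> where \<sigma>: "n \<le> CARD('r) * card {v. v < n \<and> x v = \<sigma>}" using popular_value .
    define U where "U = {v. v < n \<and> x v = \<sigma>}"
    have "k * CARD('r) \<le> CARD('r) * card U" using n \<sigma> unfolding N_def U_def by (rule order_trans)
    then have kU: "k \<le> card U" by (simp add: mult.commute[of k])
    have Un: "U \<subseteq> {..<n}" by (auto simp: U_def)
    have kn: "k \<le> n" using kU card_mono[OF _ Un] by simp
    define F where "F = {J\<in>edges k n. J \<subseteq> U}"
    have "\<pi> \<sigma> * (real (card F) / real (n choose k)) \<le>
        measure_pmf.prob (datum_pmf k n (power_pmf k P) Q) {d. \<not> solves n x d}"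
      unfolding datum_pmf_def
    proof (rule prob_datum_ge[OF kn])
      show "F \<subseteq> edges k n" by (auto simp: F_def)
      fix J assume J: "J \<in> F"
      then have JU: "J \<subseteq> U" and J': "finite J" "card J = k" "J \<subseteq> {..<n}" using edge_finite by (auto simp: F_def)
      show "\<pi> \<sigma> \<le> measure_pmf.prob (pair_pmf (power_pmf k P) Q) {l. (J, l) \<in> {d. \<not> solves n x d}}"
        unfolding \<pi>_def
      proof (rule prob_labels_ge)
        fix \<tau> assume \<tau>: "\<And>i. i < k \<Longrightarrow> \<tau> i = A \<sigma> i"
        have "(\<Sum>v<n. coef J \<tau> v * x v) = (\<Sum>v\<in>J. A \<sigma> (pos J v) * \<sigma>)"
          unfolding sum_coef[OF J'(3)] using \<tau> pos_less[OF J'(1)] J'(2) JU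
          by (intro sum.cong) (auto simp: U_def)
        also have "\<dots> = (\<Sum>i<k. A \<sigma> i * \<sigma>)"
          using sum.reindex_bij_betw[OF bij_betw_pos[OF J'(1)], of "\<lambda>i. A \<sigma> i * \<sigma>"] J'(2) by simp
        finally show "(\<tau>, B \<sigma>) \<in> {l. (J, l) \<in> {d. \<not> solves n x d}}" using AB(3)[of \<sigma>] by simp
      qed
    qed
    moreover have "c \<le> \<pi> \<sigma> * (real (card F) / real (n choose k))"
      unfolding c_def
    proof (rule mult_mono)
      have "real n \<le> real (CARD('r)) * real (card U)"
        using \<sigma> unfolding U_def by (metis of_nat_le_iff of_nat_mult)
      then have "1 / real N \<le> real (card U) / (real k * real n)"
      proof -
        have "n > 0" using n N by simp
        then show ?thesis using k \<open>real n \<le> real CARD('r) * real (card U)\<close> by (simp add: N_def field_simps)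
      qed
      then have "(1 / real N) ^ k \<le> (real (card U) / (real k * real n)) ^ k"
        by (intro power_mono) auto
      also have "\<dots> \<le> real (card F) / real (n choose k)"
        unfolding F_def by (rule edges_within_ratio[OF k kn Un kU])
      finally show "(1 / real N) ^ k \<le> real (card F) / real (n choose k)" .
    qed (use \<pi>m pos[of \<sigma>] in auto)
    ultimately show ?thesis by linarith
  qed
  have "c \<le> 1" using main[of N "\<lambda>_. 0"] measure_pmf.prob_le_1 order_trans by blast
  then show ?thesis using that c main unfolding N_def by blast
qed

lemma sat_prob_first_moment:
  fixes P Q :: "'r::{comm_ring_1, finite} pmf"
  assumes c: "0 \<le> c" "c \<le> 1"
    and viol: "\<And>x. c \<le> measure_pmf.prob (datum_pmf k n Phat Q) {d. \<not> solves n x d}"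
  shows "sat_prob k Phat (Q :: 'r pmf) n m \<le> real CARD('r) ^ n * exp (- (c * real m))"
proof -
  \<comment> \<open>Only the values below \<open>n\<close> matter, so lists of length
    \<open>n\<close> represent all assignments.\<close>
  define X where "X = {xs :: 'r list. set xs \<subseteq> UNIV \<and> length xs = n}"
  have X: "finite X" "card X = CARD('r) ^ n"
    unfolding X_def by (rule finite_lists_length_eq, simp, subst card_lists_length_eq) auto
  define S where "S = (\<lambda>xs :: 'r list. {ds. set ds \<subseteq> {d. solves n (\<lambda>v. xs ! v) d}})"
  have "sat_prob k Phat Q n m \<le> measure_pmf.prob (replicate_pmf m (datum_pmf k n Phat Q)) (\<Union>xs\<in>X. S xs)"
    unfolding sat_prob_eq_list
  proof (intro measure_pmf.finite_measure_mono subsetI)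
    fix ds :: "(nat set \<times> (nat \<Rightarrow> 'r) \<times> 'r) list"
    assume "ds \<in> {ds. \<exists>x. \<forall>d\<in>set ds. solves n x d}"
    then obtain x where x: "\<And>d. d \<in> set ds \<Longrightarrow> solves n x d" by blast
    have "solves n (\<lambda>v. map x [0..<n] ! v) d = solves n x d" for d
      unfolding solves_iff by simp
    then have "ds \<in> S (map x [0..<n])" using x by (auto simp: S_def)
    moreover have "map x [0..<n] \<in> X" by (simp add: X_def)
    ultimately show "ds \<in> (\<Union>xs\<in>X. S xs)" by blast
  qed simp
  also have "\<dots> \<le> real (card X) * exp (- (c * real m))"
  proof (rule prob_union_le[OF X(1)])
    fix xs :: "'r list"
    define M where "M = datum_pmf k n Phat Q"
    let ?A = "{d. solves n (\<lambda>v. xs ! v) d}"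
    have "measure_pmf.prob M ?A = 1 - measure_pmf.prob M {d. \<not> solves n (\<lambda>v. xs ! v) d}"
      using measure_pmf.prob_compl[of "{d. \<not> solves n (\<lambda>v. xs ! v) d}" M] by (simp add: set_diff_eq)
    then have "measure_pmf.prob M ?A \<le> 1 - c" using viol[of "(!) xs"] unfolding M_def by linarith
    then have "measure_pmf.prob M ?A ^ m \<le> (1 - c) ^ m" by (intro power_mono) auto
    also have "\<dots> \<le> exp (- (c * real m))" by (rule one_minus_power_le_exp[OF c])
    finally show "measure_pmf.prob (replicate_pmf m (datum_pmf k n Phat Q)) (S xs) \<le> exp (- (c * real m))"
      unfolding S_def prob_replicate_all M_def .
  qed
  finally show ?thesis by (simp add: X(2))
qed

lemma unsat_tendsto_infinite:
  fixes P Q :: "'r::{comm_ring_1, finite} pmf"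
  assumes k: "k \<ge> 1" and A2: "A2 k (power_pmf k P) Q" and m: "(\<lambda>n. real n) \<in> o(\<lambda>n. real (m n))"
  shows "(\<lambda>n. sat_prob k (power_pmf k P) Q n (m n)) \<longlonglongrightarrow> 0"
proof -
  obtain c where c: "0 < c" "c \<le> 1" and viol: "\<And>n x. k * CARD('r) \<le> n \<Longrightarrow>
      c \<le> measure_pmf.prob (datum_pmf k n (power_pmf k P) Q) {d. \<not> solves n x d}"
    using row_violation_prob[OF k A2] by blast
  \<comment> \<open>Once c m is at least n (ln |R| + 1), the number |R|^n of assignments is beaten
    by a factor exp(-n).\<close>
  define K where "K = (ln (real CARD('r)) + 1) / c"
  have "CARD('r) \<ge> 1" by (simp add: Suc_le_eq)
  then have ln: "ln (real CARD('r)) \<ge> 0" by simp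
  then have K: "K > 0" unfolding K_def using c by (intro divide_pos_pos) linarith+
  have "eventually (\<lambda>n. norm (real n) \<le> (1 / K) * norm (real (m n))) at_top"
    using landau_o.smallD[OF m, of "1 / K"] K by simp
  then have upper: "eventually (\<lambda>n. sat_prob k (power_pmf k P) Q n (m n) \<le> exp (- real n)) at_top"
    using eventually_ge_at_top[of "k * CARD('r)"]
  proof eventually_elim
    case (elim n)
    have "K * real n \<le> real (m n)" using elim(1) K by (simp add: field_simps)
    then have "c * (K * real n) \<le> c * real (m n)" using c by (intro mult_left_mono) auto
    then have cm: "real n * ln (real CARD('r)) + real n \<le> c * real (m n)"
    proof -
      have "c * K = ln (real CARD('r)) + 1" using c by (simp add: K_def)
      then have "c * (K * real n) = (ln (real CARD('r)) + 1) * real n" by (simp flip: mult.assoc)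
      then show ?thesis using \<open>c * (K * real n) \<le> c * real (m n)\<close> by (simp add: algebra_simps)
    qed
    have "sat_prob k (power_pmf k P) Q n (m n) \<le> real CARD('r) ^ n * exp (- (c * real (m n)))"
      using c viol[OF elim(2)] by (intro sat_prob_first_moment) auto
    also have "real CARD('r) ^ n = exp (real n * ln (real CARD('r)))"
      by (simp add: exp_of_nat_mult)
    also have "exp (real n * ln (real CARD('r))) * exp (- (c * real (m n))) =
        exp (real n * ln (real CARD('r)) - c * real (m n))" by (simp flip: exp_add)
    also have "\<dots> \<le> exp (- real n)" using cm by simp
    finally show ?case .
  qed
  have lower: "eventually (\<lambda>n. 0 \<le> sat_prob k (power_pmf k P) Q n (m n)) at_top"
    by (rule always_eventually) (simp add: sat_prob_def)
  have "(\<lambda>n. exp (- real n)) \<longlonglongrightarrow> 0" by real_asymp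
  from tendsto_sandwich[OF lower upper tendsto_const this] show ?thesis .
qed

section \<open>Satisfiable systems\<close>

definition row_lists :: "nat \<Rightarrow> nat \<Rightarrow> nat list set" where
  "row_lists m t = {gs. set gs \<subseteq> {..<m} \<and> length gs = t}"

lemma finite_row_lists: "finite (row_lists m t)"
  unfolding row_lists_def by (rule finite_lists_length_eq) simp

lemma card_row_lists: "card (row_lists m t) = m ^ t"
  unfolding row_lists_def by (subst card_lists_length_eq) simp_all

definition has_conn :: "nat \<Rightarrow> nat \<Rightarrow> (nat \<Rightarrow> nat set) set" where
  "has_conn m t = {H. \<exists>gs\<in>row_lists m t. conn H gs}"

definition has_dense :: "nat \<Rightarrow> nat \<Rightarrow> (nat \<Rightarrow> nat set) set" where
  "has_dense m L = {H. \<exists>g gs. Suc (length gs) \<le> L \<and> set (g # gs) \<subseteq> {..<m} \<and> dense H g gs}"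

definition has_cycle :: "nat \<Rightarrow> (nat \<Rightarrow> nat set) set" where
  "has_cycle m = {H. \<exists>g gs. set (g # gs) \<subseteq> {..<m} \<and> closed_trail H g gs}"

lemma prob_has_conn_le:
  assumes k: "1 \<le> k" "k \<le> n"
  shows "measure_pmf.prob (hyper_pmf k n m) (has_conn m (Suc t)) \<le>
    real m ^ Suc t * (real (k\<^sup>2 * Suc t) / real n) ^ t"
proof -
  have "has_conn m (Suc t) = (\<Union>gs\<in>row_lists m (Suc t). {H. conn H gs})" by (auto simp: has_conn_def)
  moreover have "measure_pmf.prob (hyper_pmf k n m) {H. conn H gs} \<le> (real (k\<^sup>2 * Suc t) / real n) ^ t"
    if "gs \<in> row_lists m (Suc t)" for gs
    using prob_conn_le[OF k, of gs m "Suc t"] that by (simp add: row_lists_def)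
  ultimately show ?thesis
    using prob_union_le[OF finite_row_lists, of m "Suc t" "hyper_pmf k n m" "\<lambda>gs. {H. conn H gs}"]
    by (simp add: card_row_lists)
qed

lemma prob_has_dense_le:
  assumes k: "2 \<le> k" "k \<le> n" and y: "y = real (k\<^sup>2 * L) * real m / real n" "y \<le> 1"
  shows "measure_pmf.prob (hyper_pmf k n m) (has_dense m L) \<le> real L * y"
proof -
  have y0: "y \<ge> 0" by (simp add: y)
  let ?E = "\<lambda>t. \<Union>xs\<in>row_lists m (Suc t). {H. dense H (hd xs) (tl xs)}"
  have "has_dense m L \<subseteq> (\<Union>t\<in>{..<L}. ?E t)"
  proof
    fix H assume "H \<in> has_dense m L"
    then obtain g gs where "Suc (length gs) \<le> L" "set (g # gs) \<subseteq> {..<m}" "dense H g gs"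
      unfolding has_dense_def by blast
    then show "H \<in> (\<Union>t\<in>{..<L}. ?E t)"
      by (intro UN_I[of "length gs"] UN_I[of "g # gs"]) (auto simp: row_lists_def)
  qed
  then have "measure_pmf.prob (hyper_pmf k n m) (has_dense m L) \<le>
      measure_pmf.prob (hyper_pmf k n m) (\<Union>t\<in>{..<L}. ?E t)"
    by (intro measure_pmf.finite_measure_mono) auto
  also have "\<dots> \<le> real (card {..<L}) * y"
  proof (rule prob_union_le)
    fix t assume t: "t \<in> {..<L}"
    have "measure_pmf.prob (hyper_pmf k n m) (?E t) \<le>
        real (card (row_lists m (Suc t))) * (real (k\<^sup>2 * L) / real n) ^ (Suc t)"
    proof (rule prob_union_le[OF finite_row_lists])
      fix xs assume xs: "xs \<in> row_lists m (Suc t)"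
      then obtain g gs where "xs = g # gs" by (cases xs) (auto simp: row_lists_def)
      then show "measure_pmf.prob (hyper_pmf k n m) {H. dense H (hd xs) (tl xs)} \<le>
          (real (k\<^sup>2 * L) / real n) ^ Suc t"
        using prob_dense_le[OF k, of g gs m L] xs t by (simp add: row_lists_def)
    qed
    also have "\<dots> = y ^ Suc t"
      unfolding card_row_lists y by (simp only: power_mult_distrib power_divide of_nat_power) (simp add: mult_ac)
    also have "\<dots> \<le> y ^ 1" using y0 y(2) by (intro power_decreasing) auto
    finally show "measure_pmf.prob (hyper_pmf k n m) (?E t) \<le> y" by simp
  qed simp
  finally show ?thesis by simp
qed

text \<open>A closed trail has distinct rows but may have any length up to \<open>m\<close>. The
  bound 1/2 on \<open>y\<close> turns the sum over lengths into a geometric series comparable to its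
  first term.\<close>

lemma prob_has_cycle_le:
  assumes k: "2 \<le> k" "k \<le> n" and y: "y = real (k\<^sup>2) * real m / real n" "y \<le> 1 / 2"
  shows "measure_pmf.prob (hyper_pmf k n m) (has_cycle m) \<le> 2 * y"
proof -
  have y0: "y \<ge> 0" by (simp add: y)
  let ?E = "\<lambda>t. \<Union>xs\<in>row_lists m (Suc t). {H. closed_trail H (hd xs) (tl xs)}"
  have "has_cycle m \<subseteq> (\<Union>t\<in>{..<m}. ?E t)"
  proof
    fix H assume "H \<in> has_cycle m"
    then obtain g gs where *: "set (g # gs) \<subseteq> {..<m}" "closed_trail H g gs"
      unfolding has_cycle_def by blast
    then have "distinct (g # gs)" using trail_distinct by (auto simp: closed_trail_def)
    then have "length (g # gs) \<le> m"
      using card_mono[OF _ *(1)] distinct_card[of "g # gs"] by simp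
    then show "H \<in> (\<Union>t\<in>{..<m}. ?E t)"
      using * by (intro UN_I[of "length gs"] UN_I[of "g # gs"]) (auto simp: row_lists_def)
  qed
  then have "measure_pmf.prob (hyper_pmf k n m) (has_cycle m) \<le>
      measure_pmf.prob (hyper_pmf k n m) (\<Union>t\<in>{..<m}. ?E t)"
    by (intro measure_pmf.finite_measure_mono) auto
  also have "\<dots> \<le> (\<Sum>t\<in>{..<m}. measure_pmf.prob (hyper_pmf k n m) (?E t))"
    by (intro measure_pmf.finite_measure_subadditive_finite) auto
  also have "\<dots> \<le> (\<Sum>t\<in>{..<m}. y * (1 / 2) ^ t)"
  proof (rule sum_mono)
    fix t
    have "measure_pmf.prob (hyper_pmf k n m) (?E t) \<le>
        real (card (row_lists m (Suc t))) * (real (k\<^sup>2) / real n) ^ (Suc t)"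
    proof (rule prob_union_le[OF finite_row_lists])
      fix xs assume xs: "xs \<in> row_lists m (Suc t)"
      then obtain g gs where "xs = g # gs" by (cases xs) (auto simp: row_lists_def)
      then show "measure_pmf.prob (hyper_pmf k n m) {H. closed_trail H (hd xs) (tl xs)} \<le>
          (real (k\<^sup>2) / real n) ^ Suc t"
        using prob_cycle_le[OF k, of g gs m] xs by (simp add: row_lists_def)
    qed
    also have "\<dots> = y ^ Suc t"
      unfolding card_row_lists y by (simp only: power_mult_distrib power_divide of_nat_power) (simp add: mult_ac)
    also have "\<dots> \<le> y * (1 / 2) ^ t" using y0 y(2) by (simp add: mult_left_mono power_mono)
    finally show "measure_pmf.prob (hyper_pmf k n m) (?E t) \<le> y * (1 / 2) ^ t" .
  qed
  also have "\<dots> = y * (\<Sum>t<m. (1 / 2) ^ t)" by (simp add: sum_distrib_left)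
  also have "\<dots> \<le> y * 2"
  proof (rule mult_left_mono[OF _ y0])
    have "(\<Sum>t<m. (1 / 2 :: real) ^ t) = 2 - 2 * (1 / 2) ^ m" by (induction m) simp_all
    then show "(\<Sum>t<m. (1 / 2 :: real) ^ t) \<le> 2" by simp
  qed
  finally show ?thesis by simp
qed

section \<open>Satisfiability from the structure of the hypergraph\<close>

definition sat_labelled :: "nat \<Rightarrow> nat \<Rightarrow> (nat \<Rightarrow> nat set) \<Rightarrow> ((nat \<Rightarrow> 'r::comm_ring_1) \<times> 'r) list \<Rightarrow> bool" where
  "sat_labelled n m H ls \<longleftrightarrow>
     (\<exists>x. \<forall>a<m. dot n (\<lambda>a. coef (H a) (fst (ls ! a))) a x = snd (ls ! a))"

text \<open>For a hypergraph in \<open>G\<close>, prescribing the labels on the at most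
  \<open>T\<close> rows of \<open>M H\<close> costs a factor \<open>\<rho> ^ T\<close>.
  \<open>M\<close> is empty when the hypergraph alone decides, the critical rows at the threshold,
  and all rows at level 0.\<close>

lemma sat_prob_ge_labels:
  fixes L :: "((nat \<Rightarrow> 'r::comm_ring_1) \<times> 'r) set"
  assumes sat: "\<And>H ls. H \<in> set_pmf (hyper_pmf k n m) \<Longrightarrow>
      ls \<in> set_pmf (replicate_pmf m (pair_pmf Phat Q)) \<Longrightarrow> H \<in> G \<Longrightarrow>
      (\<And>i. i \<in> M H \<Longrightarrow> ls ! i \<in> L) \<Longrightarrow> sat_labelled n m H ls"
    and M: "\<And>H. H \<in> G \<Longrightarrow> M H \<subseteq> {..<m} \<and> card (M H) \<le> T"
    and \<rho>: "0 \<le> \<rho>" "\<rho> \<le> measure_pmf.prob (pair_pmf Phat Q) L"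
  shows "\<rho> ^ T * measure_pmf.prob (hyper_pmf k n m) G \<le> sat_prob k Phat Q n m"
proof -
  let ?R = "replicate_pmf m (pair_pmf Phat Q)"
  have \<rho>1: "\<rho> \<le> 1" using \<rho>(2) measure_pmf.prob_le_1 order_trans by blast
  have "\<rho> ^ T * measure_pmf.prob (hyper_pmf k n m) G \<le>
      measure_pmf.prob (bind_pmf (hyper_pmf k n m) (\<lambda>H. map_pmf (Pair H) ?R)) {(H, ls). sat_labelled n m H ls}"
  proof (rule prob_bind_pmf_ge)
    fix H assume H: "H \<in> set_pmf (hyper_pmf k n m)"
    show "\<rho> ^ T * indicator G H \<le> measure_pmf.prob (map_pmf (Pair H) ?R) {(H, ls). sat_labelled n m H ls}"
    proof (cases "H \<in> G")
      case True
      define B where "B = (\<lambda>i. if i \<in> M H then L else UNIV)"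
      have MH: "M H \<subseteq> {..<m}" "card (M H) \<le> T" using M[OF True] by auto
      have "\<rho> ^ T \<le> \<rho> ^ card (M H)" using MH \<rho>(1) \<rho>1 by (intro power_decreasing) auto
      also have "\<dots> \<le> measure_pmf.prob (pair_pmf Phat Q) L ^ card (M H)"
        using \<rho> by (intro power_mono) auto
      also have "\<dots> = (\<Prod>i<m. measure_pmf.prob (pair_pmf Phat Q) (B i))"
      proof -
        have "(\<Prod>i<m. measure_pmf.prob (pair_pmf Phat Q) (B i)) =
            (\<Prod>i\<in>M H. measure_pmf.prob (pair_pmf Phat Q) (B i))"
          using MH(1) by (intro prod.mono_neutral_right) (auto simp: B_def)
        then show ?thesis by (simp add: B_def)
      qed
      also have "\<dots> = measure_pmf.prob (Pi_pmf {..<m} undefined (\<lambda>_. pair_pmf Phat Q)) (Pi {..<m} B)"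
        by (rule measure_Pi_pmf_Pi[symmetric]) simp
      also have "\<dots> \<le> measure_pmf.prob (Pi_pmf {..<m} undefined (\<lambda>_. pair_pmf Phat Q))
          ((\<lambda>f. map f [0..<m]) -` {ls. \<forall>i\<in>M H. ls ! i \<in> L})"
      proof (rule measure_pmf.finite_measure_mono)
        show "Pi {..<m} B \<subseteq> (\<lambda>f. map f [0..<m]) -` {ls. \<forall>i\<in>M H. ls ! i \<in> L}"
          using MH(1) by (auto simp: B_def Pi_def subset_eq)
      qed simp
      also have "\<dots> = measure_pmf.prob ?R {ls. \<forall>i\<in>M H. ls ! i \<in> L}"
        unfolding Pi_pmf_to_list[of m undefined, symmetric] measure_map_pmf ..
      also have "\<dots> \<le> measure_pmf.prob ?R {ls. sat_labelled n m H ls}"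
      proof (rule measure_pmf.finite_measure_mono_AE)
        show "AE ls in measure_pmf ?R. ls \<in> {ls. \<forall>i\<in>M H. ls ! i \<in> L} \<longrightarrow> ls \<in> {ls. sat_labelled n m H ls}"
          unfolding AE_measure_pmf_iff using sat[OF H _ True] by blast
      qed simp
      finally show ?thesis using True by (simp add: vimage_def)
    qed simp
  qed
  then show ?thesis
    unfolding sat_prob_eq_hyper by (simp add: pair_pmf_def map_pmf_def sat_labelled_def)
qed

text \<open>The fifth conclusion collects what all cases of satisfiability share: rows with a vertex
  not blocked are solved by \<open>extends_if_not_blocked\<close>, and for the others a direct
  solution may be supplied.\<close>

lemma labelled_system:
  fixes P Q :: "'r::{comm_ring_1, finite} pmf"
  assumes k: "k \<le> n" and H: "H \<in> set_pmf (hyper_pmf k n m)"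
    and ls: "ls \<in> set_pmf (replicate_pmf m (pair_pmf (power_pmf k P) Q))"
    and c: "c = (\<lambda>a. coef (H a) (fst (ls ! a)))"
  shows "\<And>g. g < m \<Longrightarrow> H g \<in> edges k n"
    "\<And>g u. g < m \<Longrightarrow> u \<notin> H g \<Longrightarrow> c g u = 0"
    "\<And>g u. g < m \<Longrightarrow> u \<in> H g \<Longrightarrow> c g u \<in> set_pmf P"
    "\<And>g. g < m \<Longrightarrow> snd (ls ! g) \<in> set_pmf Q"
    "(\<And>f. f < m \<Longrightarrow> (\<exists>v\<in>H f. \<exists>l. \<not> blocked H m (Suc l) f v \<and> set_pmf Q \<subseteq> level_ideal P l) \<or>
        (\<exists>x. dot n c f x = snd (ls ! f) \<and> (\<forall>g<m. g \<noteq> f \<longrightarrow> dot n c g x = 0))) \<Longrightarrow>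
      sat_labelled n m H ls"
proof -
  show H': "H g \<in> edges k n" if "g < m" for g
    using H that k unfolding hyper_pmf_def by (auto simp: set_Pi_pmf PiE_dflt_def edges_facts)
  show c0: "c g u = 0" if "g < m" "u \<notin> H g" for g u using that by (simp add: c coef_def)
  have lsg: "ls ! g \<in> set_pmf (power_pmf k P) \<times> set_pmf Q" if "g < m" for g
    using ls that unfolding set_replicate_pmf by (auto simp: in_lists_conv_set)
  show cP: "c g u \<in> set_pmf P" if "g < m" "u \<in> H g" for g u
  proof -
    have "pos (H g) u < k" using edge_finite[OF H'[OF that(1)]] pos_less that(2) by metis
    moreover have "fst (ls ! g) \<in> set_pmf (power_pmf k P)" using lsg[OF that(1)] by auto
    ultimately show ?thesis using that(2)
      by (auto simp: c coef_def power_pmf_def set_Pi_pmf PiE_dflt_def)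
  qed
  show lQ: "snd (ls ! g) \<in> set_pmf Q" if "g < m" for g using lsg[OF that] by auto
  assume *: "\<And>f. f < m \<Longrightarrow> (\<exists>v\<in>H f. \<exists>l. \<not> blocked H m (Suc l) f v \<and> set_pmf Q \<subseteq> level_ideal P l) \<or>
        (\<exists>x. dot n c f x = snd (ls ! f) \<and> (\<forall>g<m. g \<noteq> f \<longrightarrow> dot n c g x = 0))"
  show "sat_labelled n m H ls"
    unfolding sat_labelled_def c[symmetric]
  proof (rule superposition)
    fix f assume f: "f < m"
    show "\<exists>x. dot n c f x = snd (ls ! f) \<and> (\<forall>g<m. g \<noteq> f \<longrightarrow> dot n c g x = 0)"
    proof (cases "\<exists>v\<in>H f. \<exists>l. \<not> blocked H m (Suc l) f v \<and> set_pmf Q \<subseteq> level_ideal P l")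
      case True
      then obtain v l where v: "v \<in> H f" "\<not> blocked H m (Suc l) f v" "set_pmf Q \<subseteq> level_ideal P l" by blast
      have "snd (ls ! f) \<in> (*) (c f v) ` free_ideal P l"
        using lQ[OF f] v(3) cP[OF f v(1)] unfolding level_ideal_eq by blast
      then obtain y where y: "snd (ls ! f) = c f v * y" "y \<in> free_ideal P l" by blast
      have Hn: "H g \<subseteq> {..<n}" if "g < m" for g using edge_finite[OF H'[OF that]] by blast
      have "extends m n c f v y"
        by (rule extends_if_not_blocked[where m = m and H = H and n = n and c = c, OF Hn c0 cP f v(1,2) y(2)])
      then show ?thesis unfolding extends_def y(1) .
    next
      case False
      then show ?thesis using *[OF f] by blast
    qed
  qed
qed

text \<open>The head is attached last, so deleting from the front keeps a list connected.\<close>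

lemma conn_shorten:
  assumes "conn H gs" "set gs \<subseteq> {..<m}" "t \<le> length gs"
  shows "H \<in> has_conn m t"
proof -
  have "conn H (drop (length gs - t) gs)"
    using conn_append[of H "take (length gs - t) gs" "drop (length gs - t) gs"] assms(1) by simp
  moreover have "drop (length gs - t) gs \<in> row_lists m t"
    using assms(2,3) set_drop_subset[of "length gs - t" gs] by (auto simp: row_lists_def)
  ultimately show ?thesis unfolding has_conn_def by blast
qed

text \<open>In the application \<open>Suc l\<close> is the level, so that \<open>s\<close> agrees
  with the sum in \<open>alpha\<close>. A row blocked at all its vertices would grow a connected
  list of \<open>Suc s\<close> rows.\<close>

lemma sat_if_small_components:
  fixes P Q :: "'r::{comm_ring_1, finite} pmf"
  assumes k: "k \<le> n" and H: "H \<in> set_pmf (hyper_pmf k n m)"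
    and ls: "ls \<in> set_pmf (replicate_pmf m (pair_pmf (power_pmf k P) Q))"
    and Q: "set_pmf Q \<subseteq> level_ideal P l"
    and s: "s = k * obstruction_size k (Suc l)"
    and nodense: "H \<notin> has_dense m (Suc s)" and noconn: "H \<notin> has_conn m (Suc s)"
  shows "sat_labelled n m H ls"
proof (rule labelled_system(5)[OF k H ls refl])
  note H' = labelled_system(1)[OF k H ls refl]
  have card: "finite (H g) \<and> card (H g) = k" if "g < m" for g using edge_finite[OF H'[OF that]] by blast
  fix f assume f: "f < m"
  have "\<exists>v\<in>H f. \<not> blocked H m (Suc l) f v"
  proof (rule ccontr)
    assume "\<not> ?thesis"
    then have bl: "blocked H m (Suc l) f v" if "v \<in> H f" for v using that by blast
    have nd: "\<not> dense H g gs" if "Suc (length gs) \<le> Suc s" "set (g # gs) \<subseteq> {..<m}" for g gs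
      using that nodense unfolding has_dense_def by blast
    have "1 + card (H f) * obstruction_size k (Suc l) \<le> Suc s" using card[OF f] s by simp
    then obtain es where es: "length es = card (H f) * obstruction_size k (Suc l)" "conn H (es @ [f])"
        "set es \<subseteq> {..<m}"
      using blocked_edge_grow[where m = m and H = H and k = k, OF card nd f subset_refl bl] by blast
    then have "length es = s" using card[OF f] s by simp
    then have "H \<in> has_conn m (Suc s)" using f es by (intro conn_shorten[of H "es @ [f]"]) auto
    then show False using noconn by contradiction
  qed
  then show "(\<exists>v\<in>H f. \<exists>l. \<not> blocked H m (Suc l) f v \<and> set_pmf Q \<subseteq> level_ideal P l) \<or>
        (\<exists>x. dot n (\<lambda>a. coef (H a) (fst (ls ! a))) f x = snd (ls ! f) \<and>
          (\<forall>g<m. g \<noteq> f \<longrightarrow> dot n (\<lambda>a. coef (H a) (fst (ls ! a))) g x = 0))"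
    using Q by blast
qed

text \<open>At infinite level any depth is admissible, so depth \<open>m\<close> may be used, at
  which nothing is blocked in an acyclic hypergraph.\<close>

lemma sat_if_acyclic:
  fixes P Q :: "'r::{comm_ring_1, finite} pmf"
  assumes k: "2 \<le> k" "k \<le> n" and H: "H \<in> set_pmf (hyper_pmf k n m)"
    and ls: "ls \<in> set_pmf (replicate_pmf m (pair_pmf (power_pmf k P) Q))"
    and Q: "\<And>l. set_pmf Q \<subseteq> level_ideal P l" and nocycle: "H \<notin> has_cycle m"
  shows "sat_labelled n m H ls"
proof (rule labelled_system(5)[OF k(2) H ls refl])
  note H' = labelled_system(1)[OF k(2) H ls refl]
  have card: "finite (H g) \<and> card (H g) = k" if "g < m" for g using edge_finite[OF H'[OF that]] by blast
  fix f assume f: "f < m"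
  then obtain l where l: "m = Suc l" by (cases m) auto
  have "H f \<noteq> {}" using edge_finite[OF H'[OF f]] k by auto
  then obtain v where v: "v \<in> H f" by blast
  have "\<not> blocked H m m f v"
  proof (rule not_blocked_if_acyclic[where m = m and H = H and k = k, OF card k(1) _ f v])
    show "\<not> closed_trail H g gs" if "set (g # gs) \<subseteq> {..<m}" for g gs
      using that nocycle unfolding has_cycle_def by blast
  qed
  then have "\<not> blocked H m (Suc l) f v" using l by simp
  then show "(\<exists>v\<in>H f. \<exists>l. \<not> blocked H m (Suc l) f v \<and> set_pmf Q \<subseteq> level_ideal P l) \<or>
        (\<exists>x. dot n (\<lambda>a. coef (H a) (fst (ls ! a))) f x = snd (ls ! f) \<and>
          (\<forall>g<m. g \<noteq> f \<longrightarrow> dot n (\<lambda>a. coef (H a) (fst (ls ! a))) g x = 0))"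
    using Q v by blast
qed

definition critical_rows :: "nat \<Rightarrow> nat \<Rightarrow> (nat \<Rightarrow> nat set) \<Rightarrow> nat set" where
  "critical_rows m t H = \<Union>{set gs | gs. gs \<in> row_lists m t \<and> conn H gs}"

text \<open>
  A row that is blocked at all its vertices lies in a component of exactly \<open>Suc s\<close> rows, and its
  vertices are not blocked at the next depth. If the neighbouring rows have constant coefficients,
  then the value \<open>y\<close> needed at a vertex can be passed on unchanged to a vertex that is not blocked.
\<close>

lemma sat_if_critical_constant:
  fixes P Q :: "'r::{comm_ring_1, finite} pmf"
  assumes k: "2 \<le> k" "k \<le> n" and H: "H \<in> set_pmf (hyper_pmf k n m)"
    and ls: "ls \<in> set_pmf (replicate_pmf m (pair_pmf (power_pmf k P) Q))"
    and Q: "set_pmf Q \<subseteq> level_ideal P l"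
    and s: "s = k * obstruction_size k (Suc l)"
    and nodense: "H \<notin> has_dense m (2 * Suc s)" and noconn: "H \<notin> has_conn m (Suc (Suc s))"
    and crit: "\<And>g i. g \<in> critical_rows m (Suc s) H \<Longrightarrow> i < k \<Longrightarrow> fst (ls ! g) i = r"
  shows "sat_labelled n m H ls"
proof (rule labelled_system(5)[OF k(2) H ls refl])
  define c where "c = (\<lambda>a. coef (H a) (fst (ls ! a)))"
  note facts = labelled_system(1-4)[OF k(2) H ls c_def]
  note H' = facts(1)
  have card: "finite (H g) \<and> card (H g) = k" if "g < m" for g using edge_finite[OF H'[OF that]] by blast
  define N where "N = obstruction_size k (Suc l)"
  have nd: "\<not> dense H g gs" if "Suc (length gs) \<le> 2 * Suc s" "set (g # gs) \<subseteq> {..<m}" for g gs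
    using that nodense unfolding has_dense_def by blast
  have sN: "s = k * N" by (simp only: s N_def)
  \<comment> \<open>\<open>s\<close> splits into the subtrees at all vertices of \<open>f\<close>
    but one, with \<open>A\<close> rows, and the subtree at the last, with \<open>N\<close>
    rows.\<close>
  define A where "A = (k - 1) * N"
  have kN: "A + N = s" "N \<le> A" unfolding A_def sN using k(1) by (cases k; simp)+
  fix f assume f: "f < m"
  show "(\<exists>v\<in>H f. \<exists>l. \<not> blocked H m (Suc l) f v \<and> set_pmf Q \<subseteq> level_ideal P l) \<or>
        (\<exists>x. dot n (\<lambda>a. coef (H a) (fst (ls ! a))) f x = snd (ls ! f) \<and>
          (\<forall>g<m. g \<noteq> f \<longrightarrow> dot n (\<lambda>a. coef (H a) (fst (ls ! a))) g x = 0))"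
  proof (cases "\<exists>v\<in>H f. \<not> blocked H m (Suc l) f v")
    case True
    then show ?thesis using Q by blast
  next
    case False
    then have bl: "blocked H m (Suc l) f v" if "v \<in> H f" for v using that by blast
    have "1 + card (H f) * obstruction_size k (Suc l) \<le> 2 * Suc s" using card[OF f] s by simp
    then obtain es where "length es = card (H f) * obstruction_size k (Suc l)"
      and es: "conn H (es @ [f])" "set es \<subseteq> {..<m}"
      using blocked_edge_grow[where m = m and H = H and k = k, OF card nd f subset_refl bl] by blast
    then have les: "length es = s" using card[OF f] s by simp
    have "H f \<noteq> {}" using card[OF f] k by auto
    then obtain v where v: "v \<in> H f" by blast
    have vn: "v < n" using edge_finite[OF H'[OF f]] v by blast
    have "snd (ls ! f) \<in> (*) (c f v) ` free_ideal P l"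
      using facts(4)[OF f] Q facts(3)[OF f v] unfolding level_ideal_eq by blast
    then obtain y where y: "snd (ls ! f) = c f v * y" "y \<in> free_ideal P l" by blast
    have "extends m n c f v y"
    proof (rule extends_step[OF f vn facts(2)])
      fix g assume g: "g < m" "g \<noteq> f" "v \<in> H g"
      have gcrit: "g \<in> critical_rows m (Suc s) H"
      proof -
        \<comment> \<open>\<open>f\<close> already lies in a connected list of \<open>Suc s\<close>
          rows, and a further row would give a list of excluded length.\<close>
        have "g \<in> set (es @ [f])"
        proof (rule ccontr)
          assume "g \<notin> set (es @ [f])"
          then have "conn H (g # es @ [f])" using es(1) g(3) v by auto
          then have "H \<in> has_conn m (Suc (Suc s))"
            using g(1) es les f by (intro conn_shorten[of H "g # es @ [f]"]) auto
          then show False using noconn by contradiction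
        qed
        moreover have "es @ [f] \<in> row_lists m (Suc s)" using es les f by (auto simp: row_lists_def)
        ultimately show ?thesis unfolding critical_rows_def using es(1) by blast
      qed
      \<comment> \<open>Otherwise \<open>v\<close> is blocked one step deeper. Its subtree then has
        \<open>1 + A\<close> rows, and with the \<open>A\<close> rows at the other vertices of
        \<open>f\<close> and \<open>f\<close> itself this makes 2 + 2 A rows, at least
        \<open>Suc (Suc s)\<close>. Growing that many, up to \<open>2 * Suc s\<close>, is why dense
        lists are excluded to this length.\<close>
      have "\<exists>u\<in>H g - {v}. \<not> blocked H m (Suc l) g u"
      proof (rule ccontr)
        assume "\<not> ?thesis"
        then have bl': "blocked H m (Suc (Suc l)) f v"
          unfolding blocked.simps(2)[of H m "Suc l"] using g by blast
        have cF: "card (H f - {v}) = k - 1" using card[OF f] v by simp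
        have "1 + card (H f - {v}) * obstruction_size k (Suc l) \<le> 2 * Suc s"
          unfolding cF N_def[symmetric] A_def[symmetric] kN(1)[symmetric] by simp
        then obtain es where es: "length es = A" "conn H (es @ [f])" "set es \<subseteq> {..<m}"
            "\<Union>(H ` set es) \<inter> H f \<subseteq> H f - {v}"
          using blocked_edge_grow[where m = m and H = H and k = k and F = "H f - {v}" and l = "Suc l",
              OF card nd f Diff_subset] bl unfolding cF N_def[symmetric] A_def[symmetric] by blast
        have "\<exists>es'. length es' = obstruction_size k (Suc (Suc l)) \<and> conn H (es' @ es @ [f]) \<and>
            set es' \<subseteq> {..<m} \<and> \<Union>(H ` set es') \<inter> \<Union>(H ` set (es @ [f])) \<subseteq> {v}"
        proof (rule blocked_grow[where m = m and H = H and k = k, OF card nd es(2) _ _ v _ bl'])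
          show "\<forall>h\<in>set (es @ [f]). h \<noteq> f \<longrightarrow> v \<notin> H h" using es(4) v by auto
          have "obstruction_size k (Suc (Suc l)) = 1 + A" by (simp only: obstruction_size.simps N_def A_def)
          then show "length (es @ [f]) + obstruction_size k (Suc (Suc l)) \<le> 2 * Suc s"
            using es(1) kN by simp
        qed (use f es(3) in auto)
        then obtain es' where es': "length es' = 1 + A" "conn H (es' @ es @ [f])" "set es' \<subseteq> {..<m}"
          unfolding obstruction_size.simps(2)[of k "Suc l"] N_def[symmetric] A_def[symmetric] by blast
        have "H \<in> has_conn m (Suc (Suc s))"
          using es es' f kN by (intro conn_shorten[of H "es' @ es @ [f]"]) auto
        then show False using noconn by contradiction
      qed
      then obtain u where u: "u \<in> H g" "\<not> blocked H m (Suc l) g u" by blast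
      have cg: "c g w = r" if "w \<in> H g" for w
      proof -
        have "pos (H g) w < k" using pos_less[of "H g" w] card[OF g(1)] that by auto
        then show ?thesis using crit[OF gcrit] that by (simp add: c_def coef_def)
      qed
      have Hn: "H g \<subseteq> {..<n}" if "g < m" for g using edge_finite[OF H'[OF that]] by blast
      have "extends m n c g u y"
        by (rule extends_if_not_blocked[where m = m and H = H and n = n and c = c,
              OF Hn facts(2,3) g(1) u y(2)])
      then show "\<exists>u z. c g v * y = c g u * z \<and> extends m n c g u z"
        using cg[OF g(3)] cg[OF u(1)] by (intro exI[of _ u] exI[of _ y]) simp
    qed
    then show ?thesis unfolding extends_def y(1) c_def by blast
  qed
qed

lemma sat_prob_ge_compl:
  assumes "\<And>H ls. H \<in> set_pmf (hyper_pmf k n m) \<Longrightarrow>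
      ls \<in> set_pmf (replicate_pmf m (pair_pmf Phat Q)) \<Longrightarrow> H \<notin> B \<Longrightarrow> sat_labelled n m H ls"
  shows "1 - measure_pmf.prob (hyper_pmf k n m) B \<le> sat_prob k Phat Q n m"
proof -
  have "1 ^ 0 * measure_pmf.prob (hyper_pmf k n m) (- B) \<le> sat_prob k Phat Q n m"
    by (rule sat_prob_ge_labels[where M = "\<lambda>_. {}" and L = UNIV]) (use assms in auto)
  then show ?thesis
    using measure_pmf.prob_compl[of B "hyper_pmf k n m"] by (simp add: Compl_eq_Diff_UNIV)
qed

section \<open>Below the threshold\<close>

lemma sat_prob_le_1: "sat_prob k Phat Q n m \<le> 1"
  by (simp add: sat_prob_def)

lemma tendsto_1_if_ge:
  fixes f g :: "nat \<Rightarrow> real"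
  assumes "g \<longlonglongrightarrow> 0" "eventually (\<lambda>n. 1 - g n \<le> f n) at_top" "\<And>n. f n \<le> 1"
  shows "f \<longlonglongrightarrow> 1"
proof -
  have "(\<lambda>n. 1 - g n) \<longlonglongrightarrow> 1 - 0" using assms(1) by (intro tendsto_diff tendsto_const)
  then have "(\<lambda>n. 1 - g n) \<longlonglongrightarrow> 1" by simp
  from tendsto_sandwich[OF assms(2) always_eventually this tendsto_const] assms(3) show ?thesis by blast
qed

lemma alpha_power:
  assumes k: "1 \<le> k" and lev: "level P Q = enat l" and s: "s = k * obstruction_size k l" and n: "0 < n"
  shows "(real n powr alpha k P Q) ^ Suc s = real n ^ s"
proof -
  have "alpha k P Q * real (Suc s) = real s"
    using alpha_enat[OF k lev refl] unfolding s[symmetric] by simp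
  then show ?thesis unfolding powr_nat_power[OF n] using n by (simp add: powr_realpow)
qed

lemma sat_tendsto_infinite:
  fixes P Q :: "'r::{comm_ring_1, finite} pmf"
  assumes k: "2 \<le> k" and lev: "level P Q = \<infinity>" and m: "(\<lambda>n. real (m n)) \<in> o(\<lambda>n. real n)"
  shows "(\<lambda>n. sat_prob k (power_pmf k P) Q n (m n)) \<longlonglongrightarrow> 1"
proof -
  define y where "y = (\<lambda>n. real (k\<^sup>2) * real (m n) / real n)"
  have "(\<lambda>n. real (m n) / real n) \<longlonglongrightarrow> 0" using smalloD_tendsto[OF m] .
  from tendsto_mult[OF tendsto_const[of "real (k\<^sup>2)"] this] have y: "y \<longlonglongrightarrow> 0" by (simp add: y_def)
  from tendsto_mult[OF tendsto_const[of 2] this] have y2: "(\<lambda>n. 2 * y n) \<longlonglongrightarrow> 0" by simp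
  have "eventually (\<lambda>n. y n < 1 / 2) at_top" using y by (intro order_tendstoD) auto
  then have "eventually (\<lambda>n. 1 - 2 * y n \<le> sat_prob k (power_pmf k P) Q n (m n)) at_top"
    using eventually_ge_at_top[of k]
  proof eventually_elim
    case (elim n)
    have "measure_pmf.prob (hyper_pmf k n (m n)) (has_cycle (m n)) \<le> 2 * y n"
      by (rule prob_has_cycle_le) (use k elim in \<open>auto simp: y_def\<close>)
    moreover have "1 - measure_pmf.prob (hyper_pmf k n (m n)) (has_cycle (m n)) \<le>
        sat_prob k (power_pmf k P) Q n (m n)"
      by (rule sat_prob_ge_compl) (rule sat_if_acyclic[OF k elim(2) _ _ level_infD[OF lev]])
    ultimately show ?case by linarith
  qed
  then show ?thesis by (rule tendsto_1_if_ge[OF y2 _ sat_prob_le_1])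
qed

lemma prob_has_dense_tendsto:
  assumes k: "2 \<le> k" and m: "(\<lambda>n. real (m n) / real n) \<longlonglongrightarrow> 0"
  shows "(\<lambda>n. measure_pmf.prob (hyper_pmf k n (m n)) (has_dense (m n) L)) \<longlonglongrightarrow> 0"
proof -
  define y where "y = (\<lambda>n. real (k\<^sup>2 * L) * real (m n) / real n)"
  from tendsto_mult[OF tendsto_const[of "real (k\<^sup>2 * L)"] m] have y: "y \<longlonglongrightarrow> 0" by (simp add: y_def)
  from tendsto_mult[OF tendsto_const[of "real L"] this] have Ly: "(\<lambda>n. real L * y n) \<longlonglongrightarrow> 0" by simp
  have "eventually (\<lambda>n. y n < 1) at_top" using y by (intro order_tendstoD) auto
  then have "eventually (\<lambda>n. measure_pmf.prob (hyper_pmf k n (m n)) (has_dense (m n) L) \<le> real L * y n) at_top"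
    using eventually_ge_at_top[of k]
  proof eventually_elim
    case (elim n)
    show ?case by (rule prob_has_dense_le) (use k elim in \<open>auto simp: y_def\<close>)
  qed
  from tendsto_sandwich[OF always_eventually this tendsto_const Ly] show ?thesis by simp
qed

lemma sat_tendsto_finite:
  fixes P Q :: "'r::{comm_ring_1, finite} pmf"
  assumes k: "2 \<le> k" and lev: "level P Q = enat l"
    and m: "(\<lambda>n. real (m n)) \<in> o(\<lambda>n. real n powr alpha k P Q)"
  shows "(\<lambda>n. sat_prob k (power_pmf k P) Q n (m n)) \<longlonglongrightarrow> 1"
proof (cases l)
  \<comment> \<open>At level 0 the exponent is 0, so \<open>m n\<close> is eventually 0 and the
    system is empty.\<close>
  case 0
  have k1: "1 \<le> k" using k by simp
  have "eventually (\<lambda>n. norm (real (m n)) \<le> 1 / 2 * norm (real n powr alpha k P Q)) at_top"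
    using landau_o.smallD[OF m, of "1 / 2"] by simp
  then have "eventually (\<lambda>n. sat_prob k (power_pmf k P) Q n (m n) = 1) at_top"
    using eventually_gt_at_top[of 0]
  proof eventually_elim
    case (elim n)
    then have "real (m n) \<le> 1 / 2" using alpha_bounds(4)[OF k1 lev 0] by simp
    then have "m n = 0" by linarith
    then show ?case by (simp add: sat_prob_eq_list)
  qed
  then show ?thesis by (rule tendsto_eventually)
next
  case (Suc l')
  have k1: "1 \<le> k" using k by simp
  define s where "s = k * obstruction_size k (Suc l')"
  have lev': "level P Q = enat (Suc l')" using lev Suc by simp
  define a where "a = alpha k P Q"
  have a: "a \<le> 1" using alpha_bounds(2)[OF k1 lev] by (simp add: a_def)
  define z where "z = (\<lambda>n. real (m n) / real n powr a)"
  have z: "z \<longlonglongrightarrow> 0" using smalloD_tendsto[OF m] by (simp add: z_def a_def)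
  have upper: "eventually (\<lambda>n. real (m n) / real n \<le> z n) at_top"
    using eventually_gt_at_top[of 0]
  proof eventually_elim
    case (elim n)
    have "real n powr a \<le> real n powr 1" using elim a by (intro powr_mono) auto
    then show ?case unfolding z_def using elim by (intro divide_left_mono) auto
  qed
  have lower: "eventually (\<lambda>n. 0 \<le> real (m n) / real n) at_top" by simp
  have mn: "(\<lambda>n. real (m n) / real n) \<longlonglongrightarrow> 0"
    using tendsto_sandwich[OF lower upper tendsto_const z] .
  define K where "K = real (k\<^sup>2 * Suc s) ^ s"
  define g where "g = (\<lambda>n. measure_pmf.prob (hyper_pmf k n (m n)) (has_dense (m n) (Suc s)) + K * z n ^ Suc s)"
  have "(\<lambda>n. z n ^ Suc s) \<longlonglongrightarrow> 0 ^ Suc s" using z by (rule tendsto_power)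
  then have "(\<lambda>n. z n ^ Suc s) \<longlonglongrightarrow> 0" by simp
  from tendsto_add[OF prob_has_dense_tendsto[OF k mn] tendsto_mult[OF tendsto_const[of K] this]]
  have g: "g \<longlonglongrightarrow> 0" by (simp add: g_def)
  have "eventually (\<lambda>n. 1 - g n \<le> sat_prob k (power_pmf k P) Q n (m n)) at_top"
    using eventually_ge_at_top[of k]
  proof eventually_elim
    case (elim n)
    have n: "0 < n" using elim k by simp
    let ?H = "hyper_pmf k n (m n)"
    have "measure_pmf.prob ?H (has_conn (m n) (Suc s)) \<le>
        real (m n) ^ Suc s * (real (k\<^sup>2 * Suc s) / real n) ^ s"
      by (rule prob_has_conn_le[OF k1 elim])
    also have "\<dots> = K * (real (m n) ^ Suc s / real n ^ s)" by (simp add: K_def power_divide)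
    \<comment> \<open>The exponent is chosen so that m^(s+1) / n^s is a power of m / n^a.\<close>
    also have "real n ^ s = (real n powr a) ^ Suc s"
      unfolding a_def by (rule alpha_power[OF k1 lev' s_def n, symmetric])
    also have "real (m n) ^ Suc s / (real n powr a) ^ Suc s = z n ^ Suc s" by (simp only: z_def power_divide)
    finally have "measure_pmf.prob ?H (has_conn (m n) (Suc s)) \<le> K * z n ^ Suc s" .
    moreover have "measure_pmf.prob ?H (has_dense (m n) (Suc s) \<union> has_conn (m n) (Suc s)) \<le>
        measure_pmf.prob ?H (has_dense (m n) (Suc s)) + measure_pmf.prob ?H (has_conn (m n) (Suc s))"
      by (rule measure_Un_le) auto
    moreover have "1 - measure_pmf.prob ?H (has_dense (m n) (Suc s) \<union> has_conn (m n) (Suc s)) \<le>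
        sat_prob k (power_pmf k P) Q n (m n)"
      by (rule sat_prob_ge_compl)
        (use sat_if_small_components[OF elim _ _ level_enatD(2)[OF lev' lessI] s_def] in blast)
    ultimately show ?case unfolding g_def by linarith
  qed
  then show ?thesis by (rule tendsto_1_if_ge[OF g _ sat_prob_le_1])
qed

section \<open>At the threshold: boundedly many critical rows\<close>

lemma prob_many_le:
  assumes I: "finite I" and le: "(\<Sum>i\<in>I. measure_pmf.prob p {x. E x i}) \<le> B"
  shows "real T * measure_pmf.prob p {x. T \<le> card {i\<in>I. E x i}} \<le> B"
proof -
  have int: "integrable (measure_pmf p) (\<lambda>x. indicator {x. E x i} x :: real)" for i
    by (rule integrable_measure_pmf_bounded[where B = 1]) (simp add: indicator_def)
  have "real T * measure_pmf.prob p {x. T \<le> card {i\<in>I. E x i}} =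
      measure_pmf.expectation p (\<lambda>x. real T * indicator {x. T \<le> card {i\<in>I. E x i}} x)" by simp
  also have "\<dots> \<le> measure_pmf.expectation p (\<lambda>x. \<Sum>i\<in>I. indicator {x. E x i} x)"
  proof (rule integral_mono)
    show "integrable (measure_pmf p) (\<lambda>x. real T * indicator {x. T \<le> card {i\<in>I. E x i}} x)"
      by (rule integrable_measure_pmf_bounded[where B = "real T"]) (simp add: indicator_def)
    show "integrable (measure_pmf p) (\<lambda>x. \<Sum>i\<in>I. indicator {x. E x i} x :: real)"
      by (rule Bochner_Integration.integrable_sum) (rule int)
    fix x
    have "(\<Sum>i\<in>I. indicator {x. E x i} x :: real) = (\<Sum>i\<in>I. if E x i then 1 else 0)"
      by (intro sum.cong) (simp_all add: indicator_def)
    also have "\<dots> = (\<Sum>i\<in>{i\<in>I. E x i}. 1)" using I by (simp only: sum.inter_filter)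
    finally have "(\<Sum>i\<in>I. indicator {x. E x i} x :: real) = real (card {i\<in>I. E x i})" by simp
    then show "real T * indicator {x. T \<le> card {i\<in>I. E x i}} x \<le> (\<Sum>i\<in>I. indicator {x. E x i} x)"
      by (simp add: indicator_def)
  qed
  also have "\<dots> = (\<Sum>i\<in>I. measure_pmf.prob p {x. E x i})"
    by (subst Bochner_Integration.integral_sum) (use int in auto)
  finally show ?thesis using le by linarith
qed

lemma card_critical_rows_le:
  "card (critical_rows m t H) \<le> card {gs\<in>row_lists m t. conn H gs} * t"
proof -
  have eq: "critical_rows m t H = (\<Union>gs\<in>{gs\<in>row_lists m t. conn H gs}. set gs)"
    by (auto simp: critical_rows_def)
  have fin: "finite {gs\<in>row_lists m t. conn H gs}" using finite_row_lists by simp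
  have "card (critical_rows m t H) \<le> (\<Sum>gs\<in>{gs\<in>row_lists m t. conn H gs}. card (set gs))"
    unfolding eq by (rule card_UN_le[OF fin])
  also have "\<dots> \<le> (\<Sum>gs\<in>{gs\<in>row_lists m t. conn H gs}. t)"
    by (intro sum_mono) (auto simp: row_lists_def intro: order_trans[OF card_length])
  finally show ?thesis by simp
qed

text \<open>Connected lists of \<open>Suc s\<close> rows may occur here, but with probability
  tending to 1 there are neither longer nor dense ones. With probability at least 3/4 fewer than
  \<open>T\<close> critical lists exist, and then at most \<open>T * Suc s\<close> rows need
  prescribed labels, at a cost independent of \<open>n\<close>.\<close>

lemma sat_liminf_positive_level:
  fixes P Q :: "'r::{comm_ring_1, finite} pmf"
  assumes k: "2 \<le> k" and lev: "level P Q = enat (Suc l)" and C: "C > 0"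
  obtains \<delta> where "\<delta> > 0"
    "eventually (\<lambda>n. \<delta> \<le> sat_prob k (power_pmf k P) Q n (nat \<lceil>C * real n powr alpha k P Q\<rceil>)) at_top"
proof -
  have k1: "1 \<le> k" using k by simp
  define s where "s = k * obstruction_size k (Suc l)"
  define a where "a = alpha k P Q"
  have a: "0 \<le> a" "a < 1" using alpha_bounds(1,2)[OF k1 lev] by (auto simp: a_def)
  define m where "m = (\<lambda>n. nat \<lceil>C * real n powr a\<rceil>)"
  \<comment> \<open>n^a is at least 1, so one further multiple of it absorbs the rounding
    up.\<close>
  define D where "D = C + 1"
  have D: "D > 0" using C by (simp add: D_def)
  have mD: "real (m n) \<le> D * real n powr a" if "0 < n" for n
  proof -
    have "1 \<le> real n powr a" using that a by (intro ge_one_powr_ge_zero) auto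
    moreover have "real (m n) \<le> C * real n powr a + 1" unfolding m_def using C by (intro real_nat_ceiling_le) simp
    ultimately show ?thesis by (simp add: D_def distrib_right)
  qed
  have upper: "eventually (\<lambda>n. real (m n) / real n \<le> D * real n powr (a - 1)) at_top"
    using eventually_gt_at_top[of 0]
  proof eventually_elim
    case (elim n)
    then show ?case using mD[of n] by (simp add: powr_diff divide_right_mono)
  qed
  have lower: "eventually (\<lambda>n. 0 \<le> real (m n) / real n) at_top" by simp
  have "(\<lambda>n. D * real n powr (a - 1)) \<longlonglongrightarrow> 0" using a by real_asymp
  from tendsto_sandwich[OF lower upper tendsto_const this]
  have mn: "(\<lambda>n. real (m n) / real n) \<longlonglongrightarrow> 0" .
  \<comment> \<open>\<open>B\<close> bounds the expected number of connected lists of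
    \<open>Suc s\<close> rows. As \<open>T\<close> is at least 4 B, Markov's inequality gives
    probability at most 1/4 for \<open>T\<close> or more of them; with 1/8 for each of the two other
    events the bad set has probability at most 1/2.\<close>
  define B where "B = D ^ Suc s * real (k\<^sup>2 * Suc s) ^ s"
  have B: "B \<ge> 0" using D by (simp add: B_def)
  define T where "T = nat \<lceil>4 * B\<rceil> + 1"
  define K where "K = D ^ Suc s * real (k\<^sup>2 * Suc (Suc s)) ^ Suc s"
  have power: "real (m n) ^ Suc s \<le> D ^ Suc s * real n ^ s" if "0 < n" for n
  proof -
    have "real (m n) ^ Suc s \<le> (D * real n powr a) ^ Suc s" using mD[OF that] by (intro power_mono) auto
    also have "\<dots> = D ^ Suc s * (real n powr a) ^ Suc s" by (rule power_mult_distrib)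
    also have "(real n powr a) ^ Suc s = real n ^ s"
      unfolding a_def by (rule alpha_power[OF k1 lev s_def that])
    finally show ?thesis .
  qed
  \<comment> \<open>One row more than critical costs another factor of order m/n.\<close>
  have conn2: "eventually (\<lambda>n. measure_pmf.prob (hyper_pmf k n (m n)) (has_conn (m n) (Suc (Suc s))) \<le>
      K * (real (m n) / real n)) at_top"
    using eventually_ge_at_top[of k]
  proof eventually_elim
    case (elim n)
    have n: "0 < n" using elim k by simp
    have "measure_pmf.prob (hyper_pmf k n (m n)) (has_conn (m n) (Suc (Suc s))) \<le>
        real (m n) ^ Suc (Suc s) * (real (k\<^sup>2 * Suc (Suc s)) / real n) ^ Suc s"
      by (rule prob_has_conn_le[OF k1 elim])
    also have "\<dots> = real (m n) ^ Suc s * (real (m n) * (real (k\<^sup>2 * Suc (Suc s)) / real n) ^ Suc s)" by simp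
    also have "\<dots> \<le> (D ^ Suc s * real n ^ s) * (real (m n) * (real (k\<^sup>2 * Suc (Suc s)) / real n) ^ Suc s)"
      using power[OF n] by (intro mult_right_mono) auto
    also have "\<dots> = K * (real (m n) / real n)" unfolding K_def power_divide using n by simp
    finally show ?case .
  qed
  define d where "d = (\<lambda>n. measure_pmf.prob (hyper_pmf k n (m n)) (has_dense (m n) (2 * Suc s)))"
  have "d \<longlonglongrightarrow> 0" unfolding d_def by (rule prob_has_dense_tendsto[OF k mn])
  then have ev1: "eventually (\<lambda>n. d n < 1 / 8) at_top" by (intro order_tendstoD) auto
  have "(\<lambda>n. K * (real (m n) / real n)) \<longlonglongrightarrow> K * 0" by (intro tendsto_mult tendsto_const mn)
  then have ev2: "eventually (\<lambda>n. K * (real (m n) / real n) < 1 / 8) at_top" by (intro order_tendstoD) auto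
  obtain r b where r: "r \<in> set_pmf P" and b: "b \<in> set_pmf Q" by (meson ex_in_conv set_pmf_not_empty)
  define L where "L = {l :: (nat \<Rightarrow> 'r) \<times> 'r. \<forall>i<k. fst l i = r}"
  define \<rho> where "\<rho> = (\<Prod>i<k. pmf P r) * pmf Q b"
  have \<rho>: "\<rho> > 0" unfolding \<rho>_def using r b by (intro mult_pos_pos prod_pos) (auto simp: pmf_positive)
  have \<rho>L: "\<rho> \<le> measure_pmf.prob (pair_pmf (power_pmf k P) Q) L"
    unfolding \<rho>_def by (rule prob_labels_ge) (simp add: L_def)
  define \<delta> where "\<delta> = \<rho> ^ (T * Suc s) * (1 / 2)"
  have "eventually (\<lambda>n. \<delta> \<le> sat_prob k (power_pmf k P) Q n (m n)) at_top"
    using eventually_ge_at_top[of k] conn2 ev1 ev2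
  proof eventually_elim
    case (elim n)
    have n: "0 < n" using elim(1) k by simp
    let ?H = "hyper_pmf k n (m n)"
    define many where "many = {H. T \<le> card {gs\<in>row_lists (m n) (Suc s). conn H gs}}"
    have "(\<Sum>gs\<in>row_lists (m n) (Suc s). measure_pmf.prob ?H {H. conn H gs}) \<le>
        (\<Sum>gs\<in>row_lists (m n) (Suc s). (real (k\<^sup>2 * Suc s) / real n) ^ s)"
    proof (rule sum_mono)
      fix gs assume "gs \<in> row_lists (m n) (Suc s)"
      then show "measure_pmf.prob ?H {H. conn H gs} \<le> (real (k\<^sup>2 * Suc s) / real n) ^ s"
        using prob_conn_le[OF k1 elim(1), of gs "m n" "Suc s"] by (simp add: row_lists_def)
    qed
    also have "\<dots> = real (m n) ^ Suc s * (real (k\<^sup>2 * Suc s) / real n) ^ s" by (simp add: card_row_lists)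
    also have "\<dots> \<le> (D ^ Suc s * real n ^ s) * (real (k\<^sup>2 * Suc s) / real n) ^ s"
      using power[OF n] by (intro mult_right_mono) auto
    also have "\<dots> = B" unfolding B_def power_divide using n by simp
    finally have "real T * measure_pmf.prob ?H many \<le> B"
      unfolding many_def by (rule prob_many_le[OF finite_row_lists])
    moreover have "4 * B \<le> real T" unfolding T_def by linarith
    then have "4 * B * measure_pmf.prob ?H many \<le> real T * measure_pmf.prob ?H many"
      by (intro mult_right_mono) auto
    ultimately have "real T * (4 * measure_pmf.prob ?H many) \<le> real T"
      using \<open>4 * B \<le> real T\<close> by linarith
    moreover have "real T > 0" by (simp add: T_def)
    ultimately have pmany: "measure_pmf.prob ?H many \<le> 1 / 4" by simp
    define Bad where "Bad = has_dense (m n) (2 * Suc s) \<union> (has_conn (m n) (Suc (Suc s)) \<union> many)"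
    have "measure_pmf.prob ?H Bad \<le> measure_pmf.prob ?H (has_dense (m n) (2 * Suc s)) +
        measure_pmf.prob ?H (has_conn (m n) (Suc (Suc s)) \<union> many)"
      unfolding Bad_def by (rule measure_Un_le) auto
    also have "measure_pmf.prob ?H (has_conn (m n) (Suc (Suc s)) \<union> many) \<le>
        measure_pmf.prob ?H (has_conn (m n) (Suc (Suc s))) + measure_pmf.prob ?H many"
      by (rule measure_Un_le) auto
    finally have "measure_pmf.prob ?H Bad \<le> 1 / 2" using elim(2,3,4) pmany unfolding d_def by linarith
    then have "1 / 2 \<le> measure_pmf.prob ?H (- Bad)"
      using measure_pmf.prob_compl[of Bad ?H] by (simp add: Compl_eq_Diff_UNIV)
    then have "\<delta> \<le> \<rho> ^ (T * Suc s) * measure_pmf.prob ?H (- Bad)"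
      unfolding \<delta>_def using \<rho> by (intro mult_left_mono) auto
    also have "\<dots> \<le> sat_prob k (power_pmf k P) Q n (m n)"
    proof (rule sat_prob_ge_labels[where M = "critical_rows (m n) (Suc s)" and L = L])
      fix H assume H: "H \<in> - Bad"
      have "critical_rows (m n) (Suc s) H \<subseteq> {..<m n}"
        by (auto simp: critical_rows_def row_lists_def)
      moreover have "card {gs\<in>row_lists (m n) (Suc s). conn H gs} \<le> T" using H by (simp add: Bad_def many_def)
      then have "card (critical_rows (m n) (Suc s) H) \<le> T * Suc s"
        using card_critical_rows_le[of "m n" "Suc s" H] by (meson mult_le_mono1 order_trans)
      ultimately show "critical_rows (m n) (Suc s) H \<subseteq> {..<m n} \<and>
          card (critical_rows (m n) (Suc s) H) \<le> T * Suc s" by blast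
    next
      fix H ls assume *: "H \<in> set_pmf ?H" "ls \<in> set_pmf (replicate_pmf (m n) (pair_pmf (power_pmf k P) Q))"
        "H \<in> - Bad" and ls: "\<And>i. i \<in> critical_rows (m n) (Suc s) H \<Longrightarrow> ls ! i \<in> L"
      show "sat_labelled n (m n) H ls"
      proof (rule sat_if_critical_constant[OF k elim(1) *(1,2) level_enatD(2)[OF lev lessI] s_def])
        show "H \<notin> has_dense (m n) (2 * Suc s)" "H \<notin> has_conn (m n) (Suc (Suc s))"
          using *(3) by (auto simp: Bad_def)
        show "fst (ls ! g) i = r" if "g \<in> critical_rows (m n) (Suc s) H" "i < k" for g i
          using ls[OF that(1)] that(2) by (simp add: L_def)
      qed
    qed (use \<rho> \<rho>L in auto)
    finally show ?case .
  qed
  moreover have "\<delta> > 0" using \<rho> by (simp add: \<delta>_def)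
  ultimately show ?thesis using that unfolding m_def a_def by blast
qed

lemma ideal_gen_image_combination:
  fixes a :: "nat \<Rightarrow> 'r::comm_ring_1"
  assumes "b \<in> ideal_gen (a ` {..<k})"
  obtains c where "b = (\<Sum>i<k. a i * c i)"
proof -
  define I where "I = {\<Sum>i<k. a i * c i | c. True}"
  have "is_ideal I" unfolding is_ideal_iff
  proof (intro conjI ballI allI)
    show "0 \<in> I" unfolding I_def by (intro CollectI exI[of _ "\<lambda>_. 0"]) simp
  next
    fix x y assume "x \<in> I" "y \<in> I"
    then obtain c d where "x = (\<Sum>i<k. a i * c i)" "y = (\<Sum>i<k. a i * d i)" unfolding I_def by blast
    then have "x + y = (\<Sum>i<k. a i * (c i + d i))" by (simp add: distrib_left sum.distrib)
    then show "x + y \<in> I" unfolding I_def by (intro CollectI exI[of _ "\<lambda>i. c i + d i"]) simp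
  next
    fix r x assume "x \<in> I"
    then obtain c where "x = (\<Sum>i<k. a i * c i)" unfolding I_def by blast
    then have "r * x = (\<Sum>i<k. a i * (r * c i))" by (simp add: sum_distrib_left mult.left_commute)
    then show "r * x \<in> I" unfolding I_def by (intro CollectI exI[of _ "\<lambda>i. r * c i"]) simp
  qed
  moreover have "a ` {..<k} \<subseteq> I"
  proof
    fix x assume "x \<in> a ` {..<k}"
    then obtain j where j: "j < k" "x = a j" by blast
    have "(\<Sum>i<k. a i * (if i = j then 1 else 0)) = (\<Sum>i<k. if i = j then a j else 0)"
      by (intro sum.cong) auto
    then have "x = (\<Sum>i<k. a i * (if i = j then 1 else 0))" using j by simp
    then show "x \<in> I" unfolding I_def by (intro CollectI exI[of _ "\<lambda>i. if i = j then 1 else 0"]) simp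
  qed
  ultimately have "b \<in> I" using assms unfolding ideal_gen_eq_Inter by blast
  then show ?thesis using that unfolding I_def by blast
qed

text \<open>Rows without common vertices do not interact, so each is solved on its own vertices with
  the same coefficients \<open>c\<close>.\<close>

lemma sat_if_disjoint:
  fixes P Q :: "'r::{comm_ring_1, finite} pmf"
  assumes k: "k \<le> n" and H: "H \<in> set_pmf (hyper_pmf k n m)"
    and ls: "ls \<in> set_pmf (replicate_pmf m (pair_pmf (power_pmf k P) Q))"
    and noconn: "H \<notin> has_conn m 2"
    and labels: "\<And>g i. g < m \<Longrightarrow> i < k \<Longrightarrow> fst (ls ! g) i = a i" "\<And>g. g < m \<Longrightarrow> snd (ls ! g) = b"
    and b: "b = (\<Sum>i<k. a i * c i)"
  shows "sat_labelled n m H ls"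
proof (rule labelled_system(5)[OF k H ls refl])
  note H' = labelled_system(1)[OF k H ls refl]
  fix f assume f: "f < m"
  define x where "x = (\<lambda>v. if v \<in> H f then c (pos (H f) v) else 0)"
  have fin: "finite (H f)" "card (H f) = k" "H f \<subseteq> {..<n}" using edge_finite[OF H'[OF f]] by auto
  have "dot n (\<lambda>a. coef (H a) (fst (ls ! a))) f x = (\<Sum>v\<in>H f. fst (ls ! f) (pos (H f) v) * x v)"
    unfolding dot_def by (rule sum_coef[OF fin(3)])
  also have "\<dots> = (\<Sum>v\<in>H f. a (pos (H f) v) * c (pos (H f) v))"
    using labels(1)[OF f] pos_less[OF fin(1)] fin(2) by (intro sum.cong) (auto simp: x_def)
  also have "\<dots> = b"
    using sum.reindex_bij_betw[OF bij_betw_pos[OF fin(1)], of "\<lambda>i. a i * c i"] fin(2) b by simp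
  finally have "dot n (\<lambda>a. coef (H a) (fst (ls ! a))) f x = snd (ls ! f)" using labels(2)[OF f] by simp
  moreover have "dot n (\<lambda>a. coef (H a) (fst (ls ! a))) g x = 0" if g: "g < m" "g \<noteq> f" for g
  proof -
    have "H g \<inter> H f = {}"
    proof (rule ccontr)
      assume "H g \<inter> H f \<noteq> {}"
      then have "conn H [g, f]" using g by simp
      moreover have "[g, f] \<in> row_lists m 2" using f g by (simp add: row_lists_def)
      ultimately show False using noconn unfolding has_conn_def by blast
    qed
    then show ?thesis unfolding dot_def by (intro sum.neutral) (auto simp: coef_def x_def)
  qed
  ultimately show "(\<exists>v\<in>H f. \<exists>l. \<not> blocked H m (Suc l) f v \<and> set_pmf Q \<subseteq> level_ideal P l) \<or>
        (\<exists>x. dot n (\<lambda>a. coef (H a) (fst (ls ! a))) f x = snd (ls ! f) \<and>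
          (\<forall>g<m. g \<noteq> f \<longrightarrow> dot n (\<lambda>a. coef (H a) (fst (ls ! a))) g x = 0))" by blast
qed

text \<open>At level 0 the exponent is 0, so the number of rows is a constant. Boundedly many rows
  are pairwise disjoint with probability tending to 1, and each receives the solvable labels from
  \<open>A1\<close> with fixed positive probability.\<close>

lemma sat_liminf_level_0:
  fixes P Q :: "'r::{comm_ring_1, finite} pmf"
  assumes k: "1 \<le> k" and A1: "A1 k (power_pmf k P) Q"
  obtains \<delta> where "\<delta> > 0" "eventually (\<lambda>n. \<delta> \<le> sat_prob k (power_pmf k P) Q n m) at_top"
proof -
  obtain a b where a: "a \<in> set_pmf (power_pmf k P)" and b: "b \<in> set_pmf Q" "b \<in> ideal_gen (a ` {..<k})"
    using A1 unfolding A1_def by blast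
  obtain c where c: "b = (\<Sum>i<k. a i * c i)" using ideal_gen_image_combination[OF b(2)] .
  define L where "L = {l :: (nat \<Rightarrow> 'r) \<times> 'r. (\<forall>i<k. fst l i = a i) \<and> snd l = b}"
  define \<rho> where "\<rho> = (\<Prod>i<k. pmf P (a i)) * pmf Q b"
  have "a i \<in> set_pmf P" if "i < k" for i
    using a that unfolding power_pmf_def by (auto simp: set_Pi_pmf PiE_dflt_def)
  then have \<rho>: "\<rho> > 0" unfolding \<rho>_def using b by (intro mult_pos_pos prod_pos) (auto simp: pmf_positive)
  have \<rho>L: "\<rho> \<le> measure_pmf.prob (pair_pmf (power_pmf k P) Q) L"
    unfolding \<rho>_def by (rule prob_labels_ge) (simp add: L_def)
  define y where "y = (\<lambda>n. real m ^ 2 * (real (k\<^sup>2 * 2) / real n))"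
  have "y \<longlonglongrightarrow> 0" unfolding y_def by real_asymp
  then have "eventually (\<lambda>n. y n < 1 / 2) at_top" by (intro order_tendstoD) auto
  then have "eventually (\<lambda>n. \<rho> ^ m * (1 / 2) \<le> sat_prob k (power_pmf k P) Q n m) at_top"
    using eventually_ge_at_top[of k]
  proof eventually_elim
    case (elim n)
    have "measure_pmf.prob (hyper_pmf k n m) (has_conn m 2) \<le> y n"
      using prob_has_conn_le[OF k elim(2), of m 1] by (simp add: y_def numeral_2_eq_2)
    then have "1 / 2 \<le> measure_pmf.prob (hyper_pmf k n m) (- has_conn m 2)"
      using measure_pmf.prob_compl[of "has_conn m 2" "hyper_pmf k n m"] elim(1)
      by (simp add: Compl_eq_Diff_UNIV)
    then have "\<rho> ^ m * (1 / 2) \<le> \<rho> ^ m * measure_pmf.prob (hyper_pmf k n m) (- has_conn m 2)"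
      using \<rho> by (intro mult_left_mono) auto
    also have "\<dots> \<le> sat_prob k (power_pmf k P) Q n m"
    proof (rule sat_prob_ge_labels[where M = "\<lambda>_. {..<m}" and L = L])
      fix H ls assume *: "H \<in> set_pmf (hyper_pmf k n m)"
        "ls \<in> set_pmf (replicate_pmf m (pair_pmf (power_pmf k P) Q))" "H \<in> - has_conn m 2"
        and ls: "\<And>i. i \<in> {..<m} \<Longrightarrow> ls ! i \<in> L"
      show "sat_labelled n m H ls"
        by (rule sat_if_disjoint[OF elim(2) *(1,2) _ _ _ c]) (use *(3) ls in \<open>auto simp: L_def\<close>)
    qed (use \<rho> \<rho>L in auto)
    finally show ?case .
  qed
  moreover have "\<rho> ^ m * (1 / 2) > 0" using \<rho> by simp
  ultimately show ?thesis using that by blast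
qed

theorem theorem1p6:
  fixes k :: nat
    and P Q :: "'r::{comm_ring_1, finite} pmf"
  assumes "k \<ge> 3"
    and "principal_ring TYPE('r)"
    and "A1 k (power_pmf k P) Q"
    and "A2 k (power_pmf k P) Q"
  shows "(\<forall>m :: nat \<Rightarrow> nat.
            ((\<lambda>n. real (m n)) \<in> o(\<lambda>n. real n powr alpha k P Q) \<longrightarrow>
               (\<lambda>n. sat_prob k (power_pmf k P) Q n (m n)) \<longlonglongrightarrow> 1) \<and>
            ((\<lambda>n. real n powr alpha k P Q) \<in> o(\<lambda>n. real (m n)) \<longrightarrow>
               (\<lambda>n. sat_prob k (power_pmf k P) Q n (m n)) \<longlonglongrightarrow> 0)) \<and>
         (alpha k P Q < 1 \<longrightarrow> (\<forall>C::real. C > 0 \<longrightarrow>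
            (let p = (\<lambda>n. ereal (sat_prob k (power_pmf k P) Q n
                             (nat \<lceil>C * real n powr alpha k P Q\<rceil>)))
             in 0 < liminf p \<and> liminf p \<le> limsup p \<and> limsup p < 1)))"
proof (cases "level P Q")
  case infinity
  then have \<alpha>: "alpha k P Q = 1" by (simp add: alpha_def)
  have "(\<lambda>n. real n powr 1) = (\<lambda>n. real n)" by auto
  then show ?thesis
    unfolding \<alpha> using assms sat_tendsto_infinite[OF _ infinity] unsat_tendsto_infinite[OF _ assms(4)]
    by simp
next
  case (enat l)
  have k: "k \<ge> 2" "k \<ge> 1" using assms(1) by auto
  have "0 < liminf p \<and> liminf p \<le> limsup p \<and> limsup p < 1"
    if C: "C > 0" and p: "p = (\<lambda>n. ereal (sat_prob k (power_pmf k P) Q n (nat \<lceil>C * real n powr alpha k P Q\<rceil>)))"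
    for C p
  proof (intro conjI)
    obtain \<delta> where \<delta>: "\<delta> > 0"
      "eventually (\<lambda>n. \<delta> \<le> sat_prob k (power_pmf k P) Q n (nat \<lceil>C * real n powr alpha k P Q\<rceil>)) at_top"
    proof (cases l)
      case 0
      obtain \<delta> where \<delta>: "\<delta> > 0" "eventually (\<lambda>n. \<delta> \<le> sat_prob k (power_pmf k P) Q n (nat \<lceil>C\<rceil>)) at_top"
        using sat_liminf_level_0[OF k(2) assms(3)] .
      \<comment> \<open>\<open>real n powr 0\<close> is 1 only for positive \<open>n\<close>, hence
        the restriction to large \<open>n\<close>.\<close>
      have "eventually (\<lambda>n. \<delta> \<le> sat_prob k (power_pmf k P) Q n (nat \<lceil>C * real n powr alpha k P Q\<rceil>)) at_top"
        using \<delta>(2) eventually_gt_at_top[of 0]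
        by eventually_elim (use alpha_bounds(4)[OF k(2) enat 0] in simp)
      then show ?thesis using that \<delta>(1) by blast
    next
      case (Suc l')
      then show ?thesis using that sat_liminf_positive_level[OF k(1) _ C, of P Q l'] enat by metis
    qed
    have "eventually (\<lambda>n. ereal \<delta> \<le> p n) at_top" using \<delta>(2) by (simp add: p)
    then have "ereal \<delta> \<le> liminf p" by (rule Liminf_bounded)
    then show "0 < liminf p" using \<delta>(1) by (metis ereal_less(2) less_le_trans)
    obtain \<eta> where \<eta>: "\<eta> < 1"
      "eventually (\<lambda>n. sat_prob k (power_pmf k P) Q n (nat \<lceil>C * real n powr alpha k P Q\<rceil>) \<le> \<eta>) at_top"
      using unsat_limsup[OF assms(2) k(1) enat C] .
    have "eventually (\<lambda>n. p n \<le> ereal \<eta>) at_top" using \<eta>(2) by (simp add: p)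
    then have "limsup p \<le> ereal \<eta>" by (rule Limsup_bounded)
    then show "limsup p < 1" using \<eta>(1) by (metis ereal_less(3) le_less_trans)
    show "liminf p \<le> limsup p" by (rule Liminf_le_Limsup) simp
  qed
  then show ?thesis
    using sat_tendsto_finite[OF k(1) enat] unsat_tendsto_finite[OF assms(2) k(1) enat]
    unfolding Let_def by blast
qed

end
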